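(* Let $\varepsilon>0$ and $r\ge 1$. Let $A$ be the adjacency matrix of a random graph drawn from the stochastic block model $G(n,\frac{a}{n},\frac{b}{n})$. Assume that $$ (a-b)^2>C(a+b), $$ where $C$ is a (suitable) constant depending only on $\varepsilon$ and $r$. Choose $\tau$ to be the average degree of the graph, i.e. $\tau=(d_1+\cdots+d_n)/n$, where $d_i=\sum_{j=1}^n A_{ij}$ are the degrees of the vertices. Then with probability at least $1-e^{-r}$, the signs of the entries of the eigenvector corresponding to the second largest eigenvalue of the regularized Laplacian $\mathcal{L}(A_\tau)$ correctly estimate the partition of the vertices into the two communities, up to at most $\varepsilon n$ misclassified vertices.
   Context: The stochastic block model $G(n,\frac{a}{n},\frac{b}{n})$ (balanced planted partition model) is the random undirected graph on $n$ vertices defined as follows: the vertex set is partitioned into two communities of $n/2$ vertices each; edges are drawn independently, each pair of vertices in the same community being connected with probability $a/n$ and each pair of vertices in different communities with probability $b/n$. The adjacency matrix $A$ is the symmetric $n\times n$ matrix with $A_{ij}=1$ if $i$ and $j$ are connected by an edge and $A_{ij}=0$ otherwise (customarily with no self-loops, $A_{ii}=0$). For $\tau>0$, the regularized adjacency matrix is $A_\tau=A+\frac{\tau}{n}\mathbf{1}\mathbf{1}^{\mathsf{T}}$, where $\mathbf{1}\in\mathbb{R}^n$ is the all-ones vector. For a symmetric matrix $B$ with nonnegative entries and positive row sums, the (symmetric, normalized) Laplacian is $\mathcal{L}(B)=D^{-1/2}BD^{-1/2}$, where $D$ is the diagonal matrix whose $i$-th diagonal entry is the row sum $\sum_{j}B_{ij}$.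 So for $B=A_\tau$ the diagonal entries of $D$ are $d_i+\tau$. Estimating the partition by the signs of a vector $v\in\mathbb{R}^n$ means assigning the vertices to two estimated communities according to the sign of $v_i$. The number of misclassified vertices is counted up to a permutation (swap) of the two community labels.
   Formalization: The formal statement adds the assumption a > b; for a < b the claim fails (a = 0, b = n gives the complete bipartite graph, where the second largest eigenvalue is 0 and the partition vector belongs to the smallest eigenvalue −1/2). *)

theory Defs
  imports
    "HOL-Probability.Product_PMF"
    "Jordan_Normal_Form.Char_Poly"
begin

text \<open>
  The vertex set is \<open>{..<n}\<close> and a graph is the set of its edges, each edge being a
  two-element set of vertices. A partition into two communities is given by one of them,
  \<open>S\<close>; the other one is \<open>{..<n} - S\<close>.
\<close>

definition vertex_pairs :: "nat \<Rightarrow> nat set set" where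
  "vertex_pairs n = {e. e \<subseteq> {..<n} \<and> card e = 2}"

definition edge_prob :: "nat \<Rightarrow> nat set \<Rightarrow> real \<Rightarrow> real \<Rightarrow> nat set \<Rightarrow> real" where
  "edge_prob n S a b e = (if e \<subseteq> S \<or> e \<inter> S = {} then a / real n else b / real n)"

definition sbm :: "nat \<Rightarrow> nat set \<Rightarrow> real \<Rightarrow> real \<Rightarrow> nat set set pmf" where
  "sbm n S a b =
     map_pmf (\<lambda>x. {e \<in> vertex_pairs n. x e})
       (Pi_pmf (vertex_pairs n) False (\<lambda>e. bernoulli_pmf (edge_prob n S a b e)))"

definition adjacency_mat :: "nat \<Rightarrow> nat set set \<Rightarrow> real mat" where
  "adjacency_mat n E = mat n n (\<lambda>(i, j). if i \<noteq> j \<and> {i, j} \<in> E then 1 else 0)"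

definition row_sum :: "real mat \<Rightarrow> nat \<Rightarrow> real" where
  "row_sum B i = (\<Sum>j<dim_col B. B $$ (i, j))"

definition average_degree :: "real mat \<Rightarrow> real" where
  "average_degree A = (\<Sum>i<dim_row A. row_sum A i) / real (dim_row A)"

definition regularized_adjacency :: "real \<Rightarrow> real mat \<Rightarrow> real mat" where
  "regularized_adjacency \<tau> A =
     A + (\<tau> / real (dim_row A)) \<cdot>\<^sub>m mat (dim_row A) (dim_row A) (\<lambda>_. 1)"

text \<open>
  Only meaningful if all row sums are positive. In the degenerate case of the empty graph with
  \<open>\<tau> = 0\<close>, division by zero makes the Laplacian the zero matrix.
\<close>

definition laplacian :: "real mat \<Rightarrow> real mat" where
  "laplacian B =
     (let D' = mat_diag (dim_row B) (\<lambda>i. 1 / sqrt (row_sum B i)) in D' * B * D')"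

text \<open>
  Eigenvalues are counted with multiplicity. For the matrices of interest (symmetric and real, of
  size at least two) the characteristic polynomial splits over the reals, so that the list below
  contains all eigenvalues.
\<close>

definition eigenvalues_desc :: "real mat \<Rightarrow> real list" where
  "eigenvalues_desc M = rev (sorted_list_of_multiset (proots (char_poly M)))"

definition second_largest_eigenvalue :: "real mat \<Rightarrow> real" where
  "second_largest_eigenvalue M = eigenvalues_desc M ! 1"

definition community_sign :: "nat set \<Rightarrow> nat \<Rightarrow> real" where
  "community_sign S i = (if i \<in> S then 1 else -1)"

text \<open>
  The two arguments of \<open>min\<close> correspond to the two ways of naming the estimated communities.
  A vertex with \<open>v $ i = 0\<close> has no sign and is counted as misclassified for both of them, so
  a bound on this number holds however such vertices are assigned.
\<close>

definition misclassified :: "nat set \<Rightarrow> real vec \<Rightarrow> nat" where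
  "misclassified S v =
     min (card {i. i < dim_vec v \<and> sgn (v $ i) \<noteq> community_sign S i})
         (card {i. i < dim_vec v \<and> sgn (v $ i) \<noteq> - community_sign S i})"

end

theory Submission
  imports Defs
begin

text \<open>
  Write \<open>d = (a + b) / 2\<close>, let \<open>W\<close> be the centred adjacency matrix and \<open>d\<^sub>i\<close> the degrees.
  Substituting \<open>v = D\<^sup>1\<^sup>/\<^sup>2 x\<close> turns the spectral problem for the Laplacian into the pencil of
  \<open>A\<^sub>\<tau>\<close> and \<open>D\<close>, and the only noise estimate that is needed is one-sided: with high probability
  \<open>x\<^sup>T W x \<le> (K / \<surd>d) \<Sum>\<^sub>i (d + d\<^sub>i) x\<^sub>i\<^sup>2\<close> for all \<open>x\<close>. The weights \<open>d\<^sub>i\<close> on the right absorb the vertices of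
  large degree, so nothing has to be pruned and no logarithm is lost.

  For the estimate, normalise \<open>x\<close> so that the right-hand sum is of order \<open>d n\<close>. As \<open>W\<close> has zero diagonal,
  its form is affine in each coordinate, so the coordinates can be rounded to \<open>0\<close> or \<open>\<plusminus>2\<^sup>k\<close>.
  Pairs with \<open>\<bar>x\<^sub>i x\<^sub>j\<bar> \<le> \<surd>d\<close> are handled by exponential moments and a union bound over the at most
  \<open>e\<^sup>O\<^sup>(\<^sup>n\<^sup>)\<close> rounded vectors. For the remaining pairs only the edges matter. If the ratio of the two
  entries exceeds \<open>\<surd>d\<close>, the degree term dominates; otherwise the number of edges between two
  level sets is bounded by a Chernoff bound valid for all pairs of vertex sets simultaneously.

  The rest is deterministic. The second eigenvalue is at least \<open>(a - b) / (4 \<tau>) - O(1 / \<surd>d)\<close>, by the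
  min-max principle on the span of the all-ones and the community vector. Comparing with the upper
  bound forces the second eigenvector to be almost parallel to the community vector in the
  \<open>D\<close>-inner product.
\<close>

section \<open>Spectral theorem for real symmetric matrices\<close>

text \<open>The normalised Laplacian is what makes a one-sided estimate sufficient: in the variable
  x its Rayleigh quotient has the D-norm as denominator, and the weights of D are, up to a factor 2,
  at least the weights d + d_i of the noise bound. The noise has to be bounded from below on a
  single vector only, the community vector, which needs no union bound. Neither operator norms nor
  perturbation theory of eigenvectors enters: two estimates of the same quadratic form are compared.
  As (a - b)^2 is at most (a + b)^2, the hypothesis forces a + b > C, hence d > C / 2 and n >= a >=
  d. So d and n both exceed any constant that is needed, which makes failure probabilities of order
  1 / n harmless. Only the sum of squared degree deviations is controlled by Markov's inequality
  alone; its constant has to be of order e^r. The threshold sqrt d is replaced by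
  \<open>2 ^ q\<close> with \<open>4 ^ q\<close> within a factor 4 of d. It is then itself a dyadic
  level, and comparisons between levels become comparisons of exponents.\<close>

definition orthonormal_system :: "nat \<Rightarrow> nat \<Rightarrow> (nat \<Rightarrow> nat \<Rightarrow> real) \<Rightarrow> bool" where
  "orthonormal_system n k u \<longleftrightarrow>
     (\<forall>a<k. \<forall>b<k. (\<Sum>i<n. u a i * u b i) = (if a = b then 1 else 0))"

context
  fixes n k :: nat and u R :: "nat \<Rightarrow> nat \<Rightarrow> real"
  assumes on: "orthonormal_system n k u"
  defines "R \<equiv> \<lambda>i j. (if i = j then 1 else 0) - (\<Sum>a<k. u a i * u a j)"
begin

text \<open>\<open>R\<close> is the matrix of the orthogonal projection onto the complement of the
  span of \<open>u\<close>. Its columns are explicit candidates for further orthogonal vectors, so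
  that no dimension argument is needed.\<close>

lemma residual_orthogonal:
  assumes "a < k" "j < n"
  shows "(\<Sum>i<n. u a i * R i j) = 0"
proof -
  have "(\<Sum>i<n. u a i * R i j) =
      (\<Sum>i<n. if i = j then u a i else 0) - (\<Sum>i<n. \<Sum>b<k. u a i * u b i * u b j)"
    unfolding R_def sum_subtractf[symmetric] 
    by (intro sum.cong refl) (auto simp: algebra_simps sum_distrib_left)
  also have "(\<Sum>i<n. \<Sum>b<k. u a i * u b i * u b j) = (\<Sum>b<k. (\<Sum>i<n. u a i * u b i) * u b j)"
    unfolding sum_distrib_right by (rule sum.swap)
  also have "\<dots> = (\<Sum>b<k. if b = a then u a j else 0)"
    using on assms by (intro sum.cong refl) (auto simp: orthonormal_system_def)
  finally show ?thesis using assms by simp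
qed

text \<open>A projection is symmetric and idempotent, so a diagonal entry is the squared norm of its
  column.\<close>

lemma residual_norm:
  assumes "j < n"
  shows "(\<Sum>i<n. (R i j)\<^sup>2) = R j j"
proof -
  have "(\<Sum>i<n. (R i j)\<^sup>2) =
      (\<Sum>i<n. if i = j then R i j else 0) - (\<Sum>i<n. \<Sum>a<k. u a j * (u a i * R i j))"
    unfolding sum_subtractf[symmetric]
  proof (intro sum.cong refl)
    fix i
    have "(R i j)\<^sup>2 = ((if i = j then 1 else 0) - (\<Sum>a<k. u a i * u a j)) * R i j"
      by (simp add: power2_eq_square R_def)
    thus "(R i j)\<^sup>2 = (if i = j then R i j else 0) - (\<Sum>a<k. u a j * (u a i * R i j))"
      by (auto simp: algebra_simps sum_distrib_left)
  qed
  also have "(\<Sum>i<n. \<Sum>a<k. u a j * (u a i * R i j)) = (\<Sum>a<k. u a j * (\<Sum>i<n. u a i * R i j))"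
    unfolding sum_distrib_left by (rule sum.swap)
  also have "\<dots> = 0" using residual_orthogonal[OF _ assms] by simp
  finally show ?thesis using assms by simp
qed

lemma residual_trace: "(\<Sum>j<n. R j j) = real n - real k"
proof -
  have "(\<Sum>j<n. R j j) = real n - (\<Sum>j<n. \<Sum>a<k. u a j * u a j)"
    by (simp add: R_def sum_subtractf)
  also have "(\<Sum>j<n. \<Sum>a<k. u a j * u a j) = (\<Sum>a<k. \<Sum>j<n. u a j * u a j)"
    by (rule sum.swap)
  also have "\<dots> = (\<Sum>a<k. 1)"
    using on by (intro sum.cong refl) (auto simp: orthonormal_system_def)
  finally show ?thesis by simp
qed

text \<open>The trace of the projection is its rank, \<open>n - k\<close>. If it is positive, some
  diagonal entry is positive, and the column through it can be normalised.\<close>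

lemma ex_unit_orthogonal:
  assumes "k < n"
  shows "\<exists>x. (\<forall>i\<ge>n. x i = 0) \<and> (\<Sum>i<n. (x i)\<^sup>2) = (1::real) \<and> (\<forall>a<k. (\<Sum>i<n. u a i * x i) = 0)"
proof -
  have "(\<Sum>j<n. R j j) > 0" using assms by (simp add: residual_trace)
  then obtain j where j: "j < n" "R j j > 0"
    using sum_nonpos[of "{..<n}" "\<lambda>j. R j j"] by (force simp: not_le)
  define x where "x = (\<lambda>i. if i < n then R i j / sqrt (R j j) else 0)"
  have "(\<Sum>i<n. (x i)\<^sup>2) = (\<Sum>i<n. (R i j)\<^sup>2) / R j j"
    unfolding sum_divide_distrib x_def using j by (intro sum.cong refl) (simp add: power_divide)
  hence "(\<Sum>i<n. (x i)\<^sup>2) = 1" using j residual_norm[of j] by simp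
  moreover have "(\<Sum>i<n. u a i * x i) = 0" if "a < k" for a
  proof -
    have "(\<Sum>i<n. u a i * x i) = (\<Sum>i<n. u a i * R i j) / sqrt (R j j)"
      unfolding sum_divide_distrib x_def by (intro sum.cong refl) simp
    thus ?thesis using residual_orthogonal[OF that j(1)] by simp
  qed
  ultimately show ?thesis by (intro exI[of _ x]) (auto simp: x_def)
qed

text \<open>For \<open>k = n\<close> the trace vanishes, so all columns of the projection have norm
  zero.\<close>

lemma orthonormal_complete:
  assumes "k = n" "i < n" "j < n"
  shows "(\<Sum>a<n. u a i * u a j) = (if i = j then 1 else 0)"
proof -
  have nn: "R j j \<ge> 0" if "j < n" for j
    using residual_norm[OF that] by (metis sum_nonneg zero_le_power2)
  have "(\<Sum>j<n. R j j) = 0" using assms residual_trace by simp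
  hence "R j j = 0" using nn assms(3)
    by (subst (asm) sum_nonneg_eq_0_iff) auto
  hence "(\<Sum>i<n. (R i j)\<^sup>2) = 0" using residual_norm assms by simp
  hence "R i j = 0" using assms(2) by (subst (asm) sum_nonneg_eq_0_iff) auto
  thus ?thesis by (simp add: R_def assms(1))
qed

end

section \<open>Successive maximisation of the Rayleigh quotient\<close>

lemma compact_unit_orthogonal:
  fixes u :: "nat \<Rightarrow> nat \<Rightarrow> real"
  shows "compact {x. (\<forall>i\<ge>n. x i = 0) \<and> (\<Sum>i<n. (x i)\<^sup>2) = 1 \<and> (\<forall>a<k. (\<Sum>i<n. u a i * x i) = 0)}"
    (is "compact ?K")
proof -
  \<comment> \<open>Vectors are functions on all naturals. Fixing the coordinates from
    \<open>n\<close> on to zero places the unit sphere in a product of compact sets, to which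
    Tychonoff's theorem applies.\<close>
  let ?B = "PiE UNIV (\<lambda>i. if i < n then {-1..1} else {0::real})"
  have "compactin (product_topology (\<lambda>_. euclidean) UNIV) ?B"
    by (subst compactin_PiE) auto
  hence B: "compact ?B"
    by (simp add: euclidean_product_topology)
  have cont: "continuous_on UNIV (\<lambda>x::nat \<Rightarrow> real. x i)" for i
    by simp
  have c1: "continuous_on UNIV (\<lambda>x::nat \<Rightarrow> real. \<Sum>i<n. (x i)\<^sup>2)"
    by (rule continuous_on_sum, rule continuous_on_power, rule cont)
  have c2: "continuous_on UNIV (\<lambda>x::nat \<Rightarrow> real. \<Sum>i<n. u a i * x i)" for a
    by (rule continuous_on_sum, rule continuous_on_mult_left, rule cont)
  have cl: "closed {x::nat \<Rightarrow> real. f x = c}" if "continuous_on UNIV f" for f and c :: real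
    by (rule closed_Collect_eq, rule that, rule continuous_on_const)
  have "closed {x::nat \<Rightarrow> real. x i = 0}" for i by (rule cl[OF cont])
  moreover have "closed {x::nat \<Rightarrow> real. (\<Sum>i<n. (x i)\<^sup>2) = 1}" by (rule cl[OF c1])
  moreover have "closed {x. (\<Sum>i<n. u a i * x i) = 0}" for a by (rule cl[OF c2])
  moreover have "?K = (\<Inter>i\<in>{n..}. {x. x i = 0}) \<inter> {x. (\<Sum>i<n. (x i)\<^sup>2) = 1}
      \<inter> (\<Inter>a\<in>{..<k}. {x. (\<Sum>i<n. u a i * x i) = 0})" by auto
  ultimately have cl: "closed ?K" by (simp add: closed_Int closed_INT)
  have "?K \<subseteq> ?B"
  proof
    fix x assume x: "x \<in> ?K"
    have "\<bar>x i\<bar> \<le> 1" if "i < n" for i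
    proof -
      have "(x i)\<^sup>2 \<le> (\<Sum>i<n. (x i)\<^sup>2)" using that by (intro member_le_sum) auto
      thus ?thesis using x by (simp add: abs_square_le_1)
    qed
    thus "x \<in> ?B" using x by (auto simp: PiE_def Pi_def abs_le_iff minus_le_iff)
  qed
  hence "?B \<inter> ?K = ?K" by (rule Int_absorb1)
  thus ?thesis using compact_Int_closed[OF B cl] by argo
qed

text \<open>First-order optimality, tested in the single direction of the residual
  \<open>M x - l x\<close>: a step of length t gains 2 t N, with N the squared norm of the residual,
  against a term of order t^2, so N must vanish. \<open>F\<close> stands for the subspace on which
  \<open>x\<close> is optimal.\<close>

lemma rayleigh_maximizer_eigenvector:
  fixes M :: "nat \<Rightarrow> nat \<Rightarrow> real" and F :: "(nat \<Rightarrow> real) \<Rightarrow> bool"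
  assumes sym: "\<And>i j. i < n \<Longrightarrow> j < n \<Longrightarrow> M i j = M j i"
    and F: "\<And>y t. F y \<Longrightarrow> F (\<lambda>i. x i + t * y i)"
    and max: "\<And>y. F y \<Longrightarrow> (\<Sum>i<n. \<Sum>j<n. M i j * y i * y j) \<le> l * (\<Sum>i<n. (y i)\<^sup>2)"
    and eq: "(\<Sum>i<n. \<Sum>j<n. M i j * x i * x j) = l * (\<Sum>i<n. (x i)\<^sup>2)"
    and res: "F (\<lambda>i. (\<Sum>j<n. M i j * x j) - l * x i)"
    and "i < n"
  shows "(\<Sum>j<n. M i j * x j) = l * x i"
proof -
  define y where "y = (\<lambda>i. (\<Sum>j<n. M i j * x j) - l * x i)"
  define N where "N = (\<Sum>i<n. (y i)\<^sup>2)"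
  define P where "P = l * N - (\<Sum>i<n. \<Sum>j<n. M i j * y i * y j)"
  have *: "2 * t * N \<le> t\<^sup>2 * P" for t
  proof -
    have Fy: "F (\<lambda>i. x i + t * y i)" by (rule F) (use res in \<open>simp add: y_def\<close>)
    have sw: "(\<Sum>i<n. \<Sum>j<n. M i j * y i * x j) = (\<Sum>i<n. \<Sum>j<n. M i j * x i * y j)"
      by (subst sum.swap) (intro sum.cong refl, auto simp: sym)
    have "(\<Sum>i<n. \<Sum>j<n. M i j * (x i + t * y i) * (x j + t * y j)) =
        (\<Sum>i<n. \<Sum>j<n. M i j * x i * x j) + t * (\<Sum>i<n. \<Sum>j<n. M i j * y i * x j)
        + t * (\<Sum>i<n. \<Sum>j<n. M i j * x i * y j) + t\<^sup>2 * (\<Sum>i<n. \<Sum>j<n. M i j * y i * y j)"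
      unfolding sum_distrib_left sum.distrib[symmetric]
      by (intro sum.cong refl) (simp add: algebra_simps power2_eq_square)
    also have "\<dots> = (\<Sum>i<n. \<Sum>j<n. M i j * x i * x j) + 2 * t * (\<Sum>i<n. \<Sum>j<n. M i j * y i * x j)
        + t\<^sup>2 * (\<Sum>i<n. \<Sum>j<n. M i j * y i * y j)"
      unfolding sw by simp
    finally have 1: "(\<Sum>i<n. \<Sum>j<n. M i j * (x i + t * y i) * (x j + t * y j)) =
        l * (\<Sum>i<n. (x i)\<^sup>2) + 2 * t * (\<Sum>i<n. \<Sum>j<n. M i j * y i * x j)
        + t\<^sup>2 * (\<Sum>i<n. \<Sum>j<n. M i j * y i * y j)" using eq by simp
    have 2: "(\<Sum>i<n. (x i + t * y i)\<^sup>2) = (\<Sum>i<n. (x i)\<^sup>2) + 2 * t * (\<Sum>i<n. x i * y i) + t\<^sup>2 * N"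
      unfolding N_def sum_distrib_left sum.distrib[symmetric]
      by (intro sum.cong refl) (simp add: algebra_simps power2_eq_square)
    have 3: "(\<Sum>i<n. \<Sum>j<n. M i j * y i * x j) - l * (\<Sum>i<n. x i * y i) = N"
      unfolding N_def sum_distrib_left sum_subtractf[symmetric]
    proof (intro sum.cong refl)
      fix i
      have "(\<Sum>j<n. M i j * y i * x j) - l * (x i * y i) = y i * ((\<Sum>j<n. M i j * x j) - l * x i)"
        by (simp add: sum_distrib_left algebra_simps)
      thus "(\<Sum>j<n. M i j * y i * x j) - l * (x i * y i) = (y i)\<^sup>2"
        by (simp add: y_def power2_eq_square)
    qed
    have "(\<Sum>i<n. \<Sum>j<n. M i j * (x i + t * y i) * (x j + t * y j)) \<le> l * (\<Sum>i<n. (x i + t * y i)\<^sup>2)"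
      using max[OF Fy] by simp
    hence "2 * t * ((\<Sum>i<n. \<Sum>j<n. M i j * y i * x j) - l * (\<Sum>i<n. x i * y i)) \<le> t\<^sup>2 * P"
      unfolding 1 2 P_def by (simp add: algebra_simps)
    thus ?thesis using 3 by simp
  qed
  have N0: "N \<ge> 0" unfolding N_def by (intro sum_nonneg) auto
  have "N = 0"
  proof (rule ccontr)
    assume "N \<noteq> 0"
    hence "N > 0" using N0 by simp
    \<comment> \<open>With this \<open>t\<close> the product \<open>t * (\<bar>P\<bar> + 1)\<close>
      equals \<open>N\<close>, which contradicts \<open>2 * N \<le> t * P\<close>. The summand 1
      covers \<open>P = 0\<close>.\<close>
    define t where "t = N / (\<bar>P\<bar> + 1)"
    have t: "t > 0" using \<open>N > 0\<close> by (simp add: t_def add_nonneg_pos)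
    have "2 * N \<le> t * P" using *[of t] t by (simp add: power2_eq_square)
    also have "\<dots> \<le> t * (\<bar>P\<bar> + 1)" using t by (intro mult_left_mono) auto
    also have "\<dots> = N" by (simp add: t_def add_nonneg_eq_0_iff)
    finally show False using \<open>N > 0\<close> by simp
  qed
  hence "y i = 0" unfolding N_def using \<open>i < n\<close> by (subst (asm) sum_nonneg_eq_0_iff) auto
  thus ?thesis by (simp add: y_def)
qed

theorem real_symmetric_eigenbasis:
  fixes M :: "nat \<Rightarrow> nat \<Rightarrow> real"
  assumes sym: "\<And>i j. i < n \<Longrightarrow> j < n \<Longrightarrow> M i j = M j i"
  obtains u l where "orthonormal_system n n u"
    and "\<And>a i. a < n \<Longrightarrow> i < n \<Longrightarrow> (\<Sum>j<n. M i j * u a j) = l a * u a i"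
    and "\<And>a b. a \<le> b \<Longrightarrow> b < n \<Longrightarrow> l b \<le> l a"
proof -
  define K where "K = (\<lambda>(k::nat) (u::nat \<Rightarrow> nat \<Rightarrow> real). {x::nat \<Rightarrow> real. (\<forall>i\<ge>n. x i = 0) \<and> (\<Sum>i<n. (x i)\<^sup>2) = (1::real) \<and>
      (\<forall>a<k. (\<Sum>i<n. u a i * x i) = 0)})" 
  define q where "q = (\<lambda>x. \<Sum>i<n. \<Sum>j<n. M i j * x i * x j)"
  \<comment> \<open>The last conjunct makes the eigenvalues decrease: every unit vector still
    available, in particular the next maximiser, has a form value of at most \<open>l a\<close> for
    each earlier \<open>a\<close>.\<close>
  have "\<exists>u l. orthonormal_system n k u \<and>
      (\<forall>a<k. \<forall>i<n. (\<Sum>j<n. M i j * u a j) = l a * u a i) \<and>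
      (\<forall>b<k. \<forall>a\<le>b. l b \<le> l a) \<and> (\<forall>a<k. \<forall>x\<in>K k u. q x \<le> l a)" if "k \<le> n" for k
    using that
  proof (induction k)
    case 0
    show ?case by (auto simp: orthonormal_system_def)
  next
    case (Suc k)
    obtain u l where *: "orthonormal_system n k u"
      "\<forall>a<k. \<forall>i<n. (\<Sum>j<n. M i j * u a j) = l a * u a i"
      "\<forall>b<k. \<forall>a\<le>b. l b \<le> l a" "\<forall>a<k. \<forall>x\<in>K k u. q x \<le> l a"
      using Suc.IH[OF Suc_leD[OF Suc.prems]] by blast
    have on: "orthonormal_system n k u"
      and ev: "\<And>a i. a < k \<Longrightarrow> i < n \<Longrightarrow> (\<Sum>j<n. M i j * u a j) = l a * u a i"
      and dec: "\<And>a b. b < k \<Longrightarrow> a \<le> b \<Longrightarrow> l b \<le> l a"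
      and bnd: "\<And>a x. a < k \<Longrightarrow> x \<in> K k u \<Longrightarrow> q x \<le> l a"
      using * by auto
    have "compact (K k u)" unfolding K_def by (rule compact_unit_orthogonal)
    moreover have "K k u \<noteq> {}" using ex_unit_orthogonal[OF on] Suc.prems by (auto simp: K_def)
    moreover have "continuous_on (K k u) q" unfolding q_def
      by (intro continuous_on_sum continuous_on_mult continuous_on_const
          continuous_on_subset[OF continuous_on_product_coordinates subset_UNIV])
    ultimately obtain x where x: "x \<in> K k u" and xmax: "\<And>y. y \<in> K k u \<Longrightarrow> q y \<le> q x"
      using continuous_attains_sup by metis
    have xn: "(\<Sum>i<n. (x i)\<^sup>2) = 1" and xo: "\<And>a. a < k \<Longrightarrow> (\<Sum>i<n. u a i * x i) = 0"
      using x by (auto simp: K_def)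
    define F where "F = (\<lambda>y. \<forall>a<k. (\<Sum>i<n. u a i * y i) = 0)"
    have xev: "(\<Sum>j<n. M i j * x j) = q x * x i" if "i < n" for i
    proof (rule rayleigh_maximizer_eigenvector[where F = F, OF sym])
      show "F (\<lambda>i. x i + t * y i)" if "F y" for y t
      proof -
        have "(\<Sum>i<n. u a i * (x i + t * y i)) = (\<Sum>i<n. u a i * x i) + t * (\<Sum>i<n. u a i * y i)" for a
          unfolding sum_distrib_left sum.distrib[symmetric] by (intro sum.cong refl) (simp add: algebra_simps)
        thus ?thesis using that xo by (auto simp: F_def)
      qed
      show "(\<Sum>i<n. \<Sum>j<n. M i j * y i * y j) \<le> q x * (\<Sum>i<n. (y i)\<^sup>2)" if "F y" for y
      proof (cases "(\<Sum>i<n. (y i)\<^sup>2) = 0")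
        case True
        hence "y i = 0" if "i < n" for i using that by (subst (asm) sum_nonneg_eq_0_iff) auto
        thus ?thesis by simp
      next
        case False
        define N where "N = (\<Sum>i<n. (y i)\<^sup>2)"
        have N: "N > 0" using False sum_nonneg[of "{..<n}" "\<lambda>i. (y i)\<^sup>2"] by (simp add: N_def)
        define z where "z = (\<lambda>i. if i < n then y i / sqrt N else 0)"
        have "(\<Sum>i<n. (z i)\<^sup>2) = (\<Sum>i<n. (y i)\<^sup>2) / N"
          unfolding sum_divide_distrib z_def using N by (intro sum.cong refl) (simp add: power_divide)
        moreover have "(\<Sum>i<n. u a i * z i) = (\<Sum>i<n. u a i * y i) / sqrt N" for a
          unfolding sum_divide_distrib z_def by (intro sum.cong refl) simp
        ultimately have "z \<in> K k u" using that N by (auto simp: K_def F_def N_def z_def)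
        hence "q z \<le> q x" by (rule xmax)
        moreover have "q z = (\<Sum>i<n. \<Sum>j<n. M i j * y i * y j) / N"
          unfolding q_def sum_divide_distrib z_def using N by (intro sum.cong refl) simp
        ultimately show ?thesis using N by (simp add: N_def field_simps)
      qed
      show "(\<Sum>i<n. \<Sum>j<n. M i j * x i * x j) = q x * (\<Sum>i<n. (x i)\<^sup>2)" using xn by (simp add: q_def)
      \<comment> \<open>A symmetric matrix maps the complement of its eigenvectors into
        itself.\<close>
      show "F (\<lambda>i. (\<Sum>j<n. M i j * x j) - q x * x i)" unfolding F_def
      proof (intro allI impI)
        fix a assume a: "a < k"
        have "(\<Sum>i<n. u a i * ((\<Sum>j<n. M i j * x j) - q x * x i)) =
            (\<Sum>i<n. \<Sum>j<n. u a i * M i j * x j) - q x * (\<Sum>i<n. u a i * x i)"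
          unfolding sum_distrib_left sum_subtractf[symmetric]
          by (intro sum.cong refl) (simp add: algebra_simps sum_distrib_left)
        also have "(\<Sum>i<n. \<Sum>j<n. u a i * M i j * x j) = (\<Sum>j<n. \<Sum>i<n. u a i * M i j * x j)"
          by (rule sum.swap)
        also have "\<dots> = (\<Sum>j<n. (\<Sum>i<n. M j i * u a i) * x j)"
          unfolding sum_distrib_right by (intro sum.cong refl) (auto simp: sym)
        also have "\<dots> = l a * (\<Sum>j<n. u a j * x j)"
          unfolding sum_distrib_left using ev a by (intro sum.cong refl) simp
        finally show "(\<Sum>i<n. u a i * ((\<Sum>j<n. M i j * x j) - q x * x i)) = 0" using xo[OF a] by simp
      qed
    qed (use that in auto)
    define u' where "u' = u(k := x)"
    define l' where "l' = l(k := q x)"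
    have "orthonormal_system n (Suc k) u'"
      unfolding orthonormal_system_def
    proof (intro allI impI)
      fix a b assume "a < Suc k" "b < Suc k"
      thus "(\<Sum>i<n. u' a i * u' b i) = (if a = b then 1 else 0)"
        using on xn xo[of a] xo[of b]
        by (auto simp: u'_def less_Suc_eq orthonormal_system_def power2_eq_square mult.commute)
    qed
    moreover have "\<forall>a<Suc k. \<forall>i<n. (\<Sum>j<n. M i j * u' a j) = l' a * u' a i"
      using ev xev by (auto simp: u'_def l'_def less_Suc_eq)
    moreover have "\<forall>b<Suc k. \<forall>a\<le>b. l' b \<le> l' a"
      using dec bnd[OF _ x] by (auto simp: l'_def less_Suc_eq)
    moreover have "\<forall>a<Suc k. \<forall>y\<in>K (Suc k) u'. q y \<le> l' a"
    proof (intro allI impI ballI)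
      fix a y assume a: "a < Suc k" and y: "y \<in> K (Suc k) u'"
      have "y \<in> K k u" using y by (auto simp: K_def u'_def less_Suc_eq)
      thus "q y \<le> l' a" using a bnd xmax by (auto simp: l'_def less_Suc_eq)
    qed
    ultimately show ?case by blast
  qed
  from this[of n] show ?thesis using that by (metis order.refl)
qed

section \<open>Eigenbasis and characteristic polynomial\<close>

lemma eigenvalues_desc_eigenbasis:
  fixes M :: "real mat"
  assumes M: "M \<in> carrier_mat n n" and on: "orthonormal_system n n u"
    and ev: "\<And>a i. a < n \<Longrightarrow> i < n \<Longrightarrow> (\<Sum>j<n. M $$ (i, j) * u a j) = l a * u a i"
    and dec: "\<And>a b. a \<le> b \<Longrightarrow> b < n \<Longrightarrow> l b \<le> l a"
  shows "eigenvalues_desc M = map l [0..<n]"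
proof -
  define U where "U = mat n n (\<lambda>(i, a). u a i)"
  define D where "D = mat n n (\<lambda>(i, j). if i = j then l i else 0)"
  have U: "U \<in> carrier_mat n n" "U\<^sup>T \<in> carrier_mat n n" and D: "D \<in> carrier_mat n n"
    by (auto simp: U_def D_def)
  have UU: "U\<^sup>T * U = 1\<^sub>m n"
    using on by (intro eq_matI) (auto simp: U_def scalar_prod_def orthonormal_system_def lessThan_atLeast0)
  hence UU': "U * U\<^sup>T = 1\<^sub>m n" using U by (rule_tac mat_mult_left_right_inverse) auto
  have MU: "M * U = U * D"
  proof (rule eq_matI)
    fix i a assume "i < dim_row (U * D)" "a < dim_col (U * D)"
    hence i: "i < n" and a: "a < n" using U D by auto
    have "(M * U) $$ (i, a) = (\<Sum>j<n. M $$ (i, j) * u a j)"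
      using M i a by (simp add: U_def scalar_prod_def lessThan_atLeast0)
    also have "\<dots> = u a i * l a" using ev i a by simp
    also have "\<dots> = (\<Sum>b<n. u b i * (if b = a then l b else 0))"
      using a by (simp add: if_distrib[of "(*) _"] cong: if_cong)
    also have "\<dots> = (U * D) $$ (i, a)"
      using i a by (auto simp: U_def D_def scalar_prod_def lessThan_atLeast0 intro!: sum.cong)
    finally show "(M * U) $$ (i, a) = (U * D) $$ (i, a)" .
  qed (use M U D in simp_all)
  have "M * (U * U\<^sup>T) = (M * U) * U\<^sup>T" by (rule assoc_mult_mat[symmetric, OF M U])
  hence MUD: "M = U * D * U\<^sup>T" using UU' MU right_mult_one_mat[OF M] by metis
  hence "similar_mat M D"
    using M U D UU UU' MUD unfolding similar_mat_def similar_mat_wit_def Let_def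
    by (intro exI[of _ U] exI[of _ "U\<^sup>T"]) (simp only: carrier_matD(1), simp)
  hence "char_poly M = char_poly D" by (rule char_poly_similar)
  also have "\<dots> = (\<Prod>a\<leftarrow>diag_mat D. [:- a, 1:])"
    by (rule char_poly_upper_triangular[OF D]) (auto simp: D_def upper_triangular_def)
  also have "diag_mat D = map l [0..<n]" by (auto simp: diag_mat_def D_def)
  finally have cp: "char_poly M = (\<Prod>a\<leftarrow>map l [0..<n]. [:- a, 1:])" .
  have "proots (\<Prod>a\<leftarrow>xs. [:- a, 1:]) = mset xs" for xs :: "real list"
  proof (induction xs)
    case (Cons a xs)
    have "(\<Prod>a\<leftarrow>xs. [:- a, 1:]) \<noteq> (0 :: real poly)" by (auto simp: prod_list_zero_iff)
    thus ?case using Cons by (simp add: proots_mult del: mult_pCons_left)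
  qed simp
  hence "proots (char_poly M) = mset (map l [0..<n])" using cp by metis
  moreover have "sorted (rev (map l [0..<n]))"
    by (auto simp: rev_map sorted_iff_nth_mono rev_nth intro!: dec)
  ultimately show ?thesis unfolding eigenvalues_desc_def
    by (metis mset_rev rev_rev_ident sorted_list_of_multiset_mset sorted_sort_id)
qed

section \<open>Exponential moments of the block model\<close>

text \<open>Each unordered pair contributes at both of its endpoints. This turns row sums such as
  degrees into sums over \<open>i < j\<close>, where every edge indicator occurs once and the
  indicators are independent.\<close>

lemma sum_offdiag_symmetric:
  fixes F :: "nat \<Rightarrow> nat \<Rightarrow> real"
  assumes "\<And>i j. F i j = F j i"
  shows "(\<Sum>j<n. \<Sum>i<j. (y i + y j) * F i j) = (\<Sum>i<n. y i * (\<Sum>j<n. if i \<noteq> j then F i j else 0))"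
proof (induction n)
  case (Suc n)
  have "(\<Sum>i<Suc n. y i * (\<Sum>j<Suc n. if i \<noteq> j then F i j else 0)) =
     (\<Sum>i<n. y i * (\<Sum>j<n. if i \<noteq> j then F i j else 0) + y i * F i n) + y n * (\<Sum>j<n. F n j)"
    by (auto simp: algebra_simps intro!: sum.cong)
  also have "\<dots> = (\<Sum>i<n. y i * (\<Sum>j<n. if i \<noteq> j then F i j else 0)) + (\<Sum>i<n. (y i + y n) * F i n)"
    by (simp add: sum.distrib sum_distrib_left algebra_simps assms[of n])
  finally show ?case using Suc.IH by simp
qed simp

lemma sum_offdiag_double:
  fixes F :: "nat \<Rightarrow> nat \<Rightarrow> real"
  assumes "\<And>i j. F i j = F j i"
  shows "(\<Sum>i<n. \<Sum>j<n. if i \<noteq> j then F i j else 0) = 2 * (\<Sum>j<n. \<Sum>i<j. F i j)"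
  using sum_offdiag_symmetric[OF assms, where y = "\<lambda>_. 1" and n = n] by (simp add: sum_distrib_left)

text \<open>The two sides differ by the diagonal part, a sum of squares, so \<open>w\<close> may
  have any sign.\<close>

lemma sum_pairs_product_le:
  fixes w :: "nat \<Rightarrow> real"
  shows "2 * (\<Sum>j<n. \<Sum>i<j. w i * w j) \<le> (\<Sum>i<n. w i)\<^sup>2"
proof (induction n)
  case (Suc n)
  have "2 * (\<Sum>j<Suc n. \<Sum>i<j. w i * w j) \<le> (\<Sum>i<n. w i)\<^sup>2 + 2 * (\<Sum>i<n. w i) * w n"
    using Suc.IH by (simp add: sum_distrib_right sum_distrib_left distrib_left mult.assoc)
  also have "\<dots> \<le> (\<Sum>i<Suc n. w i)\<^sup>2" by (simp add: power2_sum)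
  finally show ?case .
qed simp

lemma sum_vertex_pairs:
  "(\<Sum>e\<in>vertex_pairs n. f e) = (\<Sum>j<n. \<Sum>i<j. f {i, j})"
proof -
  let ?I = "Sigma {..<n} (\<lambda>j. {..<j})" and ?h = "\<lambda>x. {snd x, fst x}"
  have "bij_betw ?h ?I (vertex_pairs n)"
  proof (rule bij_betwI')
    fix x y assume "x \<in> ?I" "y \<in> ?I"
    thus "(?h x = ?h y) = (x = y)" by (auto simp: doubleton_eq_iff)
  next
    fix x assume "x \<in> ?I"
    thus "?h x \<in> vertex_pairs n" by (auto simp: vertex_pairs_def)
  next
    fix e assume "e \<in> vertex_pairs n"
    then obtain i j where "e = {i, j}" "i \<noteq> j" "i < n" "j < n"
      by (auto simp: vertex_pairs_def card_2_iff)
    hence "(max i j, min i j) \<in> ?I" "e = ?h (max i j, min i j)" by (auto simp: max_def min_def)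
    thus "\<exists>x\<in>?I. e = ?h x" by blast
  qed
  from sum.reindex_bij_betw[OF this, of f] show ?thesis
    by (simp add: sum.Sigma case_prod_unfold)
qed

lemma finite_vertex_pairs [simp]: "finite (vertex_pairs n)"
  by (rule finite_subset[of _ "Pow {..<n}"]) (auto simp: vertex_pairs_def)

lemma finite_set_pmf_sbm [simp]: "finite (set_pmf (sbm n S a b))"
  by (rule finite_subset[of _ "Pow (vertex_pairs n)"]) (auto simp: sbm_def)

lemma prob_le_expectation:
  fixes f :: "'a \<Rightarrow> real"
  assumes "finite (set_pmf p)" and "\<And>x. f x \<ge> 0" and "\<And>x. P x \<Longrightarrow> f x \<ge> 1"
  shows "measure_pmf.prob p {x. P x} \<le> measure_pmf.expectation p f"
proof -
  have "measure_pmf.prob p {x. P x} = measure_pmf.expectation p (indicat_real {x. P x})" by simp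
  also have "\<dots> \<le> measure_pmf.expectation p f"
    using assms by (intro integral_mono integrable_measure_pmf_finite) (auto simp: indicator_def)
  finally show ?thesis .
qed

text \<open>Union bound and Markov's inequality in one: each bad event is dominated by a nonnegative
  function that is at least 1 on it. These functions will be exponentials, indexed by rounded
  vectors or by pairs of vertex sets.\<close>

lemma prob_ex_le_sum_expectation:
  fixes f :: "'i \<Rightarrow> 'a \<Rightarrow> real"
  assumes "finite (set_pmf p)" "finite I" and "\<And>i x. i \<in> I \<Longrightarrow> f i x \<ge> 0"
    and "\<And>i x. i \<in> I \<Longrightarrow> P i x \<Longrightarrow> f i x \<ge> 1"
  shows "measure_pmf.prob p {x. \<exists>i\<in>I. P i x} \<le> (\<Sum>i\<in>I. measure_pmf.expectation p (f i))"
proof -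
  have "measure_pmf.prob p {x. \<exists>i\<in>I. P i x} \<le> measure_pmf.expectation p (\<lambda>x. \<Sum>i\<in>I. f i x)"
  proof (rule prob_le_expectation)
    fix x assume "\<exists>i\<in>I. P i x"
    then obtain i where i: "i \<in> I" "P i x" by blast
    hence "1 \<le> f i x" by (rule assms)
    also have "\<dots> \<le> (\<Sum>i\<in>I. f i x)" using i assms by (intro member_le_sum) auto
    finally show "1 \<le> (\<Sum>i\<in>I. f i x)" .
  qed (use assms in \<open>auto intro: sum_nonneg\<close>)
  thus ?thesis using assms(1)
    by (subst (asm) Bochner_Integration.integral_sum) (auto intro: integrable_measure_pmf_finite)
qed

lemma exp_le_quadratic:
  fixes x :: real
  assumes "\<bar>x\<bar> \<le> 1"
  shows "exp x \<le> 1 + x + x\<^sup>2"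
proof (cases "x \<ge> 0")
  case True
  thus ?thesis using assms by (intro exp_bound) auto
next
  case False
  have "exp x = 1 / exp (- x)" by (simp add: exp_minus field_simps)
  also have "\<dots> \<le> 1 / (1 - x)" using False exp_ge_add_one_self[of "-x"] by (intro divide_left_mono) auto
  also have "\<dots> \<le> 1 + x + x\<^sup>2"
  proof -
    have "(1 + x + x\<^sup>2) * (1 - x) = 1 - x ^ 3" by (simp add: algebra_simps power2_eq_square power3_eq_cube)
    moreover have "x ^ 3 \<le> 0" using False by (simp add: power_le_zero_eq)
    ultimately show ?thesis using False by (simp add: divide_le_eq)
  qed
  finally show ?thesis .
qed

locale planted_partition =
  fixes n :: nat and S :: "nat set" and a b :: real
  assumes n: "n > 0" and S: "S \<subseteq> {..<n}" "2 * card S = n"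
    and b: "0 \<le> b" and ba: "b < a" and an: "a \<le> real n"
begin

definition d :: real where "d = (a + b) / 2"

abbreviation p :: "nat \<Rightarrow> nat \<Rightarrow> real" where "p i j \<equiv> edge_prob n S a b {i, j}"

definition W :: "nat set set \<Rightarrow> nat \<Rightarrow> nat \<Rightarrow> real" where
  "W E i j = of_bool ({i, j} \<in> E) - p i j"

lemma d_pos: "d > 0" using b ba by (simp add: d_def)

lemma edge_prob_bounds:
  "0 \<le> edge_prob n S a b e" "edge_prob n S a b e \<le> 1" "edge_prob n S a b e \<le> 2 * d / n"
  using n b ba an by (auto simp: edge_prob_def d_def field_simps)

lemma W_commute: "W E i j = W E j i"
  by (simp add: W_def insert_commute)

lemma sbm_exp_moment:
  fixes g :: "nat \<Rightarrow> nat \<Rightarrow> real"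
  shows "measure_pmf.expectation (sbm n S a b) (\<lambda>E. exp (\<Sum>j<n. \<Sum>i<j. g i j * of_bool ({i, j} \<in> E)))
      \<le> exp (\<Sum>j<n. \<Sum>i<j. p i j * (exp (g i j) - 1))"
proof -
  \<comment> \<open>Edges are sets, but \<open>g\<close> takes ordered pairs. Evaluating it at
    minimum and maximum allows \<open>g\<close> to be asymmetric, as it is when edges between two
    different sets are counted.\<close>
  define \<theta> where "\<theta> = (\<lambda>e. g (Min e) (Max e))"
  let ?P = "edge_prob n S a b" and ?V = "vertex_pairs n"
  have \<theta>: "\<theta> {i, j} = g i j" if "i < j" for i j using that by (simp add: \<theta>_def)
  have ex: "exp (\<Sum>j<n. \<Sum>i<j. g i j * of_bool ({i, j} \<in> {e \<in> ?V. x e})) = (\<Prod>e\<in>?V. exp (\<theta> e * of_bool (x e)))" for x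
  proof -
    have "(\<Sum>j<n. \<Sum>i<j. g i j * of_bool ({i, j} \<in> {e \<in> ?V. x e})) = (\<Sum>e\<in>?V. \<theta> e * of_bool (e \<in> {e \<in> ?V. x e}))"
      unfolding sum_vertex_pairs by (intro sum.cong refl) (auto simp: \<theta>)
    also have "\<dots> = (\<Sum>e\<in>?V. \<theta> e * of_bool (x e))" by (intro sum.cong refl) auto
    finally show ?thesis by (simp only: exp_sum finite_vertex_pairs)
  qed
  have "measure_pmf.expectation (sbm n S a b) (\<lambda>E. exp (\<Sum>j<n. \<Sum>i<j. g i j * of_bool ({i, j} \<in> E))) =
      measure_pmf.expectation (Pi_pmf ?V False (\<lambda>e. bernoulli_pmf (?P e))) (\<lambda>x. \<Prod>e\<in>?V. exp (\<theta> e * of_bool (x e)))"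
    unfolding sbm_def integral_map_pmf ex ..
  also have "\<dots> = (\<Prod>e\<in>?V. measure_pmf.expectation (bernoulli_pmf (?P e)) (\<lambda>v. exp (\<theta> e * of_bool v)))"
    by (rule expectation_prod_Pi_pmf) (auto intro: integrable_measure_pmf_finite)
  also have "\<dots> = (\<Prod>e\<in>?V. 1 + ?P e * (exp (\<theta> e) - 1))"
    using edge_prob_bounds by (intro prod.cong refl) (simp add: algebra_simps)
  also have "\<dots> \<le> (\<Prod>e\<in>?V. exp (?P e * (exp (\<theta> e) - 1)))"
  proof (rule prod_mono, intro conjI)
    fix e
    have "1 + ?P e * (exp (\<theta> e) - 1) = (1 - ?P e) + ?P e * exp (\<theta> e)" by (simp add: algebra_simps)
    also have "\<dots> \<ge> 0" using edge_prob_bounds[of e] by (intro add_nonneg_nonneg mult_nonneg_nonneg) auto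
    finally show "0 \<le> 1 + ?P e * (exp (\<theta> e) - 1)" .
  qed (rule exp_ge_add_one_self)
  also have "\<dots> = exp (\<Sum>e\<in>?V. ?P e * (exp (\<theta> e) - 1))" by (simp add: exp_sum)
  also have "(\<Sum>e\<in>?V. ?P e * (exp (\<theta> e) - 1)) = (\<Sum>j<n. \<Sum>i<j. p i j * (exp (g i j) - 1))"
    unfolding sum_vertex_pairs by (intro sum.cong refl) (auto simp: \<theta>)
  finally show ?thesis .
qed

text \<open>Centring cancels the linear term of the exponent, and for coefficients of modulus at
  most 1 the remainder \<open>exp g - 1 - g\<close> is at most \<open>g\<^sup>2\<close>. The
  exponent is thus a proxy for the variance.\<close>

lemma sbm_centered_exp_moment:
  fixes g :: "nat \<Rightarrow> nat \<Rightarrow> real"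
  assumes g: "\<And>i j. i < j \<Longrightarrow> j < n \<Longrightarrow> \<bar>g i j\<bar> \<le> 1"
  shows "measure_pmf.expectation (sbm n S a b)
      (\<lambda>E. exp (\<Sum>j<n. \<Sum>i<j. g i j * W E i j))
      \<le> exp (\<Sum>j<n. \<Sum>i<j. p i j * (g i j)\<^sup>2)"
proof -
  let ?s = "\<Sum>j<n. \<Sum>i<j. p i j * g i j"
  have "(\<Sum>j<n. \<Sum>i<j. g i j * W E i j) =
      (\<Sum>j<n. \<Sum>i<j. g i j * of_bool ({i, j} \<in> E)) - ?s" for E
    unfolding sum_subtractf[symmetric] by (intro sum.cong refl) (simp only: W_def right_diff_distrib mult.commute)
  hence "measure_pmf.expectation (sbm n S a b)
      (\<lambda>E. exp (\<Sum>j<n. \<Sum>i<j. g i j * W E i j)) =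
      measure_pmf.expectation (sbm n S a b)
      (\<lambda>E. exp (\<Sum>j<n. \<Sum>i<j. g i j * of_bool ({i, j} \<in> E))) / exp ?s"
    by (simp only: exp_diff integral_divide_zero)
  also have "\<dots> \<le> exp (\<Sum>j<n. \<Sum>i<j. p i j * (exp (g i j) - 1)) / exp ?s"
    by (intro divide_right_mono sbm_exp_moment) simp
  also have "\<dots> = exp ((\<Sum>j<n. \<Sum>i<j. p i j * (exp (g i j) - 1)) - ?s)"
    by (simp only: exp_diff)
  also have "\<dots> = exp (\<Sum>j<n. \<Sum>i<j. p i j * (exp (g i j) - 1 - g i j))"
    unfolding sum_subtractf[symmetric] by (intro arg_cong[where f = exp] sum.cong refl) (simp only: right_diff_distrib)
  also have "\<dots> \<le> exp (\<Sum>j<n. \<Sum>i<j. p i j * (g i j)\<^sup>2)"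
    unfolding exp_le_cancel_iff
  proof (intro sum_mono mult_left_mono)
    fix i j assume "j \<in> {..<n}" "i \<in> {..<j}"
    thus "exp (g i j) - 1 - g i j \<le> (g i j)\<^sup>2" using exp_le_quadratic[OF g[of i j]] by simp
  qed (rule edge_prob_bounds)
  finally show ?thesis .
qed

end

section \<open>Tail bounds\<close>

definition dyadic :: "nat \<Rightarrow> real set" where
  "dyadic m = insert 0 ((\<lambda>k. 2 ^ k) ` {..m} \<union> (\<lambda>k. - (2 ^ k)) ` {..m})"

lemma finite_dyadic [simp]: "finite (dyadic m)"
  by (simp add: dyadic_def)

text \<open>The bound does not depend on \<open>m\<close>: the union bound over rounded vectors does
  not see how many levels there are.\<close>

lemma sum_exp_dyadic: "(\<Sum>v\<in>dyadic m. exp (- (v\<^sup>2))) \<le> 3"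
proof -
  have le: "exp (- ((2 ^ k)\<^sup>2)) \<le> (1/2::real) ^ Suc k" for k :: nat
  proof -
    have "real (Suc k) \<le> 2 ^ k" by (induction k) auto
    also have "\<dots> \<le> (2 ^ k)\<^sup>2" by (simp add: power2_eq_square)
    finally have "exp (- ((2 ^ k)\<^sup>2)) \<le> exp (- real (Suc k))" by simp
    also have "\<dots> = exp (-1) ^ Suc k" using exp_of_nat_mult[of "Suc k" "-1::real"] by simp
    also have "\<dots> \<le> (1/2) ^ Suc k"
      using exp_ge_add_one_self[of 1] by (intro power_mono) (auto simp: exp_minus field_simps)
    finally show ?thesis .
  qed
  have geo: "(\<Sum>k\<le>m. (1/2::real) ^ Suc k) \<le> 1"
  proof -
    have "(\<Sum>k\<le>m. (1/2::real) ^ Suc k) = 1 - (1/2) ^ Suc m" by (induction m) auto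
    thus ?thesis by simp
  qed
  let ?X = "(\<lambda>k. (2::real) ^ k) ` {..m}" and ?Y = "(\<lambda>k. - ((2::real) ^ k)) ` {..m}"
  let ?f = "\<lambda>v::real. exp (- (v\<^sup>2))"
  have "sum ?f (?X \<union> ?Y) + sum ?f (?X \<inter> ?Y) = sum ?f ?X + sum ?f ?Y" by (rule sum.union_inter) auto
  moreover have "sum ?f (?X \<inter> ?Y) \<ge> 0" by (intro sum_nonneg) auto
  ultimately have un: "sum ?f (?X \<union> ?Y) \<le> sum ?f ?X + sum ?f ?Y" by linarith
  have inj: "inj_on (\<lambda>k. (2::real) ^ k) {..m}" "inj_on (\<lambda>k. - ((2::real) ^ k)) {..m}"
    by (auto simp: inj_on_def)
  have "sum ?f (dyadic m) \<le> 1 + sum ?f (?X \<union> ?Y)"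
    unfolding dyadic_def by (subst sum.insert_if) auto
  also have "\<dots> \<le> 1 + (sum ?f ?X + sum ?f ?Y)" using un by simp
  also have "\<dots> = 1 + 2 * (\<Sum>k\<le>m. exp (- ((2 ^ k)\<^sup>2)))"
    using inj by (simp add: sum.reindex)
  also have "\<dots> \<le> 1 + 2 * (\<Sum>k\<le>m. (1/2::real) ^ Suc k)"
    by (intro add_left_mono mult_left_mono sum_mono le) auto
  finally show ?thesis using geo by linarith
qed

text \<open>Counting with a Gaussian weight:
  \<open>exp (7 * real n - (\<Sum>i<n. (z i)\<^sup>2))\<close> is at least 1 on the vectors counted,
  and its sum over all dyadic vectors factorises over the coordinates. With
  \<open>3 \<le> exp 2\<close> per coordinate this gives 9 = 7 + 2.\<close>

lemma card_dyadic_vectors: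
  "real (card {z \<in> PiE {..<n} (\<lambda>_. dyadic m). (\<Sum>i<n. (z i)\<^sup>2) \<le> 7 * real n}) \<le> exp (9 * real n)"
    (is "real (card ?Z) \<le> _")
proof -
  have fin: "finite (PiE {..<n} (\<lambda>_. dyadic m))" by (intro finite_PiE) auto
  have "real (card ?Z) = (\<Sum>z\<in>?Z. 1)" by simp
  also have "\<dots> \<le> (\<Sum>z\<in>?Z. exp (7 * real n) * (\<Prod>i<n. exp (- ((z i)\<^sup>2))))"
  proof (rule sum_mono)
    fix z assume "z \<in> ?Z"
    hence "1 \<le> exp (7 * real n + (\<Sum>i<n. - ((z i)\<^sup>2)))" by (simp add: sum_negf)
    thus "1 \<le> exp (7 * real n) * (\<Prod>i<n. exp (- ((z i)\<^sup>2)))"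
      by (simp only: exp_add exp_sum finite_lessThan)
  qed
  also have "\<dots> \<le> (\<Sum>z\<in>PiE {..<n} (\<lambda>_. dyadic m). exp (7 * real n) * (\<Prod>i<n. exp (- ((z i)\<^sup>2))))"
    by (rule sum_mono2[OF fin], blast, intro mult_nonneg_nonneg prod_nonneg exp_ge_zero)
  also have "\<dots> = exp (7 * real n) * (\<Prod>i<n. \<Sum>v\<in>dyadic m. exp (- (v\<^sup>2)))"
    by (simp only: prod_sum_PiE finite_lessThan finite_dyadic sum_distrib_left)
  also have "\<dots> \<le> exp (7 * real n) * 3 ^ n"
    using sum_exp_dyadic[of m]
    by (simp only: prod_constant card_lessThan) (intro mult_left_mono power_mono sum_nonneg; simp)
  also have "\<dots> \<le> exp (7 * real n) * exp 2 ^ n"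
    using exp_ge_add_one_self[of "2::real"] by (intro mult_left_mono power_mono) auto
  also have "\<dots> = exp (9 * real n)"
    by (simp add: exp_of_nat_mult[symmetric] exp_add[symmetric] mult.commute)
  finally show ?thesis .
qed

text \<open>The logarithm of \<open>(e n / s)^s\<close>, the usual bound on the number of
  \<open>s\<close>-element subsets; for \<open>s = 0\<close> the conventions on division give the
  value 0.\<close>

definition entropy_bound :: "nat \<Rightarrow> nat \<Rightarrow> real" where
  "entropy_bound n s = real s * (1 + ln (real n / real s))"

text \<open>The entropy is smallest for a single vertex, which comes down to
  \<open>ln s \<le> s - 1\<close>. Hence any surplus multiple of an entropy pays for a power of
  n.\<close>

lemma entropy_bound_ge:
  assumes "1 \<le> s" "s \<le> n"
  shows "entropy_bound n s \<ge> 1 + ln (real n)"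
proof -
  have "(real s - 1) * (1 + ln (real s)) \<le> (real s - 1) * (1 + ln (real n))"
    using assms by (intro mult_left_mono) auto
  hence "1 + ln (real n) \<le> real s * (1 + (ln (real n) - ln (real s))) + (1 + ln (real s) - real s)"
    by (simp add: algebra_simps)
  moreover have "ln (real s) \<le> real s - 1" using assms by (intro ln_le_minus_one) auto
  moreover have "ln (real n / real s) = ln (real n) - ln (real s)" using assms by (simp add: ln_div)
  ultimately show ?thesis by (simp add: entropy_bound_def)
qed

text \<open>A single term of the binomial expansion of \<open>(1 + x) ^ n\<close>, taken at
  \<open>x = s / n\<close>.\<close>

lemma binomial_le_exp_entropy:
  assumes "1 \<le> s" "s \<le> n"
  shows "real (n choose s) \<le> exp (entropy_bound n s)"
proof -
  define x where "x = real s / real n"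
  have x: "x > 0" using assms by (simp add: x_def)
  have "real (n choose s) * x ^ s \<le> (\<Sum>k\<le>n. real (n choose k) * x ^ k)"
    using assms x by (intro member_le_sum) auto
  also have "\<dots> = (1 + x) ^ n" using binomial_ring[of x 1 n] by (simp add: add.commute)
  also have "\<dots> \<le> exp x ^ n" using x exp_ge_add_one_self[of x] by (intro power_mono) auto
  also have "\<dots> = exp (real s)" using assms by (simp add: exp_of_nat_mult[symmetric] x_def)
  finally have "real (n choose s) \<le> exp (real s) * (1 / x) ^ s"
    using x by (simp add: field_simps)
  also have "(1 / x) ^ s = exp (real s * ln (real n / real s))"
    using assms by (simp add: exp_of_nat_mult x_def)
  finally show ?thesis by (simp add: entropy_bound_def distrib_left exp_add)
qed

text \<open>Of the three entropies in the exponent one pays for the number of sets of a given size.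
  The other two leave at most 1 / (e n)^2, which covers the n sizes and a further factor 1 /
  n.\<close>

lemma sum_exp_entropy_subsets:
  assumes "n > 0"
  shows "(\<Sum>A\<in>Pow {..<n} - {{}}. exp (- 3 * entropy_bound n (card A))) \<le> 1 / (4 * real n)"
proof -
  let ?P = "Pow {..<n} - {{}}"
  have cardA: "card A \<in> {1..n}" if "A \<in> ?P" for A
    using that card_mono[of "{..<n}" A] by (auto simp: Suc_le_eq card_gt_0_iff intro: finite_subset)
  have "(\<Sum>A\<in>?P. exp (- 3 * entropy_bound n (card A))) =
      (\<Sum>s\<in>{1..n}. \<Sum>A | A \<in> ?P \<and> card A = s. exp (- 3 * entropy_bound n (card A)))"
    by (rule sum.group[symmetric]) (use cardA in \<open>auto simp del: atLeastAtMost_iff\<close>)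
  also have "\<dots> \<le> (\<Sum>s\<in>{1..n}. exp (- 2 * (1 + ln (real n))))"
  proof (rule sum_mono)
    fix s assume s: "s \<in> {1..n}"
    have "{A. A \<in> ?P \<and> card A = s} = {A. A \<subseteq> {..<n} \<and> card A = s}" using s by auto
    hence "(\<Sum>A | A \<in> ?P \<and> card A = s. exp (- 3 * entropy_bound n (card A))) =
        real (n choose s) * exp (- 3 * entropy_bound n s)"
      by (simp add: n_subsets)
    also have "\<dots> \<le> exp (entropy_bound n s) * exp (- 3 * entropy_bound n s)"
      using s by (intro mult_right_mono binomial_le_exp_entropy) auto
    also have "\<dots> = exp (- 2 * entropy_bound n s)" by (simp add: exp_add[symmetric])
    also have "\<dots> \<le> exp (- 2 * (1 + ln (real n)))" using entropy_bound_ge[of s n] s by simp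
    finally show "(\<Sum>A | A \<in> ?P \<and> card A = s. exp (- 3 * entropy_bound n (card A)))
        \<le> exp (- 2 * (1 + ln (real n)))" .
  qed
  also have "\<dots> = real n * (exp (- 1 - ln (real n)))\<^sup>2"
    by (simp add: power2_eq_square exp_add[symmetric])
  also have "\<dots> = (exp (-1))\<^sup>2 / real n"
    using assms by (simp add: exp_diff power2_eq_square)
  also have "\<dots> \<le> (1/2)\<^sup>2 / real n"
    using exp_ge_add_one_self[of 1] by (intro divide_right_mono power_mono) (auto simp: exp_minus field_simps)
  finally show ?thesis by (simp add: power2_eq_square)
qed

definition light :: "nat \<Rightarrow> real \<Rightarrow> real" where
  "light q t = (if \<bar>t\<bar> \<le> 2 ^ q then t else 0)"

text \<open>\<open>A\<close> holds the smaller and \<open>B\<close> the larger endpoint, so each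
  edge enters at most once even if the sets overlap; the count is not symmetric in \<open>A\<close>
  and \<open>B\<close>.\<close>

definition edges_between :: "nat \<Rightarrow> nat set set \<Rightarrow> nat set \<Rightarrow> nat set \<Rightarrow> real" where
  "edges_between n E A B = (\<Sum>j<n. \<Sum>i<j. of_bool (i \<in> A \<and> j \<in> B) * of_bool ({i, j} \<in> E))"

lemma square_le_exp_sum:
  fixes x :: real
  shows "x\<^sup>2 \<le> 2 * (exp x + exp (- x) - 2)"
proof -
  have "1 + \<bar>x\<bar> + \<bar>x\<bar>\<^sup>2 / 2 \<le> exp \<bar>x\<bar>" by (rule exp_lower_Taylor_quadratic) simp
  moreover have "1 - \<bar>x\<bar> \<le> exp (- \<bar>x\<bar>)" using exp_ge_add_one_self[of "-\<bar>x\<bar>"] by simp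
  moreover have "exp \<bar>x\<bar> + exp (- \<bar>x\<bar>) = exp x + exp (- x)" by (cases "x \<ge> 0") auto
  ultimately show ?thesis by simp
qed

section \<open>Tails of the four exceptional events\<close>

context planted_partition
begin

lemma sbm_centered_exp_moment_shifted:
  fixes g :: "nat \<Rightarrow> nat \<Rightarrow> real"
  assumes "\<And>i j. i < j \<Longrightarrow> j < n \<Longrightarrow> \<bar>g i j\<bar> \<le> 1"
    and "(\<Sum>j<n. \<Sum>i<j. p i j * (g i j)\<^sup>2) \<le> v"
  shows "measure_pmf.expectation (sbm n S a b) (\<lambda>E. exp ((\<Sum>j<n. \<Sum>i<j. g i j * W E i j) - t)) \<le> exp (v - t)"
proof -
  have "measure_pmf.expectation (sbm n S a b) (\<lambda>E. exp (\<Sum>j<n. \<Sum>i<j. g i j * W E i j)) \<le> exp v"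
    by (rule order_trans[OF sbm_centered_exp_moment]) (use assms in auto)
  thus ?thesis by (simp only: exp_diff integral_divide_zero) (simp add: divide_right_mono)
qed

text \<open>Squared coefficients dominated by products \<open>w i * w j\<close> reduce the double
  sum to the square of a total weight. The factor \<open>d\<close> of the edge probabilities cancels
  against \<open>4 ^ q\<close>, which leaves a variance of order n.\<close>

lemma variance_proxy_le:
  fixes w :: "nat \<Rightarrow> real" and R :: real
  assumes d: "d \<le> 4 * 4 ^ q" and w: "\<And>i. w i \<ge> 0" "(\<Sum>i<n. w i) \<le> R * n"
    and g: "\<And>i j. i < j \<Longrightarrow> j < n \<Longrightarrow> (g i j)\<^sup>2 \<le> w i * w j / 4 ^ q"
  shows "(\<Sum>j<n. \<Sum>i<j. p i j * (g i j)\<^sup>2) \<le> 4 * R\<^sup>2 * real n"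
proof -
  have "(\<Sum>j<n. \<Sum>i<j. p i j * (g i j)\<^sup>2) \<le> (\<Sum>j<n. \<Sum>i<j. (2 * d / n) * (w i * w j / 4 ^ q))"
    using edge_prob_bounds g d_pos w by (intro sum_mono mult_mono) auto
  also have "\<dots> = d / (n * 4 ^ q) * (2 * (\<Sum>j<n. \<Sum>i<j. w i * w j))"
    unfolding sum_distrib_left by (intro sum.cong refl) simp
  also have "\<dots> \<le> d / (n * 4 ^ q) * (R * n)\<^sup>2"
  proof (rule mult_left_mono)
    have "2 * (\<Sum>j<n. \<Sum>i<j. w i * w j) \<le> (\<Sum>i<n. w i)\<^sup>2" by (rule sum_pairs_product_le)
    also have "\<dots> \<le> (R * n)\<^sup>2" using w by (intro power_mono sum_nonneg) auto
    finally show "2 * (\<Sum>j<n. \<Sum>i<j. w i * w j) \<le> (R * n)\<^sup>2" .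
  qed (use d_pos in simp)
  also have "\<dots> = (d / 4 ^ q) * (R\<^sup>2 * n)" using n by (simp add: power2_eq_square)
  also have "\<dots> \<le> 4 * (R\<^sup>2 * n)" using d by (intro mult_right_mono) (auto simp: field_simps)
  finally show ?thesis by simp
qed

text \<open>Light coefficients divided by \<open>2 ^ q\<close> have modulus at most 1, so the
  exponential moment applies. Its variance is of order n, the same order as the logarithm of the
  number of rounded vectors, so the union bound loses only a constant.\<close>

lemma light_tail:
  assumes d: "d \<le> 4 * 4 ^ q"
  shows "measure_pmf.prob (sbm n S a b)
    {E. \<exists>z. (\<forall>i<n. z i \<in> dyadic m) \<and> (\<Sum>i<n. (z i)\<^sup>2) \<le> 7 * real n \<and>
        206 * real n * 2 ^ q < (\<Sum>j<n. \<Sum>i<j. light q (z i * z j) * W E i j)} \<le> exp (- real n)"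
proof -
  let ?Z = "{z \<in> PiE {..<n} (\<lambda>_. dyadic m). (\<Sum>i<n. (z i)\<^sup>2) \<le> 7 * real n}"
  let ?Q = "\<lambda>z E. 206 * real n * 2 ^ q < (\<Sum>j<n. \<Sum>i<j. light q (z i * z j) * W E i j)"
  let ?f = "\<lambda>z E. exp ((\<Sum>j<n. \<Sum>i<j. light q (z i * z j) / 2 ^ q * W E i j) - 206 * real n)"
  have fin: "finite ?Z" by (rule finite_subset[of _ "PiE {..<n} (\<lambda>_. dyadic m)"]) (auto intro: finite_PiE)
  have "{E. \<exists>z. (\<forall>i<n. z i \<in> dyadic m) \<and> (\<Sum>i<n. (z i)\<^sup>2) \<le> 7 * real n \<and> ?Q z E} \<subseteq> {E. \<exists>z\<in>?Z. ?Q z E}"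
  proof (rule subsetI, elim CollectE exE conjE)
    fix E z assume z: "\<forall>i<n. z i \<in> dyadic m" "(\<Sum>i<n. (z i)\<^sup>2) \<le> 7 * real n" "?Q z E"
    let ?z = "restrict z {..<n}"
    have "(\<Sum>j<n. \<Sum>i<j. light q (?z i * ?z j) * W E i j) = (\<Sum>j<n. \<Sum>i<j. light q (z i * z j) * W E i j)"
      by (intro sum.cong refl) auto
    hence "?Q ?z E" using z by simp
    moreover have "?z \<in> ?Z" using z by auto
    ultimately show "E \<in> {E. \<exists>z\<in>?Z. ?Q z E}" by blast
  qed
  hence "measure_pmf.prob (sbm n S a b)
      {E. \<exists>z. (\<forall>i<n. z i \<in> dyadic m) \<and> (\<Sum>i<n. (z i)\<^sup>2) \<le> 7 * real n \<and> ?Q z E}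
      \<le> measure_pmf.prob (sbm n S a b) {E. \<exists>z\<in>?Z. ?Q z E}"
    by (intro measure_pmf.finite_measure_mono) auto
  also have "\<dots> \<le> (\<Sum>z\<in>?Z. measure_pmf.expectation (sbm n S a b) (?f z))"
  proof (rule prob_ex_le_sum_expectation[OF finite_set_pmf_sbm fin])
    fix z E assume "?Q z E"
    hence "206 * real n \<le> (\<Sum>j<n. \<Sum>i<j. light q (z i * z j) * W E i j) / 2 ^ q" by (simp add: field_simps)
    also have "\<dots> = (\<Sum>j<n. \<Sum>i<j. light q (z i * z j) / 2 ^ q * W E i j)"
      by (simp add: sum_divide_distrib)
    finally show "1 \<le> ?f z E" by simp
  qed simp
  \<comment> \<open>206 = 4 * 7^2 + 9 + 1: the variance, the number of vectors, and the tail that is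
    to remain.\<close>
  also have "\<dots> \<le> (\<Sum>z\<in>?Z. exp (4 * 7\<^sup>2 * real n - 206 * real n))"
  proof (rule sum_mono, rule sbm_centered_exp_moment_shifted)
    fix z assume z: "z \<in> ?Z"
    show "(\<Sum>j<n. \<Sum>i<j. p i j * (light q (z i * z j) / 2 ^ q)\<^sup>2) \<le> 4 * 7\<^sup>2 * real n"
    proof (rule variance_proxy_le[OF d, where w = "\<lambda>i. (z i)\<^sup>2"])
      have "((2::real) ^ q)\<^sup>2 = 4 ^ q" by (simp add: power2_eq_square power_mult_distrib[symmetric])
      thus "(light q (z i * z j) / 2 ^ q)\<^sup>2 \<le> (z i)\<^sup>2 * (z j)\<^sup>2 / 4 ^ q" for i j
        by (simp add: light_def power_divide power_mult_distrib)
    qed (use z in auto)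
  qed (simp add: light_def)
  also have "\<dots> = real (card ?Z) * exp (- 10 * real n)" by simp
  also have "\<dots> \<le> exp (9 * real n) * exp (- 10 * real n)"
    by (intro mult_right_mono card_dyadic_vectors) simp
  also have "\<dots> = exp (- real n)" by (simp add: exp_add[symmetric])
  finally show ?thesis .
qed

text \<open>The only lower bound on the noise; it serves to bound the second eigenvalue from below.
  For a single vector 5 = 4 + 1 suffices: the variance and the tail.\<close>

lemma community_form_tail:
  assumes d: "d \<le> 4 * 4 ^ q"
  shows "measure_pmf.prob (sbm n S a b)
    {E. 5 * real n * 2 ^ q < - (\<Sum>j<n. \<Sum>i<j. community_sign S i * community_sign S j * W E i j)} \<le> exp (- real n)"
proof -
  let ?g = "\<lambda>i j. - (community_sign S i * community_sign S j) / 2 ^ q"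
  have "measure_pmf.prob (sbm n S a b)
    {E. 5 * real n * 2 ^ q < - (\<Sum>j<n. \<Sum>i<j. community_sign S i * community_sign S j * W E i j)} \<le>
    measure_pmf.expectation (sbm n S a b) (\<lambda>E. exp ((\<Sum>j<n. \<Sum>i<j. ?g i j * W E i j) - 5 * real n))"
  proof (rule prob_le_expectation)
    fix E assume "5 * real n * 2 ^ q < - (\<Sum>j<n. \<Sum>i<j. community_sign S i * community_sign S j * W E i j)"
    hence "5 * real n \<le> - (\<Sum>j<n. \<Sum>i<j. community_sign S i * community_sign S j * W E i j) / 2 ^ q"
      by (simp add: field_simps)
    also have "\<dots> = (\<Sum>j<n. \<Sum>i<j. ?g i j * W E i j)"
      by (simp add: sum_divide_distrib sum_negf)
    finally show "1 \<le> exp ((\<Sum>j<n. \<Sum>i<j. ?g i j * W E i j) - 5 * real n)" by simp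
  qed auto
  also have "\<dots> \<le> exp (4 * 1\<^sup>2 * real n - 5 * real n)"
  proof (rule sbm_centered_exp_moment_shifted)
    show "(\<Sum>j<n. \<Sum>i<j. p i j * (?g i j)\<^sup>2) \<le> 4 * 1\<^sup>2 * real n"
    proof (rule variance_proxy_le[OF d, where w = "\<lambda>_. 1"])
      have "((2::real) ^ q)\<^sup>2 = 4 ^ q" by (simp add: power2_eq_square power_mult_distrib[symmetric])
      thus "(?g i j)\<^sup>2 \<le> 1 * 1 / 4 ^ q" for i j
        by (auto simp: community_sign_def power_divide)
    qed auto
  qed (auto simp: community_sign_def)
  finally show ?thesis by simp
qed

text \<open>The bound decays in \<open>K\<close> and not in \<open>n\<close>, so \<open>K\<close>
  will be chosen according to \<open>r\<close>. Any bound linear in n d is enough later, because it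
  is only used relative to n d^2.\<close>

lemma degree_deviation_tail:
  fixes K :: real
  assumes d: "d \<ge> 1" and K: "K > 0"
  shows "measure_pmf.prob (sbm n S a b)
    {E. K * n * d \<le> (\<Sum>i<n. (\<Sum>j<n. if i \<noteq> j then W E i j else 0)\<^sup>2)} \<le> 28 / K"
proof -
  let ?s = "\<lambda>E i. \<Sum>j<n. if i \<noteq> j then W E i j else 0"
  let ?E = "measure_pmf.expectation (sbm n S a b)"
  have int: "integrable (measure_pmf (sbm n S a b)) f" for f :: "_ \<Rightarrow> real"
    by (rule integrable_measure_pmf_finite) simp
  have mom: "?E (\<lambda>E. exp (c * ?s E i / sqrt d)) \<le> exp 2" if c: "\<bar>c\<bar> = 1" and i: "i < n" for c :: real and i
  proof -
    \<comment> \<open>The indicator of the vertex \<open>i\<close> turns its row sum into a sum over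
      pairs, to which the exponential moment applies.\<close>
    define y :: "nat \<Rightarrow> real" where "y = (\<lambda>k. if k = i then 1 else 0)"
    have ysum: "(\<Sum>k<n. y k * f k) = f i" for f
    proof -
      have "(\<Sum>k<n. y k * f k) = (\<Sum>k<n. if k = i then f k else 0)"
        by (intro sum.cong refl) (auto simp: y_def)
      thus ?thesis using i by simp
    qed
    have s: "?s E i = (\<Sum>j<n. \<Sum>k<j. (y k + y j) * W E k j)" for E
      by (subst sum_offdiag_symmetric[OF W_commute]) (simp only: ysum)
    have "c * ?s E i / sqrt d = (\<Sum>j<n. \<Sum>k<j. c * (y k + y j) / sqrt d * W E k j)" for E
      unfolding s by (simp add: sum_distrib_left sum_divide_distrib mult.assoc)
    hence "?E (\<lambda>E. exp (c * ?s E i / sqrt d)) =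
        ?E (\<lambda>E. exp (\<Sum>j<n. \<Sum>k<j. c * (y k + y j) / sqrt d * W E k j))" by simp
    also have "\<dots> \<le> exp (\<Sum>j<n. \<Sum>k<j. p k j * (c * (y k + y j) / sqrt d)\<^sup>2)"
    proof (rule sbm_centered_exp_moment)
      fix k j :: nat assume "k < j"
      hence "\<bar>y k + y j\<bar> \<le> 1" by (auto simp: y_def)
      thus "\<bar>c * (y k + y j) / sqrt d\<bar> \<le> 1"
        using d c by (simp add: abs_mult abs_divide divide_le_eq) (smt (verit) real_sqrt_ge_one)
    qed
    also have "(\<Sum>j<n. \<Sum>k<j. p k j * (c * (y k + y j) / sqrt d)\<^sup>2) = (\<Sum>j<n. \<Sum>k<j. (y k + y j) * (p k j / d))"
    proof (intro sum.cong refl)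
      fix k j :: nat assume "k \<in> {..<j}"
      hence "(y k + y j)\<^sup>2 = y k + y j" by (auto simp: y_def)
      moreover have "c\<^sup>2 = 1" using c by (metis one_power2 power2_abs)
      ultimately show "p k j * (c * (y k + y j) / sqrt d)\<^sup>2 = (y k + y j) * (p k j / d)"
        using d by (simp add: power_divide power_mult_distrib)
    qed
    also have "\<dots> = (\<Sum>j<n. if i \<noteq> j then p i j / d else 0)"
      by (subst sum_offdiag_symmetric) (simp_all only: ysum insert_commute)
    also have "\<dots> \<le> (\<Sum>j<n. 2 / n)"
    proof (rule sum_mono)
      fix j
      have "p i j / d \<le> (2 * d / n) / d" using d by (intro divide_right_mono edge_prob_bounds) auto
      thus "(if i \<noteq> j then p i j / d else 0) \<le> 2 / n" using d by simp
    qed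
    also have "\<dots> = 2" using n by simp
    finally show ?thesis by simp
  qed
  \<comment> \<open>The variance is bounded through \<open>x\<^sup>2 \<le> 2 (e\<^sup>x + e\<^sup>-\<^sup>x - 2)\<close>, so that no independence argument is needed.\<close>
  have sq: "?E (\<lambda>E. (?s E i)\<^sup>2) \<le> 28 * d" if i: "i < n" for i
  proof -
    have "(?s E i)\<^sup>2 \<le> 2 * d * (exp (1 * ?s E i / sqrt d) + exp ((-1) * ?s E i / sqrt d) - 2)" for E
      using square_le_exp_sum[of "?s E i / sqrt d"] d by (simp add: power_divide field_simps)
    hence "?E (\<lambda>E. (?s E i)\<^sup>2) \<le>
        ?E (\<lambda>E. 2 * d * (exp (1 * ?s E i / sqrt d) + exp ((-1) * ?s E i / sqrt d) - 2))"
      by (intro integral_mono int)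
    also have "\<dots> = 2 * d * (?E (\<lambda>E. exp (1 * ?s E i / sqrt d)) + ?E (\<lambda>E. exp ((-1) * ?s E i / sqrt d)) - 2)"
      by (simp only: integral_mult_right_zero Bochner_Integration.integral_diff[OF int int]
          Bochner_Integration.integral_add[OF int int]) simp
    also have "\<dots> \<le> 2 * d * (exp 2 + exp 2 - 2)"
      using mom[of 1 i] mom[of "-1" i] d i by (intro mult_left_mono diff_right_mono add_mono) auto
    also have "\<dots> \<le> 2 * d * 14"
    proof -
      have "exp (1::real) \<le> 2.72" using e_less_272 by simp
      hence "exp (1::real) * exp 1 \<le> 2.72 * 2.72" by (intro mult_mono) auto
      hence "exp (2::real) \<le> 8" by (simp add: exp_add[symmetric])
      thus ?thesis using d by (intro mult_left_mono) auto
    qed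
    finally show ?thesis by simp
  qed
  have "measure_pmf.prob (sbm n S a b) {E. K * n * d \<le> (\<Sum>i<n. (?s E i)\<^sup>2)} \<le>
      ?E (\<lambda>E. (\<Sum>i<n. (?s E i)\<^sup>2) / (K * n * d))"
    by (rule prob_le_expectation) (use n d K in \<open>auto intro!: divide_nonneg_nonneg sum_nonneg simp: le_divide_eq\<close>)
  also have "\<dots> = (\<Sum>i<n. ?E (\<lambda>E. (?s E i)\<^sup>2)) / (K * n * d)"
    by (simp only: integral_divide_zero Bochner_Integration.integral_sum[OF int])
  also have "\<dots> \<le> (\<Sum>i<n. 28 * d) / (K * n * d)"
    using n d K sq by (intro divide_right_mono sum_mono) auto
  also have "\<dots> = 28 / K" using n d by simp
  finally show ?thesis .
qed

text \<open>Chernoff's bound with parameter \<open>h * ln 2\<close>, which makes the exponential a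
  power of two. Instead of optimising the parameter, the union bound runs over \<open>h\<close> as
  well, so that each later use can choose it.\<close>

lemma discrepancy_tail:
  "measure_pmf.prob (sbm n S a b)
    {E. \<exists>A B h. A \<subseteq> {..<n} \<and> A \<noteq> {} \<and> B \<subseteq> {..<n} \<and> B \<noteq> {} \<and> 1 \<le> h \<and> h \<le> 7 * n \<and>
      (2 * d / n) * card A * card B * 2 ^ h + 3 * (entropy_bound n (card A) + entropy_bound n (card B))
      < real h * ln 2 * edges_between n E A B} \<le> 1 / n"
proof -
  let ?P = "Pow {..<n} - {{}}"
  let ?I = "?P \<times> ?P \<times> {1..7 * n}"
  let ?H = "\<lambda>A. entropy_bound n (card A)"
  let ?\<mu> = "\<lambda>A B h. (2 * d / n) * card A * card B * 2 ^ h"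
  let ?Q = "\<lambda>(A, B, h) E. ?\<mu> A B h + 3 * (?H A + ?H B) < real h * ln 2 * edges_between n E A B"
  let ?f = "\<lambda>(A, B, h) E. exp (real h * ln 2 * edges_between n E A B) / exp (?\<mu> A B h + 3 * (?H A + ?H B))"
  let ?F = "\<lambda>A. exp (- 3 * ?H A)"
  have "{E. \<exists>A B h. A \<subseteq> {..<n} \<and> A \<noteq> {} \<and> B \<subseteq> {..<n} \<and> B \<noteq> {} \<and> 1 \<le> h \<and> h \<le> 7 * n \<and>
      ?\<mu> A B h + 3 * (?H A + ?H B) < real h * ln 2 * edges_between n E A B} \<subseteq> {E. \<exists>x\<in>?I. ?Q x E}"
  proof (rule subsetI, elim CollectE exE conjE)
    fix E A B h
    assume "A \<subseteq> {..<n}" "A \<noteq> {}" "B \<subseteq> {..<n}" "B \<noteq> {}" "1 \<le> h" "h \<le> 7 * n"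
      and Q: "?\<mu> A B h + 3 * (?H A + ?H B) < real h * ln 2 * edges_between n E A B"
    hence "(A, B, h) \<in> ?I" by auto
    moreover have "?Q (A, B, h) E" unfolding case_prod_conv by (rule Q)
    ultimately show "E \<in> {E. \<exists>x\<in>?I. ?Q x E}" by (intro CollectI bexI[of _ "(A, B, h)"])
  qed
  hence "measure_pmf.prob (sbm n S a b)
    {E. \<exists>A B h. A \<subseteq> {..<n} \<and> A \<noteq> {} \<and> B \<subseteq> {..<n} \<and> B \<noteq> {} \<and> 1 \<le> h \<and> h \<le> 7 * n \<and>
      ?\<mu> A B h + 3 * (?H A + ?H B) < real h * ln 2 * edges_between n E A B} \<le>
    measure_pmf.prob (sbm n S a b) {E. \<exists>x\<in>?I. ?Q x E}"
    by (rule measure_pmf.finite_measure_mono) simp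
  also have "measure_pmf.prob (sbm n S a b) {E. \<exists>x\<in>?I. ?Q x E} \<le>
      (\<Sum>x\<in>?I. measure_pmf.expectation (sbm n S a b) (?f x))"
    by (rule prob_ex_le_sum_expectation) auto
  also have "\<dots> \<le> (\<Sum>(A, B, h)\<in>?I. ?F A * ?F B)"
  proof (rule sum_mono)
    fix x assume x: "x \<in> ?I"
    obtain A B h where xx: "x = (A, B, h)" by (cases x)
    have A: "A \<subseteq> {..<n}" and B: "B \<subseteq> {..<n}" using x by (auto simp: xx)
    let ?g = "\<lambda>i j. real h * ln 2 * of_bool (i \<in> A \<and> j \<in> B)"
    have e: "real h * ln 2 * edges_between n E A B = (\<Sum>j<n. \<Sum>i<j. ?g i j * of_bool ({i, j} \<in> E))" for E
      by (simp only: edges_between_def sum_distrib_left mult.assoc)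
    have pw: "exp (real h * ln 2) = 2 ^ h" by (simp add: exp_of_nat_mult)
    have "(\<Sum>j<n. \<Sum>i<j. p i j * (exp (?g i j) - 1)) \<le>
        (\<Sum>j<n. \<Sum>i<n. (2 * d / n) * 2 ^ h * (of_bool (i \<in> A) * of_bool (j \<in> B)))"
    proof (rule sum_mono)
      fix j assume "j \<in> {..<n}"
      hence "(\<Sum>i<j. (2 * d / n) * 2 ^ h * (of_bool (i \<in> A) * of_bool (j \<in> B))) \<le>
          (\<Sum>i<n. (2 * d / n) * 2 ^ h * (of_bool (i \<in> A) * of_bool (j \<in> B)))"
        using d_pos by (intro sum_mono2) auto
      moreover have "(\<Sum>i<j. p i j * (exp (?g i j) - 1)) \<le>
          (\<Sum>i<j. (2 * d / n) * 2 ^ h * (of_bool (i \<in> A) * of_bool (j \<in> B)))"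
      proof (rule sum_mono)
        fix i
        have "p i j * (2 ^ h - 1) \<le> (2 * d / n) * 2 ^ h"
          using edge_prob_bounds d_pos by (intro mult_mono) auto
        thus "p i j * (exp (?g i j) - 1) \<le> (2 * d / n) * 2 ^ h * (of_bool (i \<in> A) * of_bool (j \<in> B))"
          by (cases "i \<in> A \<and> j \<in> B") (auto simp: pw)
      qed
      ultimately show "(\<Sum>i<j. p i j * (exp (?g i j) - 1)) \<le>
          (\<Sum>i<n. (2 * d / n) * 2 ^ h * (of_bool (i \<in> A) * of_bool (j \<in> B)))" by linarith
    qed
    also have "\<dots> = (2 * d / n) * 2 ^ h * ((\<Sum>i<n. of_bool (i \<in> A)) * (\<Sum>j<n. of_bool (j \<in> B)))"
      by (simp only: sum_distrib_left sum_distrib_right)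
    also have "(\<Sum>i<n. of_bool (i \<in> A)) = real (card A)" using A by (simp add: Int_absorb1 Int_def[symmetric])
    also have "(\<Sum>i<n. of_bool (i \<in> B)) = real (card B)" using B by (simp add: Int_absorb1 Int_def[symmetric])
    finally have "exp (\<Sum>j<n. \<Sum>i<j. p i j * (exp (?g i j) - 1)) \<le> exp (?\<mu> A B h)" by (simp add: mult_ac)
    with sbm_exp_moment[of ?g]
    have "measure_pmf.expectation (sbm n S a b) (\<lambda>E. exp (real h * ln 2 * edges_between n E A B)) \<le> exp (?\<mu> A B h)"
      unfolding e by (rule order_trans)
    hence "measure_pmf.expectation (sbm n S a b)
        (\<lambda>E. exp (real h * ln 2 * edges_between n E A B) / exp (?\<mu> A B h + 3 * (?H A + ?H B))) \<le>
        exp (?\<mu> A B h) / exp (?\<mu> A B h + 3 * (?H A + ?H B))"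
      by (simp only: integral_divide_zero) (rule divide_right_mono, auto)
    also have "\<dots> = ?F A * ?F B" by (simp add: exp_diff[symmetric] exp_add[symmetric])
    finally show "measure_pmf.expectation (sbm n S a b) (?f x) \<le> (case x of (A, B, h) \<Rightarrow> ?F A * ?F B)"
      unfolding xx case_prod_conv .
  qed
  also have "\<dots> = (\<Sum>A\<in>?P. ?F A) * (\<Sum>B\<in>?P. ?F B) * real (7 * n)"
    by (simp add: sum.cartesian_product[symmetric] sum_distrib_left sum_distrib_right mult_ac)
  \<comment> \<open>Each family of sets contributes 1 / (4 n); one of these factors pays for the
    \<open>7 * n\<close> values of \<open>h\<close>.\<close>
  also have "\<dots> \<le> (1 / (4 * n)) * (1 / (4 * n)) * real (7 * n)"
    using sum_exp_entropy_subsets[OF n] by (intro mult_right_mono mult_mono sum_nonneg) auto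
  also have "\<dots> \<le> 1 / n" using n by (simp add: field_simps)
  finally show ?thesis .
qed

end

section \<open>The centred quadratic form\<close>

text \<open>The terms grow almost geometrically, so the sum is comparable with its last
  term.\<close>

lemma sum_power2_div_le:
  assumes "n \<ge> 1"
  shows "(\<Sum>j=1..n. 2 ^ j / real j) \<le> 4 * 2 ^ n / real n"
  using assms
proof (induction n rule: dec_induct)
  case (step n)
  show ?case
  \<comment> \<open>The estimate \<open>4 / n \<le> 6 / (n + 1)\<close> needs
    \<open>n \<ge> 2\<close>, so the step from 1 to 2 is computed directly.\<close>
  proof (cases "n = 1")
    case False
    have "(\<Sum>j=1..Suc n. 2 ^ j / real j) \<le> 4 * 2 ^ n / real n + 2 ^ Suc n / real (Suc n)"
      using step by simp
    also have "\<dots> \<le> 4 * 2 ^ Suc n / real (Suc n)"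
    proof -
      have "4 / real n \<le> 6 / real (Suc n)" using step(1) False by (simp add: field_simps)
      hence "2 ^ n * (4 / real n) \<le> 2 ^ n * (6 / real (Suc n))" by (intro mult_left_mono) auto
      moreover have "2 ^ n * (6 / real (Suc n)) + 2 ^ Suc n / real (Suc n) = 4 * 2 ^ Suc n / real (Suc n)"
        by (simp add: add_divide_distrib[symmetric])
      ultimately show ?thesis by (simp add: mult.commute)
    qed
    finally show ?thesis .
  qed (simp add: numeral_2_eq_2)
qed simp

lemma entropy_bound_nonneg: "s \<le> n \<Longrightarrow> entropy_bound n s \<ge> 0"
  by (cases "s = 0") (auto simp: entropy_bound_def intro!: mult_nonneg_nonneg add_nonneg_nonneg)

lemma weighted_entropy_bound:
  assumes "1 \<le> k" "s \<le> n"
  shows "4 ^ k * entropy_bound n s / real k \<le> 4 * (4 ^ k * real s) + real n * (1/2) ^ k"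
proof (cases "s = 0")
  case False
  define x where "x = real n / real s"
  have x: "x > 0" using False assms by (simp add: x_def)
  \<comment> \<open>Splitting off \<open>8\<^sup>-\<^sup>k\<close> avoids a case distinction on the size of \<open>s\<close>: the first summand is
    summable against \<open>4\<^sup>k\<close>, the second cancels the division by \<open>k\<close>.\<close>
  have "ln x = ln (x * (1/8) ^ k) + real k * ln 8"
    using x by (simp add: ln_mult ln_realpow ln_div)
  also have "\<dots> \<le> x * (1/8) ^ k + real k * 3"
  proof (intro add_mono mult_left_mono)
    show "ln (x * (1/8) ^ k) \<le> x * (1/8) ^ k"
      using x by (intro ln_bound) auto
    have "ln (8::real) = 3 * ln 2" using ln_realpow[of 2 3] by simp
    thus "ln (8::real) \<le> 3" using ln_2_less_1 by simp
  qed simp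
  finally have "real s * ln x \<le> real s * (x * (1/8) ^ k + real k * 3)" by (intro mult_left_mono) auto
  also have "\<dots> = real n * (1/8) ^ k + 3 * real k * real s" using False by (simp add: x_def distrib_left)
  finally have "entropy_bound n s \<le> real s + (real n * (1/8) ^ k + 3 * real k * real s)"
    by (simp add: entropy_bound_def x_def distrib_left)
  hence "4 ^ k / real k * entropy_bound n s \<le> 4 ^ k / real k * (real s + (real n * (1/8) ^ k + 3 * real k * real s))"
    by (intro mult_left_mono) auto
  also have "\<dots> = (4 ^ k * real s + real n * (1/2) ^ k) / real k + 3 * (4 ^ k * real s)"
  proof -
    have "4 ^ k * (1/8::real) ^ k = (1/2) ^ k" by (simp add: power_mult_distrib[symmetric])
    thus ?thesis using assms by (simp add: add_divide_distrib distrib_left mult_ac)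
  qed
  also have "(4 ^ k * real s + real n * (1/2) ^ k) / real k \<le> 4 ^ k * real s + real n * (1/2) ^ k"
    using divide_left_mono[of 1 "real k" "4 ^ k * real s + real n * (1/2) ^ k"] assms by simp
  finally show ?thesis by (simp add: mult.commute)
qed (simp add: entropy_bound_def)

text \<open>An affine function on an interval is largest at an endpoint, so the coordinates can be
  moved one after the other without decreasing \<open>F\<close>. Unlike approximation by a net, this
  rounding has no error term.\<close>

lemma multiaffine_le_vertex:
  fixes F :: "(nat \<Rightarrow> real) \<Rightarrow> real"
  assumes aff: "\<And>g i. \<exists>\<alpha> \<beta>. \<forall>t. F (g(i := t)) = \<alpha> + \<beta> * t"
    and box: "\<And>i. i < n \<Longrightarrow> u i \<le> y i \<and> y i \<le> w i"
  shows "\<exists>z. (\<forall>i<n. z i = u i \<or> z i = w i) \<and> F y \<le> F z"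
proof -
  have "\<exists>z. (\<forall>i<k. z i = u i \<or> z i = w i) \<and> (\<forall>i\<ge>k. z i = y i) \<and> F y \<le> F z" if "k \<le> n" for k
    using that
  proof (induction k)
    case (Suc k)
    then obtain z where z: "\<forall>i<k. z i = u i \<or> z i = w i" "\<forall>i\<ge>k. z i = y i" "F y \<le> F z" by auto
    obtain \<alpha> \<beta> where ab: "\<And>t. F (z(k := t)) = \<alpha> + \<beta> * t" using aff by metis
    have "F z = \<alpha> + \<beta> * y k" using ab[of "y k"] z(2) by (metis fun_upd_triv order.refl)
    define t where "t = (if \<beta> \<ge> 0 then w k else u k)"
    have "\<beta> * y k \<le> \<beta> * t" using box[of k] Suc.prems
      by (auto simp: t_def intro: mult_left_mono mult_left_mono_neg)
    hence "F y \<le> F (z(k := t))" using z(3) ab[of t] \<open>F z = \<alpha> + \<beta> * y k\<close> by linarith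
    moreover have "\<forall>i<Suc k. (z(k := t)) i = u i \<or> (z(k := t)) i = w i"
      using z(1) by (auto simp: less_Suc_eq t_def)
    moreover have "\<forall>i\<ge>Suc k. (z(k := t)) i = y i" using z(2) by auto
    ultimately show ?case by blast
  qed auto
  thus ?thesis by blast
qed

text \<open>Only pairs \<open>i < j\<close> occur, so the changed coordinate is never multiplied by
  itself.\<close>

lemma pair_form_affine:
  fixes w :: "nat \<Rightarrow> nat \<Rightarrow> real"
  shows "\<exists>\<alpha> \<beta>. \<forall>t. (\<Sum>j<n. \<Sum>i<j. (g(m := t)) i * (g(m := t)) j * w i j) = \<alpha> + \<beta> * t"
proof (intro exI allI)
  fix t
  show "(\<Sum>j<n. \<Sum>i<j. (g(m := t)) i * (g(m := t)) j * w i j) =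
      (\<Sum>j<n. \<Sum>i<j. if i = m \<or> j = m then 0 else g i * g j * w i j) +
      (\<Sum>j<n. \<Sum>i<j. if i = m then g j * w i j else if j = m then g i * w i j else 0) * t"
    unfolding sum_distrib_right sum.distrib[symmetric] by (intro sum.cong refl) auto
qed

text \<open>The neighbours are 0 and 1 or two consecutive powers of two. Both are at most the larger
  of 1 and 2 t, which gives the bound on the squares.\<close>

lemma dyadic_rounding_nonneg:
  fixes t :: real
  assumes "t \<ge> 0" "2 * t \<le> real m"
  shows "\<exists>u\<in>dyadic m. \<exists>w\<in>dyadic m. u \<le> t \<and> t \<le> w \<and> u\<^sup>2 \<le> 4 * t\<^sup>2 + 1 \<and> w\<^sup>2 \<le> 4 * t\<^sup>2 + 1"
proof (cases "t < 1")
  case True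
  have "(1::real) \<in> dyadic m" "0 \<in> dyadic m" by (auto simp: dyadic_def intro: image_eqI[of _ _ 0])
  thus ?thesis using True assms by (intro bexI[of _ 0] bexI[of _ 1]) auto
next
  case False
  define k where "k = nat \<lfloor>log 2 t\<rfloor>"
  have l0: "log 2 t \<ge> 0" using False by simp
  have k1: "2 ^ k \<le> t"
  proof -
    have "2 powr real k \<le> 2 powr log 2 t" using l0 by (intro powr_mono) (auto simp: k_def)
    thus ?thesis using False by (simp add: powr_realpow)
  qed
  have k2: "t \<le> 2 ^ Suc k"
  proof -
    have "log 2 t \<le> real (Suc k)" using l0 unfolding k_def by linarith
    hence "2 powr log 2 t \<le> 2 powr real (Suc k)" by (intro powr_mono) auto
    thus ?thesis using False by (simp only: powr_realpow) simp
  qed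
  \<comment> \<open>A very generous supply of levels,
    \<open>k + 1 < 2 ^ (k + 1) \<le> 2 * t \<le> m\<close>; it is free because the count of rounded
    vectors does not depend on \<open>m\<close>.\<close>
  have "real (Suc k) < 2 ^ Suc k" by (rule of_nat_less_two_power)
  also have "\<dots> \<le> real m" using k1 assms by simp
  finally have "Suc k \<le> m" by simp
  hence "(2::real) ^ k \<in> dyadic m" "(2::real) ^ Suc k \<in> dyadic m"
    by (auto simp: dyadic_def simp del: power_Suc)
  moreover have "(2 ^ k)\<^sup>2 \<le> t\<^sup>2" using k1 by (intro power_mono) auto
  hence "(2 ^ k)\<^sup>2 \<le> 4 * t\<^sup>2 + 1" using zero_le_power2[of t] by linarith
  moreover have "(2 ^ Suc k)\<^sup>2 \<le> (2 * t)\<^sup>2" using k1 by (intro power_mono) auto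
  hence "(2 ^ Suc k)\<^sup>2 \<le> 4 * t\<^sup>2 + 1" by (simp add: power_mult_distrib)
  ultimately show ?thesis using k1 k2 by blast
qed

lemma dyadic_uminus: "v \<in> dyadic m \<Longrightarrow> - v \<in> dyadic m"
  by (auto simp: dyadic_def)

lemma dyadic_rounding:
  fixes t :: real
  assumes "2 * \<bar>t\<bar> \<le> real m"
  shows "\<exists>u\<in>dyadic m. \<exists>w\<in>dyadic m. u \<le> t \<and> t \<le> w \<and> u\<^sup>2 \<le> 4 * t\<^sup>2 + 1 \<and> w\<^sup>2 \<le> 4 * t\<^sup>2 + 1"
proof (cases "t \<ge> 0")
  case False
  with dyadic_rounding_nonneg[of "-t" m] assms obtain u w where
    "u \<in> dyadic m" "w \<in> dyadic m" "u \<le> -t" "-t \<le> w" "u\<^sup>2 \<le> 4 * t\<^sup>2 + 1" "w\<^sup>2 \<le> 4 * t\<^sup>2 + 1" by auto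
  thus ?thesis by (intro bexI[of _ "-w"] bexI[of _ "-u"]) (auto intro: dyadic_uminus)
qed (use dyadic_rounding_nonneg assms in auto)

section \<open>Dyadic level sets and heavy pairs\<close>

lemma card_level_sum:
  fixes z :: "nat \<Rightarrow> real"
  assumes "\<And>i. i < n \<Longrightarrow> z i \<in> dyadic m"
  shows "(\<Sum>k\<le>m. 4 ^ k * real (card {i. i < n \<and> \<bar>z i\<bar> = 2 ^ k})) = (\<Sum>i<n. (z i)\<^sup>2)"
proof -
  have "(\<Sum>k\<le>m. 4 ^ k * real (card {i. i < n \<and> \<bar>z i\<bar> = 2 ^ k})) =
      (\<Sum>k\<le>m. \<Sum>i<n. if \<bar>z i\<bar> = 2 ^ k then 4 ^ k else 0)"
  proof (intro sum.cong refl)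
    fix k
    have "(\<Sum>i<n. if \<bar>z i\<bar> = 2 ^ k then 4 ^ k else (0::real)) = (\<Sum>i | i \<in> {..<n} \<and> \<bar>z i\<bar> = 2 ^ k. 4 ^ k)"
      by (rule sum.inter_filter[symmetric]) simp
    thus "4 ^ k * real (card {i. i < n \<and> \<bar>z i\<bar> = 2 ^ k}) = (\<Sum>i<n. if \<bar>z i\<bar> = 2 ^ k then 4 ^ k else (0::real))"
      by simp
  qed
  also have "\<dots> = (\<Sum>i<n. \<Sum>k\<le>m. if \<bar>z i\<bar> = 2 ^ k then 4 ^ k else 0)" by (rule sum.swap)
  also have "\<dots> = (\<Sum>i<n. (z i)\<^sup>2)"
  proof (intro sum.cong refl)
    fix i assume "i \<in> {..<n}"
    hence "z i = 0 \<or> (\<exists>l\<le>m. \<bar>z i\<bar> = 2 ^ l)" using assms[of i] by (auto simp: dyadic_def)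
    thus "(\<Sum>k\<le>m. if \<bar>z i\<bar> = 2 ^ k then 4 ^ k else 0) = (z i)\<^sup>2"
    proof
      assume "\<exists>l\<le>m. \<bar>z i\<bar> = 2 ^ l"
      then obtain l where l: "l \<le> m" "\<bar>z i\<bar> = 2 ^ l" by blast
      have "(\<Sum>k\<le>m. if \<bar>z i\<bar> = 2 ^ k then 4 ^ k else 0) = (\<Sum>k\<le>m. if k = l then 4 ^ k else (0::real))"
        using l by (intro sum.cong refl) auto
      also have "\<dots> = 4 ^ l" using l by simp
      also have "\<dots> = \<bar>z i\<bar>\<^sup>2" unfolding l(2) by (simp add: power2_eq_square power_mult_distrib[symmetric])
      finally show ?thesis by simp
    qed simp
  qed
  finally show ?thesis .
qed

text \<open>
  Here \<open>2 ^ q\<close> stands for \<open>\<surd>d\<close>: the pairs of levels whose product exceeds \<open>\<surd>d\<close> and whose ratio does not.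
\<close>

definition balanced :: "nat \<Rightarrow> nat \<Rightarrow> (nat \<times> nat) set" where
  "balanced q m = {(k, l). k \<le> m \<and> l \<le> m \<and> q < k + l \<and> k \<le> l + q \<and> l \<le> k + q}"

lemma finite_balanced [simp]: "finite (balanced q m)"
  by (rule finite_subset[of _ "{..m} \<times> {..m}"]) (auto simp: balanced_def)

text \<open>For fixed k the substitution j = k + l - q leaves a sum of
  \<open>2 ^ (j + q) / j\<close> over j up to 2 k, comparable with its last term, which is of order
  \<open>2 ^ q * 4 ^ k / k\<close>. The surviving factor 1 / k is what later absorbs the logarithm
  in the entropy.\<close>

lemma sum_balanced_weights:
  fixes H :: "nat \<Rightarrow> real"
  assumes "\<And>k. k \<le> m \<Longrightarrow> H k \<ge> 0"
  shows "(\<Sum>(k, l)\<in>balanced q m. 2 ^ (k + l) * H k / real (k + l - q)) \<le>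
    (\<Sum>k=1..m. 2 * 2 ^ q * (4 ^ k * H k / real k))"
proof -
  let ?B = "\<lambda>k. {l. q < k + l \<and> l \<le> k + q}"
  have finB: "finite (?B k)" for k by (rule finite_subset[of _ "{..k+q}"]) auto
  \<comment> \<open>Level 0 drops out: \<open>k = 0\<close> would require both \<open>q < l\<close>
    and \<open>l \<le> q\<close>.\<close>
  have "(\<Sum>(k, l)\<in>balanced q m. 2 ^ (k + l) * H k / real (k + l - q)) \<le>
      (\<Sum>(k, l)\<in>Sigma {1..m} ?B. 2 ^ (k + l) * H k / real (k + l - q))"
  proof (rule sum_mono2)
    show "finite (Sigma {1..m} ?B)" using finB by auto
    show "balanced q m \<subseteq> Sigma {1..m} ?B" by (auto simp: balanced_def)
  qed (use assms in auto)
  also have "\<dots> = (\<Sum>k=1..m. \<Sum>l\<in>?B k. 2 ^ (k + l) * H k / real (k + l - q))"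
    using finB by (subst sum.Sigma) auto
  also have "\<dots> \<le> (\<Sum>k=1..m. 2 * 2 ^ q * (4 ^ k * H k / real k))"
  proof (rule sum_mono)
    fix k assume k: "k \<in> {1..m}"
    have "(\<Sum>l\<in>?B k. 2 ^ (k + l) * H k / real (k + l - q)) = (\<Sum>l\<in>?B k. 2 ^ (k + l) / real (k + l - q)) * H k"
      by (simp add: sum_distrib_right)
    also have "(\<Sum>l\<in>?B k. 2 ^ (k + l) / real (k + l - q)) \<le> (\<Sum>j=1..2*k. 2 ^ (j + q) / real j)"
    proof -
      have "(\<Sum>l\<in>?B k. 2 ^ (k + l) / real (k + l - q)) = (\<Sum>j\<in>(\<lambda>l. k + l - q) ` ?B k. 2 ^ (j + q) / real j)"
        by (subst sum.reindex) (auto simp: inj_on_def intro!: sum.cong)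
      also have "\<dots> \<le> (\<Sum>j=1..2*k. 2 ^ (j + q) / real j)"
        by (intro sum_mono2) auto
      finally show ?thesis .
    qed
    hence "(\<Sum>l\<in>?B k. 2 ^ (k + l) / real (k + l - q)) * H k \<le> (\<Sum>j=1..2*k. 2 ^ (j + q) / real j) * H k"
      using assms[of k] k by (intro mult_right_mono) auto
    also have "(\<Sum>j=1..2*k. 2 ^ (j + q) / real j) = 2 ^ q * (\<Sum>j=1..2*k. 2 ^ j / real j)"
      unfolding sum_distrib_left by (intro sum.cong refl) (simp add: power_add)
    also have "\<dots> * H k \<le> 2 ^ q * (4 * 2 ^ (2*k) / real (2*k)) * H k"
      using assms[of k] k by (intro mult_right_mono mult_left_mono sum_power2_div_le) auto
    also have "\<dots> = 2 * 2 ^ q * (4 ^ k * H k / real k)" by (simp add: power_mult)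
    finally show "(\<Sum>l\<in>?B k. 2 ^ (k + l) * H k / real (k + l - q)) \<le> 2 * 2 ^ q * (4 ^ k * H k / real k)" .
  qed
  finally show ?thesis .
qed

lemma sum_balanced_swap: "(\<Sum>(k, l)\<in>balanced q m. f l k) = (\<Sum>(k, l)\<in>balanced q m. f k l)"
  by (rule sum.reindex_bij_witness[of _ prod.swap prod.swap]) (auto simp: balanced_def)

context planted_partition
begin

definition degree :: "nat set set \<Rightarrow> nat \<Rightarrow> real" where
  "degree E i = (\<Sum>j<n. if i \<noteq> j then of_bool ({i, j} \<in> E) else 0)"

lemma degree_nonneg: "degree E i \<ge> 0"
  unfolding degree_def by (intro sum_nonneg) auto

definition light_event :: "nat \<Rightarrow> nat set set \<Rightarrow> bool" where
  "light_event q E \<longleftrightarrow> (\<forall>z. (\<forall>i<n. z i \<in> dyadic (7 * n)) \<longrightarrow> (\<Sum>i<n. (z i)\<^sup>2) \<le> 7 * real n \<longrightarrow>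
     (\<Sum>j<n. \<Sum>i<j. light q (z i * z j) * W E i j) \<le> 206 * real n * 2 ^ q)"

definition discrepancy_event :: "nat set set \<Rightarrow> bool" where
  "discrepancy_event E \<longleftrightarrow> (\<forall>A B h. A \<subseteq> {..<n} \<longrightarrow> A \<noteq> {} \<longrightarrow> B \<subseteq> {..<n} \<longrightarrow> B \<noteq> {} \<longrightarrow> 1 \<le> h \<longrightarrow> h \<le> 7 * n \<longrightarrow>
     real h * ln 2 * edges_between n E A B \<le>
     (2 * d / n) * card A * card B * 2 ^ h + 3 * (entropy_bound n (card A) + entropy_bound n (card B)))"

text \<open>The discrepancy bound splits each pair of levels into a mean term and two entropies. The
  mean terms sum to at most a product of total masses, which gives 784; the entropies of either
  level are summable and give 348. Together 784 + 2 * 348 = 1480.\<close>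

lemma balanced_edges_bound:
  fixes z :: "nat \<Rightarrow> real"
  assumes d: "d \<le> 4 * 4 ^ q" and disc: "discrepancy_event E"
    and z: "\<And>i. i < n \<Longrightarrow> z i \<in> dyadic m" and zn: "(\<Sum>i<n. (z i)\<^sup>2) \<le> 7 * real n"
  defines "L \<equiv> \<lambda>k. {i. i < n \<and> \<bar>z i\<bar> = 2 ^ k}"
  shows "(\<Sum>(k, l)\<in>balanced q m. 2 ^ (k + l) * edges_between n E (L k) (L l)) \<le> 1480 * real n * 2 ^ q"
proof -
  define s where "s = (\<lambda>k. real (card (L k)))"
  define H where "H = (\<lambda>k. entropy_bound n (card (L k)))"
  have Lsub: "L k \<subseteq> {..<n}" for k by (auto simp: L_def)
  have cL: "card (L k) \<le> n" for k using card_mono[OF _ Lsub] by simp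
  have H0: "H k \<ge> 0" for k unfolding H_def by (intro entropy_bound_nonneg cL)
  have s0: "s k \<ge> 0" for k by (simp add: s_def)
  have lev: "(\<Sum>k\<le>m. 4 ^ k * s k) \<le> 7 * real n"
  proof -
    have "(\<Sum>k\<le>m. 4 ^ k * s k) = (\<Sum>i<n. (z i)\<^sup>2)"
      unfolding s_def L_def by (rule card_level_sum) (rule z)
    thus ?thesis using zn by simp
  qed
  have lev1: "(4::real) ^ k \<le> 7 * real n" if "k \<le> m" "L k \<noteq> {}" for k
  proof -
    have "finite (L k)" using Lsub finite_subset by blast
    hence "s k \<ge> 1" using that by (simp add: s_def Suc_le_eq card_gt_0_iff)
    hence "(4::real) ^ k * 1 \<le> 4 ^ k * s k" by (intro mult_left_mono) auto
    also have "\<dots> \<le> (\<Sum>k\<le>m. 4 ^ k * s k)" using that s0 by (intro member_le_sum) auto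
    finally show ?thesis using lev by simp
  qed
  have ln2: "ln (2::real) \<ge> 1/2" using ln2_ge_two_thirds by simp
  have edge: "2 ^ (k + l) * edges_between n E (L k) (L l) \<le>
      (4 * d / n / 2 ^ q) * ((4 ^ k * s k) * (4 ^ l * s l)) +
      (6 * (2 ^ (k + l) * H k / real (k + l - q)) + 6 * (2 ^ (k + l) * H l / real (k + l - q)))"
    if kl: "(k, l) \<in> balanced q m" for k l
  proof (cases "L k = {} \<or> L l = {}")
    case True
    hence "edges_between n E (L k) (L l) = 0" unfolding edges_between_def by (intro sum.neutral) auto
    moreover have "0 \<le> (4 * d / n / 2 ^ q) * ((4 ^ k * s k) * (4 ^ l * s l)) +
      (6 * (2 ^ (k + l) * H k / real (k + l - q)) + 6 * (2 ^ (k + l) * H l / real (k + l - q)))"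
      using s0 H0 d_pos by (intro add_nonneg_nonneg mult_nonneg_nonneg divide_nonneg_nonneg) auto
    ultimately show ?thesis by simp
  next
    case False
    \<comment> \<open>With this \<open>h\<close> the mean term becomes a product of level masses, \<open>2\<^sup>k\<^sup>+\<^sup>l 2\<^sup>h = 4\<^sup>k 4\<^sup>l / 2\<^sup>q\<close>.\<close>
    define h where "h = k + l - q"
    have h: "1 \<le> h" "k + l = h + q" using kl by (auto simp: h_def balanced_def)
    \<comment> \<open>A nonempty level satisfies \<open>4 ^ k \<le> 7 * real n\<close>, and
      \<open>2 * 2 ^ (k + l) \<le> 4 ^ k + 4 ^ l\<close>; so the values of \<open>h\<close> covered
      by the discrepancy event suffice.\<close>
    have "h \<le> 7 * n"
    proof -
      have "real h \<le> real (k + l)" using h by simp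
      also have "\<dots> \<le> 2 ^ (k + l)" using of_nat_less_two_power[of "k + l", where 'a = real] by (simp only: less_imp_le)
      also have "2 * \<dots> \<le> 4 ^ k + (4::real) ^ l"
      proof -
        have "0 \<le> ((2::real) ^ k - 2 ^ l)\<^sup>2" by simp
        also have "\<dots> = 4 ^ k + 4 ^ l - 2 * 2 ^ (k + l)"
        proof -
          have "(4::real) ^ k = 2 ^ k * 2 ^ k" for k by (simp add: power_mult_distrib[symmetric])
          thus ?thesis by (simp add: power2_eq_square power_add algebra_simps)
        qed
        finally show ?thesis by simp
      qed
      also have "\<dots> \<le> 7 * real n + 7 * real n"
        using kl False by (intro add_mono lev1) (auto simp: balanced_def)
      finally show ?thesis by simp
    qed
    with disc False h Lsub have
      "real h * ln 2 * edges_between n E (L k) (L l) \<le> (2 * d / n) * s k * s l * 2 ^ h + 3 * (H k + H l)"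
      by (simp add: discrepancy_event_def s_def H_def)
    moreover have "real h * (1/2) * edges_between n E (L k) (L l) \<le> real h * ln 2 * edges_between n E (L k) (L l)"
      using ln2 by (intro mult_right_mono mult_left_mono) (auto simp: edges_between_def intro!: sum_nonneg)
    ultimately have "real h * (1/2) * edges_between n E (L k) (L l) \<le> (2 * d / n) * s k * s l * 2 ^ h + 3 * (H k + H l)"
      by linarith
    hence "edges_between n E (L k) (L l) \<le> 2 * ((2 * d / n) * s k * s l * 2 ^ h + 3 * (H k + H l)) / h"
      using h by (simp add: field_simps)
    also have "\<dots> = ((4 * d / n) * s k * s l * 2 ^ h) / h + 6 * (H k + H l) / h"
      by (simp add: add_divide_distrib distrib_left)
    also have "((4 * d / n) * s k * s l * 2 ^ h) / h \<le> ((4 * d / n) * s k * s l * 2 ^ h) / 1"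
      using h s0 d_pos by (intro divide_left_mono mult_nonneg_nonneg) auto
    finally have "2 ^ (k + l) * edges_between n E (L k) (L l) \<le>
        2 ^ (k + l) * ((4 * d / n) * s k * s l * 2 ^ h + 6 * (H k + H l) / h)"
      by (intro mult_left_mono) auto
    also have "\<dots> = (4 * d / n) * (2 ^ (k + l) * 2 ^ h) * (s k * s l) +
       (6 * (2 ^ (k + l) * H k / real h) + 6 * (2 ^ (k + l) * H l / real h))"
      by (simp add: distrib_left add_divide_distrib mult_ac)
    also have "2 ^ (k + l) * 2 ^ h = (4 ^ k * 4 ^ l / 2 ^ q :: real)"
    proof -
      have "(4::real) ^ k * 4 ^ l = 2 ^ (k + l) * 2 ^ (k + l)"
        by (simp add: power_mult_distrib[symmetric] power_add[symmetric])
      also have "\<dots> = 2 ^ (k + l) * 2 ^ h * 2 ^ q" unfolding h(2) by (simp add: power_add)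
      finally show ?thesis by simp
    qed
    finally show ?thesis by (simp add: h_def mult_ac)
  qed
  have "(\<Sum>(k, l)\<in>balanced q m. 2 ^ (k + l) * edges_between n E (L k) (L l)) \<le>
     (\<Sum>(k, l)\<in>balanced q m. (4 * d / n / 2 ^ q) * ((4 ^ k * s k) * (4 ^ l * s l)) +
      (6 * (2 ^ (k + l) * H k / real (k + l - q)) + 6 * (2 ^ (k + l) * H l / real (k + l - q))))"
    by (rule sum_mono) (use edge in auto)
  also have "\<dots> = (\<Sum>(k, l)\<in>balanced q m. (4 * d / n / 2 ^ q) * ((4 ^ k * s k) * (4 ^ l * s l))) +
      ((\<Sum>(k, l)\<in>balanced q m. 6 * (2 ^ (k + l) * H k / real (k + l - q))) +
       (\<Sum>(k, l)\<in>balanced q m. 6 * (2 ^ (k + l) * H l / real (k + l - q))))"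
    by (simp only: case_prod_unfold sum.distrib)
  also have "(\<Sum>(k, l)\<in>balanced q m. 6 * (2 ^ (k + l) * H l / real (k + l - q))) =
      (\<Sum>(k, l)\<in>balanced q m. 6 * (2 ^ (k + l) * H k / real (k + l - q)))"
    using sum_balanced_swap[of "\<lambda>k l. 6 * (2 ^ (k + l) * H k / real (k + l - q))" q m]
    by (simp only: add.commute)
  also have "(\<Sum>(k, l)\<in>balanced q m. 6 * (2 ^ (k + l) * H k / real (k + l - q))) \<le> 348 * real n * 2 ^ q"
  proof -
    have "(\<Sum>(k, l)\<in>balanced q m. 6 * (2 ^ (k + l) * H k / real (k + l - q))) =
        6 * (\<Sum>(k, l)\<in>balanced q m. 2 ^ (k + l) * H k / real (k + l - q))"
      by (simp only: case_prod_unfold sum_distrib_left)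
    also have "\<dots> \<le> 6 * (\<Sum>k=1..m. 2 * 2 ^ q * (4 ^ k * H k / real k))"
      by (intro mult_left_mono sum_balanced_weights H0) auto
    also have "\<dots> \<le> 6 * (\<Sum>k=1..m. 2 * 2 ^ q * (4 * (4 ^ k * s k) + real n * (1/2) ^ k))"
      unfolding H_def s_def
      by (intro mult_left_mono sum_mono weighted_entropy_bound cL) auto
    also have "\<dots> = 12 * 2 ^ q * (4 * (\<Sum>k=1..m. 4 ^ k * s k) + real n * (\<Sum>k=1..m. (1/2) ^ k))"
      by (simp only: sum_distrib_left sum.distrib[symmetric] distrib_left mult.assoc[symmetric]) simp
    also have "\<dots> \<le> 12 * 2 ^ q * (4 * (7 * real n) + real n * 1)"
    proof (intro mult_left_mono add_mono)
      have "(\<Sum>k=1..m. 4 ^ k * s k) \<le> (\<Sum>k\<le>m. 4 ^ k * s k)" using s0 by (intro sum_mono2) auto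
      thus "(\<Sum>k=1..m. 4 ^ k * s k) \<le> 7 * real n" using lev by simp
      have "(\<Sum>k=1..m. (1/2::real) ^ k) = 1 - (1/2) ^ m" by (induction m) auto
      thus "(\<Sum>k=1..m. (1/2::real) ^ k) \<le> 1" by simp
    qed auto
    also have "\<dots> = 348 * real n * 2 ^ q" by simp
    finally show ?thesis .
  qed
  also have "(\<Sum>(k, l)\<in>balanced q m. (4 * d / n / 2 ^ q) * ((4 ^ k * s k) * (4 ^ l * s l))) \<le> 784 * real n * 2 ^ q"
  proof -
    have "(\<Sum>(k, l)\<in>balanced q m. (4 * d / n / 2 ^ q) * ((4 ^ k * s k) * (4 ^ l * s l))) \<le>
        (\<Sum>(k, l)\<in>{..m} \<times> {..m}. (4 * d / n / 2 ^ q) * ((4 ^ k * s k) * (4 ^ l * s l)))"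
      using s0 d_pos by (intro sum_mono2) (auto simp: balanced_def)
    also have "\<dots> = (4 * d / n / 2 ^ q) * ((\<Sum>k\<le>m. 4 ^ k * s k) * (\<Sum>l\<le>m. 4 ^ l * s l))"
      by (simp only: sum.cartesian_product[symmetric] sum_distrib_left sum_distrib_right) (rule sum.swap)
    also have "\<dots> \<le> (4 * d / n / 2 ^ q) * ((7 * real n) * (7 * real n))"
      using lev s0 d_pos by (intro mult_left_mono mult_mono sum_nonneg) auto
    also have "\<dots> = 196 * real n * (d / 2 ^ q)" using n by simp
    also have "\<dots> \<le> 196 * real n * (4 * 2 ^ q)"
    proof (rule mult_left_mono)
      have "(4::real) ^ q = 2 ^ q * 2 ^ q" by (simp add: power_mult_distrib[symmetric])
      thus "d / 2 ^ q \<le> 4 * 2 ^ q" using d by (simp add: field_simps)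
    qed simp
    finally show ?thesis by simp
  qed
  finally show ?thesis by simp
qed

text \<open>Every pair is charged to one or two of four terms. For a heavy pair \<open>W\<close> is
  bounded by probability plus edge. The probability part gains from
  \<open>t \<le> t\<^sup>2 / 2 ^ q\<close>. An edge between very unequal entries is charged to the
  larger square, and thereby to a degree; any other edge is charged to its pair of levels.\<close>

lemma form_term_bound:
  fixes z :: "nat \<Rightarrow> real"
  assumes zi: "z i \<in> dyadic m" and zj: "z j \<in> dyadic m" and ij: "i < n" "j < n"
  defines "L \<equiv> \<lambda>k. {i. i < n \<and> \<bar>z i\<bar> = 2 ^ k}"
  shows "z i * z j * W E i j \<le> light q (z i * z j) * W E i j + (2 * d / n / 2 ^ q) * ((z i)\<^sup>2 * (z j)\<^sup>2) +
     ((z i)\<^sup>2 + (z j)\<^sup>2) * (of_bool ({i, j} \<in> E) / 2 ^ q) +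
     (\<Sum>(k, l)\<in>balanced q m. 2 ^ (k + l) * (of_bool (i \<in> L k \<and> j \<in> L l) * of_bool ({i, j} \<in> E)))"
    (is "_ \<le> ?l + ?A + ?B + ?C")
proof -
  define X where "X = (of_bool ({i, j} \<in> E) :: real)"
  have X: "0 \<le> X" "X \<le> 1" by (auto simp: X_def)
  have pos: "0 \<le> ?A" "0 \<le> ?B" "0 \<le> ?C"
    using d_pos by (auto intro!: sum_nonneg mult_nonneg_nonneg divide_nonneg_nonneg)
  show ?thesis
  proof (cases "\<bar>z i * z j\<bar> \<le> 2 ^ q")
    case True
    thus ?thesis using pos by (simp add: light_def)
  next
    case False
    define t where "t = \<bar>z i * z j\<bar>"
    have t: "2 ^ q < t" "0 < t" using False zero_less_power[of "2::real" q] unfolding t_def by (linarith+)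
    hence "z i \<noteq> 0" "z j \<noteq> 0" by (auto simp: t_def)
    then obtain k l where k: "k \<le> m" "\<bar>z i\<bar> = 2 ^ k" and l: "l \<le> m" "\<bar>z j\<bar> = 2 ^ l"
      using zi zj by (auto simp: dyadic_def)
    have tkl: "t = 2 ^ (k + l)" using k l by (simp add: t_def abs_mult power_add)
    have kl: "q < k + l" using t(1) unfolding tkl by (simp add: power_strict_increasing_iff)
    have "z i * z j * W E i j \<le> t * \<bar>W E i j\<bar>" unfolding t_def abs_mult[symmetric] by simp
    also have "\<dots> \<le> t * (X + p i j)"
      using t edge_prob_bounds[of "{i, j}"] X by (intro mult_left_mono) (auto simp: W_def X_def[symmetric])
    also have "\<dots> = t * p i j + t * X" by (simp add: distrib_left)
    also have "t * p i j \<le> ?A"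
    proof -
      have "t * 2 ^ q \<le> t * t" using t by (intro mult_left_mono) auto
      hence "t \<le> t\<^sup>2 / 2 ^ q" by (simp add: field_simps power2_eq_square)
      hence "t * p i j \<le> (t\<^sup>2 / 2 ^ q) * (2 * d / n)"
        using edge_prob_bounds[of "{i, j}"] t by (intro mult_mono) auto
      thus ?thesis by (simp add: t_def power_mult_distrib mult_ac)
    qed
    also have "t * X \<le> ?B + ?C"
    proof (cases "(k, l) \<in> balanced q m")
      case True
      have "t * X = (case (k, l) of (k, l) \<Rightarrow> 2 ^ (k + l) * (of_bool (i \<in> L k \<and> j \<in> L l) * of_bool ({i, j} \<in> E)))"
        using k l ij by (simp add: tkl L_def X_def)
      also have "\<dots> \<le> ?C"
        by (rule member_le_sum[OF True]) auto
      finally show ?thesis using pos(2) by linarith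
    next
      case False
      have "t \<le> ((z i)\<^sup>2 + (z j)\<^sup>2) / 2 ^ q"
      proof -
        have "t * 2 ^ q \<le> (z i)\<^sup>2 + (z j)\<^sup>2"
        proof (cases "l > k + q")
          case True
          hence "(2::real) ^ (k + q) * 2 ^ l \<le> 2 ^ l * 2 ^ l" by (intro mult_right_mono power_increasing) auto
          hence "t * 2 ^ q \<le> \<bar>z j\<bar>\<^sup>2" by (simp add: tkl l power_add power2_eq_square mult_ac)
          thus ?thesis by (simp add: add_increasing)
        next
          case l': False
          hence "k > l + q" using False k l kl by (auto simp: balanced_def)
          hence "(2::real) ^ (l + q) * 2 ^ k \<le> 2 ^ k * 2 ^ k" by (intro mult_right_mono power_increasing) auto
          hence "t * 2 ^ q \<le> \<bar>z i\<bar>\<^sup>2" by (simp add: tkl k power_add power2_eq_square mult_ac)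
          thus ?thesis by (simp add: add_increasing2)
        qed
        thus ?thesis by (simp add: field_simps)
      qed
      hence "t * X \<le> ((z i)\<^sup>2 + (z j)\<^sup>2) / 2 ^ q * X" using X by (intro mult_right_mono)
      also have "\<dots> = ?B" by (simp add: X_def)
      finally show ?thesis using pos by simp
    qed
    finally show ?thesis using False by (simp add: light_def)
  qed
qed

text \<open>1910 = 206 + 196 + 28 + 1480: light pairs, probabilities of heavy pairs, edges charged
  to degrees, balanced edges.\<close>

lemma dyadic_form_bound:
  fixes z :: "nat \<Rightarrow> real"
  assumes d: "d \<le> 4 * 4 ^ q" and li: "light_event q E" and disc: "discrepancy_event E"
    and z: "\<And>i. i < n \<Longrightarrow> z i \<in> dyadic (7 * n)" and zn: "(\<Sum>i<n. (z i)\<^sup>2) \<le> 7 * real n"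
    and zd: "(\<Sum>i<n. (z i)\<^sup>2 * degree E i) \<le> 7 * real n * d"
  shows "(\<Sum>j<n. \<Sum>i<j. z i * z j * W E i j) \<le> 1910 * real n * 2 ^ q"
proof -
  define L where "L = (\<lambda>k. {i. i < n \<and> \<bar>z i\<bar> = 2 ^ k})"
  let ?m = "7 * n"
  let ?l = "\<lambda>i j. light q (z i * z j) * W E i j"
  let ?A = "\<lambda>i j. (2 * d / n / 2 ^ q) * ((z i)\<^sup>2 * (z j)\<^sup>2)"
  let ?B = "\<lambda>i j. ((z i)\<^sup>2 + (z j)\<^sup>2) * (of_bool ({i, j} \<in> E) / 2 ^ q)"
  let ?C = "\<lambda>i j. \<Sum>(k, l)\<in>balanced q ?m. 2 ^ (k + l) * (of_bool (i \<in> L k \<and> j \<in> L l) * of_bool ({i, j} \<in> E))"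
  have dq: "d / 2 ^ q \<le> 4 * 2 ^ q"
  proof -
    have "(4::real) ^ q = 2 ^ q * 2 ^ q" by (simp add: power_mult_distrib[symmetric])
    thus ?thesis using d by (simp add: field_simps)
  qed
  have "(\<Sum>j<n. \<Sum>i<j. z i * z j * W E i j) \<le> (\<Sum>j<n. \<Sum>i<j. ?l i j + ?A i j + ?B i j + ?C i j)"
    unfolding L_def by (intro sum_mono form_term_bound z) auto
  also have "\<dots> = (\<Sum>j<n. \<Sum>i<j. ?l i j) + (\<Sum>j<n. \<Sum>i<j. ?A i j) + (\<Sum>j<n. \<Sum>i<j. ?B i j) + (\<Sum>j<n. \<Sum>i<j. ?C i j)"
    by (simp only: sum.distrib)
  also have "(\<Sum>j<n. \<Sum>i<j. ?l i j) \<le> 206 * real n * 2 ^ q"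
    using li z zn by (simp add: light_event_def)
  also have "(\<Sum>j<n. \<Sum>i<j. ?A i j) \<le> 196 * real n * 2 ^ q"
  proof -
    have "(\<Sum>j<n. \<Sum>i<j. ?A i j) = (d / n / 2 ^ q) * (2 * (\<Sum>j<n. \<Sum>i<j. (z i)\<^sup>2 * (z j)\<^sup>2))"
      unfolding sum_distrib_left by (intro sum.cong refl) simp
    also have "\<dots> \<le> (d / n / 2 ^ q) * (7 * real n)\<^sup>2"
    proof (rule mult_left_mono)
      have "2 * (\<Sum>j<n. \<Sum>i<j. (z i)\<^sup>2 * (z j)\<^sup>2) \<le> (\<Sum>i<n. (z i)\<^sup>2)\<^sup>2" by (rule sum_pairs_product_le)
      also have "\<dots> \<le> (7 * real n)\<^sup>2" using zn by (intro power_mono sum_nonneg) auto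
      finally show "2 * (\<Sum>j<n. \<Sum>i<j. (z i)\<^sup>2 * (z j)\<^sup>2) \<le> (7 * real n)\<^sup>2" .
    qed (use d_pos in simp)
    also have "\<dots> = 49 * real n * (d / 2 ^ q)" using n by (simp add: power2_eq_square)
    also have "\<dots> \<le> 49 * real n * (4 * 2 ^ q)" using dq by (intro mult_left_mono) auto
    finally show ?thesis by simp
  qed
  also have "(\<Sum>j<n. \<Sum>i<j. ?B i j) \<le> 28 * real n * 2 ^ q"
  proof -
    have "(\<Sum>j<n. \<Sum>i<j. ?B i j) = (\<Sum>i<n. (z i)\<^sup>2 * (\<Sum>j<n. if i \<noteq> j then of_bool ({i, j} \<in> E) / 2 ^ q else 0))"
      by (rule sum_offdiag_symmetric) (simp add: insert_commute)
    also have "\<dots> = (\<Sum>i<n. (z i)\<^sup>2 * degree E i) / 2 ^ q"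
    proof -
      have "(\<Sum>j<n. if i \<noteq> j then of_bool ({i, j} \<in> E) / 2 ^ q else 0) = degree E i / 2 ^ q" for i
        unfolding sum_divide_distrib degree_def by (intro sum.cong refl) simp
      thus ?thesis by (simp only: sum_divide_distrib times_divide_eq_right)
    qed
    also have "\<dots> \<le> 7 * real n * d / 2 ^ q" using zd by (intro divide_right_mono) auto
    also have "\<dots> = 7 * real n * (d / 2 ^ q)" by simp
    also have "\<dots> \<le> 7 * real n * (4 * 2 ^ q)" using dq by (intro mult_left_mono) auto
    finally show ?thesis by simp
  qed
  also have "(\<Sum>j<n. \<Sum>i<j. ?C i j) \<le> 1480 * real n * 2 ^ q"
  proof -
    have "(\<Sum>j<n. \<Sum>i<j. ?C i j) = (\<Sum>x\<in>balanced q ?m. \<Sum>j<n. \<Sum>i<j. case x of (k, l) \<Rightarrow>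
        2 ^ (k + l) * (of_bool (i \<in> L k \<and> j \<in> L l) * of_bool ({i, j} \<in> E)))"
    proof -
      have "(\<Sum>j<n. \<Sum>i<j. ?C i j) = (\<Sum>j<n. \<Sum>x\<in>balanced q ?m. \<Sum>i<j. case x of (k, l) \<Rightarrow>
        2 ^ (k + l) * (of_bool (i \<in> L k \<and> j \<in> L l) * of_bool ({i, j} \<in> E)))"
        by (rule sum.cong[OF refl], rule sum.swap)
      also have "\<dots> = (\<Sum>x\<in>balanced q ?m. \<Sum>j<n. \<Sum>i<j. case x of (k, l) \<Rightarrow>
        2 ^ (k + l) * (of_bool (i \<in> L k \<and> j \<in> L l) * of_bool ({i, j} \<in> E)))"
        by (rule sum.swap)
      finally show ?thesis .
    qed
    also have "\<dots> = (\<Sum>(k, l)\<in>balanced q ?m. 2 ^ (k + l) * edges_between n E (L k) (L l))"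
      by (intro sum.cong refl) (simp only: case_prod_unfold edges_between_def sum_distrib_left)
    also have "\<dots> \<le> 1480 * real n * 2 ^ q"
      unfolding L_def by (rule balanced_edges_bound[OF d disc z zn])
    finally show ?thesis .
  qed
  finally show ?thesis by simp
qed

text \<open>By homogeneity the weighted norm may be normalised to n. Rounding replaces a square by
  at most four times itself plus 1, and the weights \<open>1 + degree E i / d\<close> sum to at most
  3 n. The rounded vector thus has weighted norm at most 4 n + 3 n, the origin of the budget
  \<open>7 * real n\<close>.\<close>

theorem form_bound:
  fixes x :: "nat \<Rightarrow> real"
  assumes d: "d \<le> 4 * 4 ^ q" and li: "light_event q E" and disc: "discrepancy_event E"
    and deg: "(\<Sum>i<n. degree E i) \<le> 2 * real n * d"
  shows "(\<Sum>j<n. \<Sum>i<j. x i * x j * W E i j) \<le> 1910 * 2 ^ q * (\<Sum>i<n. (1 + degree E i / d) * (x i)\<^sup>2)"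
proof -
  define \<Phi> where "\<Phi> = (\<Sum>i<n. (1 + degree E i / d) * (x i)\<^sup>2)"
  have w1: "1 + degree E i / d \<ge> 1" for i using degree_nonneg[of E i] d_pos by simp
  have sqle: "(\<Sum>i<n. (y i)\<^sup>2) \<le> (\<Sum>i<n. (1 + degree E i / d) * (y i)\<^sup>2)" for y :: "nat \<Rightarrow> real"
    using mult_right_mono[OF w1 zero_le_power2] by (intro sum_mono) simp
  have "\<Phi> \<ge> 0" unfolding \<Phi>_def using w1 by (intro sum_nonneg mult_nonneg_nonneg) (auto intro: order_trans[OF zero_le_one])
  show ?thesis
  proof (cases "\<Phi> = 0")
    case True
    have "(\<Sum>i<n. (x i)\<^sup>2) = 0"
      using sqle[of x] True sum_nonneg[of "{..<n}" "\<lambda>i. (x i)\<^sup>2"] by (simp add: \<Phi>_def)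
    hence "\<forall>i\<in>{..<n}. (x i)\<^sup>2 = 0" by (subst (asm) sum_nonneg_eq_0_iff) auto
    hence "x i = 0" if "i < n" for i using that by simp
    hence "(\<Sum>j<n. \<Sum>i<j. x i * x j * W E i j) = 0" by (intro sum.neutral) auto
    thus ?thesis using True by (simp add: \<Phi>_def)
  next
    case False
    hence \<Phi>: "\<Phi> > 0" using \<open>\<Phi> \<ge> 0\<close> by simp
    define c where "c = sqrt (n / \<Phi>)"
    have c: "c > 0" "c\<^sup>2 = n / \<Phi>" using \<Phi> n by (auto simp: c_def)
    define y where "y = (\<lambda>i. c * x i)"
    have y\<Phi>: "(\<Sum>i<n. (1 + degree E i / d) * (y i)\<^sup>2) = n"
    proof -
      have "(\<Sum>i<n. (1 + degree E i / d) * (y i)\<^sup>2) = c\<^sup>2 * \<Phi>"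
        unfolding \<Phi>_def sum_distrib_left by (intro sum.cong refl) (simp add: y_def power_mult_distrib mult_ac)
      thus ?thesis using c \<Phi> by simp
    qed
    have ysq: "(\<Sum>i<n. (y i)\<^sup>2) \<le> n" using sqle[of y] y\<Phi> by simp
    have "2 * \<bar>y i\<bar> \<le> real (7 * n)" if "i < n" for i
    proof -
      have "(y i)\<^sup>2 \<le> (\<Sum>i<n. (y i)\<^sup>2)" using that by (intro member_le_sum) auto
      hence "\<bar>y i\<bar>\<^sup>2 \<le> n" using ysq by simp
      moreover have "2 * \<bar>y i\<bar> \<le> \<bar>y i\<bar>\<^sup>2 + 1"
        using zero_le_power2[of "\<bar>y i\<bar> - 1"] by (simp add: power2_diff)
      ultimately show ?thesis using n by simp
    qed
    hence "\<exists>u w. u \<in> dyadic (7 * n) \<and> w \<in> dyadic (7 * n) \<and> u \<le> y i \<and> y i \<le> w \<and>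
        u\<^sup>2 \<le> 4 * (y i)\<^sup>2 + 1 \<and> w\<^sup>2 \<le> 4 * (y i)\<^sup>2 + 1" if "i < n" for i
      using dyadic_rounding[of "y i" "7 * n"] that by blast
    then obtain u w where uw: "\<And>i. i < n \<Longrightarrow> u i \<in> dyadic (7 * n) \<and> w i \<in> dyadic (7 * n) \<and> u i \<le> y i \<and> y i \<le> w i \<and>
        (u i)\<^sup>2 \<le> 4 * (y i)\<^sup>2 + 1 \<and> (w i)\<^sup>2 \<le> 4 * (y i)\<^sup>2 + 1" by metis
    define F where "F = (\<lambda>x :: nat \<Rightarrow> real. \<Sum>j<n. \<Sum>i<j. x i * x j * W E i j)"
    have "\<exists>z. (\<forall>i<n. z i = u i \<or> z i = w i) \<and> F y \<le> F z"
    proof (rule multiaffine_le_vertex)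
      show "\<exists>\<alpha> \<beta>. \<forall>t. F (g(m := t)) = \<alpha> + \<beta> * t" for g m unfolding F_def by (rule pair_form_affine)
    qed (use uw in auto)
    then obtain z where z: "\<And>i. i < n \<Longrightarrow> z i = u i \<or> z i = w i" and Fz: "F y \<le> F z" by blast
    have zd: "z i \<in> dyadic (7 * n)" if "i < n" for i using z[OF that] uw[OF that] by auto
    have zsq: "(z i)\<^sup>2 \<le> 4 * (y i)\<^sup>2 + 1" if "i < n" for i using z[OF that] uw[OF that] by auto
    have "(\<Sum>i<n. (1 + degree E i / d) * (z i)\<^sup>2) \<le> (\<Sum>i<n. (1 + degree E i / d) * (4 * (y i)\<^sup>2 + 1))"
      using zsq w1 by (intro sum_mono mult_left_mono) (auto intro: order_trans[OF zero_le_one])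
    also have "\<dots> = (\<Sum>i<n. 4 * ((1 + degree E i / d) * (y i)\<^sup>2) + (1 + degree E i / d))"
      by (intro sum.cong refl) (simp only: distrib_left mult_1_right mult.left_commute)
    also have "\<dots> = 4 * (\<Sum>i<n. (1 + degree E i / d) * (y i)\<^sup>2) + (n + (\<Sum>i<n. degree E i) / d)"
      by (simp only: sum.distrib sum_distrib_left sum_divide_distrib) simp
    also have "\<dots> \<le> 4 * n + (n + 2 * real n)"
      using deg d_pos y\<Phi> by (simp add: divide_le_eq)
    finally have z7: "(\<Sum>i<n. (1 + degree E i / d) * (z i)\<^sup>2) \<le> 7 * real n" by simp
    have "F z \<le> 1910 * real n * 2 ^ q" unfolding F_def
    proof (rule dyadic_form_bound[OF d li disc zd])
      show "(\<Sum>i<n. (z i)\<^sup>2) \<le> 7 * real n" using sqle[of z] z7 by linarith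
      have "(\<Sum>i<n. (z i)\<^sup>2 * degree E i) / d \<le> (\<Sum>i<n. (1 + degree E i / d) * (z i)\<^sup>2)"
        unfolding sum_divide_distrib by (intro sum_mono) (simp add: algebra_simps)
      hence "(\<Sum>i<n. (z i)\<^sup>2 * degree E i) / d \<le> 7 * real n" using z7 by linarith
      thus "(\<Sum>i<n. (z i)\<^sup>2 * degree E i) \<le> 7 * real n * d" using d_pos by (simp add: divide_le_eq)
    qed
    moreover have "F y = c\<^sup>2 * F x"
      unfolding F_def y_def sum_distrib_left by (intro sum.cong refl) (simp add: power2_eq_square mult_ac)
    ultimately have "(n / \<Phi>) * F x \<le> 1910 * real n * 2 ^ q" using Fz c by simp
    hence "F x \<le> 1910 * 2 ^ q * \<Phi>" using \<Phi> n by (simp add: field_simps)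
    thus ?thesis by (simp add: F_def \<Phi>_def)
  qed
qed

end

section \<open>From the quadratic form to the second eigenvector\<close>

lemma double_sum_product:
  fixes f g :: "nat \<Rightarrow> real"
  shows "(\<Sum>i<n. \<Sum>j<n. c * (f i * g j)) = c * ((\<Sum>i<n. f i) * (\<Sum>j<n. g j))"
  by (subst sum_product) (simp only: sum_distrib_left)

section \<open>Expectation of the adjacency matrix\<close>

context planted_partition
begin

abbreviation \<sigma> :: "nat \<Rightarrow> real" where "\<sigma> \<equiv> community_sign S"

definition \<delta> :: real where "\<delta> = (a - b) / 2"

lemma sigma_square [simp]: "\<sigma> i * \<sigma> i = 1" "(\<sigma> i)\<^sup>2 = 1"
  by (auto simp: community_sign_def)

lemma sum_sigma: "(\<Sum>i<n. \<sigma> i) = 0"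
proof -
  have fS: "finite S" using S(1) finite_subset by blast
  have "(\<Sum>i<n. \<sigma> i) = (\<Sum>i<n. 2 * indicat_real S i - 1)"
    by (intro sum.cong refl) (auto simp: community_sign_def indicator_def)
  also have "\<dots> = 2 * (\<Sum>i<n. indicat_real S i) - real n"
    by (simp add: sum_subtractf sum_distrib_left)
  also have "(\<Sum>i<n. indicat_real S i) = real (card S)"
    using S(1) by (simp add: indicator_def Int_absorb1 Int_def[symmetric] inf.absorb2)
  also have "2 * real (card S) - real n = 0" using S(2) by linarith
  finally show ?thesis .
qed

text \<open>Off the diagonal the expectation is a rank-two matrix built from the all-ones and the
  community vector. On the diagonal this matrix has the entries a / n, because
  \<open>d + \<delta> = a\<close>; they appear below as a correction.\<close>

lemma edge_prob_sign: "i \<noteq> j \<Longrightarrow> p i j = d / n + \<delta> / n * (\<sigma> i * \<sigma> j)"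
  using n by (auto simp: edge_prob_def community_sign_def d_def \<delta>_def field_simps)

lemma p_form:
  "2 * (\<Sum>j<n. \<Sum>i<j. x i * x j * p i j) =
     d / n * (\<Sum>i<n. x i)\<^sup>2 + \<delta> / n * (\<Sum>i<n. \<sigma> i * x i)\<^sup>2 - a / n * (\<Sum>i<n. (x i)\<^sup>2)"
proof -
  have "2 * (\<Sum>j<n. \<Sum>i<j. x i * x j * p i j) = (\<Sum>i<n. \<Sum>j<n. if i \<noteq> j then x i * x j * p i j else 0)"
    by (rule sum_offdiag_double[symmetric]) (simp add: insert_commute mult.commute)
  also have "\<dots> = (\<Sum>i<n. \<Sum>j<n. d / n * (x i * x j) + \<delta> / n * ((\<sigma> i * x i) * (\<sigma> j * x j)) -
      (if j = i then a / n * (x i)\<^sup>2 else 0))"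
  proof (intro sum.cong refl)
    fix i j
    have "d / n * (x i * x i) + \<delta> / n * ((\<sigma> i * x i) * (\<sigma> i * x i)) = a / n * (x i)\<^sup>2"
    proof -
      have "(\<sigma> i * x i) * (\<sigma> i * x i) = (x i)\<^sup>2"
        using sigma_square(1)[of i] by (metis mult.left_commute mult.assoc mult_1 power2_eq_square)
      moreover have "d / n + \<delta> / n = a / n" by (simp add: d_def \<delta>_def add_divide_distrib[symmetric])
      ultimately show ?thesis by (simp only: power2_eq_square[symmetric] distrib_right[symmetric])
    qed
    thus "(if i \<noteq> j then x i * x j * p i j else 0) = d / n * (x i * x j) + \<delta> / n * ((\<sigma> i * x i) * (\<sigma> j * x j)) -
      (if j = i then a / n * (x i)\<^sup>2 else 0)"
      by (cases "i = j") (auto simp: edge_prob_sign distrib_left mult_ac)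
  qed
  also have "\<dots> = d / n * ((\<Sum>i<n. x i) * (\<Sum>j<n. x j)) + \<delta> / n * ((\<Sum>i<n. \<sigma> i * x i) * (\<Sum>j<n. \<sigma> j * x j))
      - (\<Sum>i<n. a / n * (x i)\<^sup>2)"
    by (simp only: sum.distrib sum_subtractf double_sum_product) simp
  finally show ?thesis by (simp only: power2_eq_square sum_distrib_left)
qed

lemma sum_p_row: "i < n \<Longrightarrow> (\<Sum>j<n. if i \<noteq> j then p i j else 0) = d - a / n"
proof -
  assume i: "i < n"
  have "(\<Sum>j<n. if i \<noteq> j then p i j else 0) = (\<Sum>j<n. d / n + \<delta> / n * \<sigma> i * \<sigma> j - (if j = i then a / n else 0))"
  proof (intro sum.cong refl)
    fix j
    have "d / n + \<delta> / n = a / n" by (simp add: d_def \<delta>_def add_divide_distrib[symmetric])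
    thus "(if i \<noteq> j then p i j else 0) = d / n + \<delta> / n * \<sigma> i * \<sigma> j - (if j = i then a / n else 0)"
      by (cases "i = j") (simp_all add: edge_prob_sign mult.assoc)
  qed
  also have "\<dots> = d + \<delta> / n * \<sigma> i * (\<Sum>j<n. \<sigma> j) - a / n"
    unfolding sum_distrib_left using i n by (simp add: sum.distrib sum_subtractf)
  finally show ?thesis by (simp add: sum_sigma)
qed

text \<open>Without self-loops the expected degree is d - a / n instead of d. As a / n is at most 1,
  the shift costs at most 2 per vertex, which \<open>d \<ge> 1\<close> absorbs.\<close>

lemma degree_deviation:
  fixes K :: real
  assumes "d \<ge> 1" "(\<Sum>i<n. (\<Sum>j<n. if i \<noteq> j then W E i j else 0)\<^sup>2) \<le> K * n * d"
  shows "(\<Sum>i<n. (degree E i - d)\<^sup>2) \<le> (2 * K + 2) * n * d"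
proof -
  let ?w = "\<lambda>i. \<Sum>j<n. if i \<noteq> j then W E i j else 0"
  have "(degree E i - d)\<^sup>2 \<le> 2 * (?w i)\<^sup>2 + 2" if "i < n" for i
  proof -
    have "?w i = (\<Sum>j<n. (if i \<noteq> j then of_bool ({i, j} \<in> E) else 0) - (if i \<noteq> j then p i j else 0))"
      by (intro sum.cong refl) (simp add: W_def)
    hence "?w i = degree E i - (d - a / n)"
      using sum_p_row[OF that] by (simp only: sum_subtractf degree_def)
    hence eq: "degree E i - d = ?w i - a / n" by simp
    have a: "0 \<le> a / n" "a / n \<le> 1" using an b ba n by auto
    have "(?w i - a / n)\<^sup>2 \<le> 2 * (?w i)\<^sup>2 + 2 * (a / n)\<^sup>2"
      using zero_le_power2[of "?w i + a / n"] unfolding power2_sum power2_diff by linarith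
    also have "(a / n)\<^sup>2 \<le> 1" using a by (simp add: power_le_one)
    finally show ?thesis unfolding eq by simp
  qed
  hence "(\<Sum>i<n. (degree E i - d)\<^sup>2) \<le> (\<Sum>i<n. 2 * (?w i)\<^sup>2 + 2)" by (intro sum_mono) auto
  also have "\<dots> = 2 * (\<Sum>i<n. (?w i)\<^sup>2) + 2 * n" by (simp add: sum.distrib sum_distrib_left)
  also have "\<dots> \<le> 2 * (K * n * d) + 2 * (n * d)"
    using assms mult_left_mono[OF assms(1), of "real n"] by simp
  finally show ?thesis by (simp add: algebra_simps)
qed

end

section \<open>Deterministic estimates for a typical graph\<close>

locale typical_graph = planted_partition +
  fixes E :: "nat set set" and q :: nat and K :: real
  assumes q: "4 ^ q \<le> d" "d \<le> 4 * 4 ^ q"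
    and li: "light_event q E" and disc: "discrepancy_event E"
    and dev: "(\<Sum>i<n. (degree E i - d)\<^sup>2) \<le> K * n * d"
    and comm: "- (\<Sum>j<n. \<Sum>i<j. \<sigma> i * \<sigma> j * W E i j) \<le> 5 * real n * 2 ^ q"
    and K: "K \<ge> 1" "d \<ge> 4 * K"
begin

definition \<tau> :: real where "\<tau> = (\<Sum>i<n. degree E i) / n"

definition D :: "nat \<Rightarrow> real" where "D i = degree E i + \<tau>"

definition B :: "nat \<Rightarrow> nat \<Rightarrow> real" where
  "B i j = (if i \<noteq> j then of_bool ({i, j} \<in> E) else 0) + \<tau> / n"

lemma d1: "d \<ge> 1" using K by linarith

lemma two_power_q: "2 ^ q \<le> sqrt d"
proof (rule real_le_rsqrt)
  have "((2::real) ^ q)\<^sup>2 = 4 ^ q" by (simp add: power2_eq_square power_mult_distrib[symmetric])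
  thus "(2 ^ q)\<^sup>2 \<le> d" using q by simp
qed

text \<open>Cauchy-Schwarz against the constant vector yields
  \<open>(\<tau> - d)\<^sup>2 \<le> K * d\<close>, and \<open>d \<ge> 4 * K\<close> makes this at
  most \<open>(d / 2)\<^sup>2\<close>.\<close>

lemma tau_bounds: "d / 2 \<le> \<tau>" "\<tau> \<le> 3 / 2 * d"
proof -
  have "(\<Sum>i<n. (degree E i - d) * 1)\<^sup>2 \<le> (\<Sum>i<n. (degree E i - d)\<^sup>2) * (\<Sum>i<n. 1\<^sup>2)"
    by (rule Cauchy_Schwarz_ineq_sum)
  also have "\<dots> \<le> (K * n * d) * n" using dev by (intro mult_mono) (auto intro!: mult_nonneg_nonneg simp: d1 K order_trans[OF zero_le_one])
  also have "(\<Sum>i<n. (degree E i - d) * 1) = n * (\<tau> - d)"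
    using n by (simp add: sum_subtractf \<tau>_def right_diff_distrib)
  finally have "(real n)\<^sup>2 * (\<tau> - d)\<^sup>2 \<le> (real n)\<^sup>2 * (K * d)"
    by (simp add: power_mult_distrib power2_eq_square mult_ac)
  hence "(\<tau> - d)\<^sup>2 \<le> K * d" using n by simp
  also have "\<dots> \<le> (d / 4) * d" using K d1 by (intro mult_right_mono) auto
  also have "\<dots> = (d / 2)\<^sup>2" by (simp add: power2_eq_square)
  finally have "\<bar>\<tau> - d\<bar> \<le> d / 2" using d1 abs_le_square_iff[of "\<tau> - d" "d / 2"] by simp
  thus "d / 2 \<le> \<tau>" "\<tau> \<le> 3 / 2 * d" by linarith+
qed

lemma tau_pos: "\<tau> > 0" using tau_bounds d1 by linarith

lemma D_ge: "D i \<ge> \<tau>" "D i > 0"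
  using degree_nonneg[of E i] tau_pos by (auto simp: D_def)

lemma B_pos: "B i j > 0" using tau_pos n by (auto simp: B_def intro!: add_nonneg_pos)

lemma B_commute: "B i j = B j i" by (simp add: B_def insert_commute)

lemma sum_B: "(\<Sum>j<n. B i j) = D i"
  using n by (simp add: B_def D_def degree_def sum.distrib)

lemma sum_D: "(\<Sum>i<n. D i) = 2 * n * \<tau>"
  using n by (simp add: D_def sum.distrib \<tau>_def)

text \<open>\<open>2 * \<tau>\<close> is the mean of the \<open>D i\<close>, and the sum of squared
  deviations is smallest around the mean.\<close>

lemma D_dev: "(\<Sum>i<n. (D i - 2 * \<tau>)\<^sup>2) \<le> K * n * d"
proof -
  have "(\<Sum>i<n. (degree E i - d)\<^sup>2) = (\<Sum>i<n. (D i - 2 * \<tau>)\<^sup>2 + 2 * (\<tau> - d) * degree E i + (d\<^sup>2 - \<tau>\<^sup>2))"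
    by (intro sum.cong refl) (simp add: D_def power2_eq_square algebra_simps)
  also have "\<dots> = (\<Sum>i<n. (D i - 2 * \<tau>)\<^sup>2) + 2 * (\<tau> - d) * (n * \<tau>) + n * (d\<^sup>2 - \<tau>\<^sup>2)"
    using n by (simp add: sum.distrib sum_distrib_left[symmetric] \<tau>_def)
  also have "\<dots> = (\<Sum>i<n. (D i - 2 * \<tau>)\<^sup>2) + n * (\<tau> - d)\<^sup>2" by (simp add: power2_eq_square algebra_simps)
  finally have "(\<Sum>i<n. (D i - 2 * \<tau>)\<^sup>2) \<le> (\<Sum>i<n. (degree E i - d)\<^sup>2)" by simp
  thus ?thesis using dev by linarith
qed

text \<open>Permits exchanging the weights \<open>D i\<close> in an inner product for the constant
  \<open>2 * \<tau>\<close>, at a relative cost of order sqrt (K / d).\<close>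

lemma D_dev_product: "(\<Sum>i<n. (D i - 2 * \<tau>) * x i)\<^sup>2 \<le> K * n * d * (\<Sum>i<n. (x i)\<^sup>2)"
  using Cauchy_Schwarz_ineq_sum[of "\<lambda>i. D i - 2 * \<tau>" x "{..<n}"]
    mult_right_mono[OF D_dev sum_nonneg[of "{..<n}" "\<lambda>i. (x i)\<^sup>2"]] by simp

lemma norm_le: "\<tau> * (\<Sum>i<n. (x i)\<^sup>2) \<le> (\<Sum>i<n. D i * (x i)\<^sup>2)"
  unfolding sum_distrib_left using D_ge by (intro sum_mono mult_right_mono) auto

lemma B_form:
  "(\<Sum>i<n. \<Sum>j<n. B i j * x i * x j) = 2 * (\<Sum>j<n. \<Sum>i<j. x i * x j * W E i j) +
     (d + \<tau>) / n * (\<Sum>i<n. x i)\<^sup>2 + \<delta> / n * (\<Sum>i<n. \<sigma> i * x i)\<^sup>2 - a / n * (\<Sum>i<n. (x i)\<^sup>2)"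
proof -
  have "(\<Sum>i<n. \<Sum>j<n. B i j * x i * x j) =
      (\<Sum>i<n. \<Sum>j<n. (if i \<noteq> j then x i * x j * of_bool ({i, j} \<in> E) else 0) + \<tau> / n * (x i * x j))"
    by (intro sum.cong refl) (simp add: B_def algebra_simps)
  also have "\<dots> = (\<Sum>i<n. \<Sum>j<n. if i \<noteq> j then x i * x j * of_bool ({i, j} \<in> E) else 0) + \<tau> / n * (\<Sum>i<n. x i)\<^sup>2"
    by (simp only: sum.distrib power2_eq_square double_sum_product)
  also have "(\<Sum>i<n. \<Sum>j<n. if i \<noteq> j then x i * x j * of_bool ({i, j} \<in> E) else 0) =
      2 * (\<Sum>j<n. \<Sum>i<j. x i * x j * of_bool ({i, j} \<in> E))"
    by (rule sum_offdiag_double) (simp add: insert_commute mult.commute)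
  also have "(\<Sum>j<n. \<Sum>i<j. x i * x j * of_bool ({i, j} \<in> E)) =
      (\<Sum>j<n. \<Sum>i<j. x i * x j * W E i j) + (\<Sum>j<n. \<Sum>i<j. x i * x j * p i j)"
    unfolding sum.distrib[symmetric] by (intro sum.cong refl) (simp add: W_def algebra_simps)
  finally show ?thesis using p_form[of x] by (simp add: add_divide_distrib distrib_right)
qed

text \<open>Since \<open>\<tau>\<close> is at least d / 2, the weight \<open>d + degree E i\<close>
  is at most \<open>2 * D i\<close>. Here the degree-weighted estimate meets the norm that belongs
  to the Laplacian; 7640 = 4 * 1910.\<close>

lemma W_form_le:
  "2 * (\<Sum>j<n. \<Sum>i<j. x i * x j * W E i j) \<le> 7640 / sqrt d * (\<Sum>i<n. D i * (x i)\<^sup>2)"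
proof -
  have "(\<Sum>i<n. degree E i) = n * \<tau>" using n by (simp add: \<tau>_def)
  also have "\<dots> \<le> n * (2 * d)" using tau_bounds(2) d1 by (intro mult_left_mono) auto
  finally have "(\<Sum>i<n. degree E i) \<le> 2 * real n * d" by simp
  from form_bound[OF q(2) li disc this, of x]
  have "2 * (\<Sum>j<n. \<Sum>i<j. x i * x j * W E i j) \<le> 3820 * 2 ^ q * (\<Sum>i<n. (1 + degree E i / d) * (x i)\<^sup>2)"
    by simp
  also have "\<dots> \<le> 3820 * sqrt d * (\<Sum>i<n. (2 / d) * (D i * (x i)\<^sup>2))"
  proof (rule mult_mono)
    show "(\<Sum>i<n. (1 + degree E i / d) * (x i)\<^sup>2) \<le> (\<Sum>i<n. (2 / d) * (D i * (x i)\<^sup>2))"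
    proof (rule sum_mono)
      fix i
      have "d + degree E i \<le> 2 * D i"
        using tau_bounds(1) degree_nonneg[of E i] by (simp add: D_def)
      hence "(d + degree E i) / d \<le> 2 * D i / d" using d1 by (intro divide_right_mono) auto
      hence "1 + degree E i / d \<le> (2 / d) * D i" using d1 by (simp add: add_divide_distrib)
      thus "(1 + degree E i / d) * (x i)\<^sup>2 \<le> (2 / d) * (D i * (x i)\<^sup>2)"
        unfolding mult.assoc[symmetric] by (intro mult_right_mono) auto
    qed
    show "0 \<le> (\<Sum>i<n. (1 + degree E i / d) * (x i)\<^sup>2)"
      using degree_nonneg d1 by (intro sum_nonneg mult_nonneg_nonneg add_nonneg_nonneg divide_nonneg_nonneg) auto
  qed (use two_power_q d1 in auto)
  also have "\<dots> = 7640 * (sqrt d / d) * (\<Sum>i<n. D i * (x i)\<^sup>2)"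
    by (simp only: sum_distrib_left[symmetric]) simp
  also have "sqrt d / d = 1 / sqrt d" using d1 by (simp add: field_simps)
  finally show ?thesis by simp
qed

text \<open>A vector that is D-orthogonal to the constants has a small ordinary sum, because D is
  close to a multiple of the identity. The all-ones part of the expectation then contributes only at
  order K / d, and the community part is what remains.\<close>

lemma B_form_le:
  assumes "(\<Sum>i<n. D i * x i) = 0"
  shows "(\<Sum>i<n. \<Sum>j<n. B i j * x i * x j) \<le>
    (7640 / sqrt d + 5 * K / d) * (\<Sum>i<n. D i * (x i)\<^sup>2) + \<delta> / n * (\<Sum>i<n. \<sigma> i * x i)\<^sup>2"
proof -
  let ?N = "\<Sum>i<n. D i * (x i)\<^sup>2" and ?X = "\<Sum>i<n. (x i)\<^sup>2"
  have X0: "?X \<ge> 0" by (intro sum_nonneg) auto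
  have XN: "?X \<le> ?N / \<tau>" using norm_le[of x] tau_pos by (simp add: field_simps)
  have N0: "?N \<ge> 0" using D_ge by (intro sum_nonneg mult_nonneg_nonneg) (auto intro: less_imp_le)
  have "(\<Sum>i<n. (D i - 2 * \<tau>) * x i) = - (2 * \<tau> * (\<Sum>i<n. x i))"
    using assms by (simp add: left_diff_distrib sum_subtractf sum_distrib_left)
  hence "(2 * \<tau> * (\<Sum>i<n. x i))\<^sup>2 \<le> K * n * d * ?X" using D_dev_product[of x] by simp
  hence "(\<Sum>i<n. x i)\<^sup>2 \<le> K * n * d * ?X / (4 * \<tau>\<^sup>2)"
    using tau_pos by (simp add: field_simps power_mult_distrib)
  hence "(d + \<tau>) / n * (\<Sum>i<n. x i)\<^sup>2 \<le> (d + \<tau>) / n * (K * n * d * ?X / (4 * \<tau>\<^sup>2))"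
    using tau_pos d1 n by (intro mult_left_mono) auto
  also have "\<dots> = K * (((d + \<tau>) / (2 * \<tau>)) * (d / (2 * \<tau>)) * ?X)" using n by (simp add: power2_eq_square mult_ac)
  also have "\<dots> \<le> K * ((3 / 2) * 1 * (?N / \<tau>))"
  proof (intro mult_left_mono mult_mono XN)
    show "(d + \<tau>) / (2 * \<tau>) \<le> 3 / 2" "d / (2 * \<tau>) \<le> 1" using tau_bounds tau_pos by (auto simp: field_simps)
  qed (use tau_pos d1 K X0 in auto)
  also have "\<dots> \<le> K * ((3 / 2) * 1 * (?N / (d / 2)))"
    using tau_bounds d1 K N0 by (intro mult_left_mono divide_left_mono) auto
  also have "\<dots> = 3 * K / d * ?N" by simp
  also have "\<dots> \<le> 5 * K / d * ?N" using N0 K d1 by (intro mult_right_mono divide_right_mono) auto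
  finally have "(d + \<tau>) / n * (\<Sum>i<n. x i)\<^sup>2 \<le> 5 * K / d * ?N" .
  moreover have "0 \<le> a / n * ?X" using X0 b ba by simp
  ultimately show ?thesis unfolding B_form[of x] distrib_right using W_form_le[of x] by linarith
qed

end

text \<open>A two-dimensional space contains a nonzero vector orthogonal to \<open>u 0\<close>, and
  on such vectors the form is at most \<open>l 1\<close> times the squared norm.\<close>

lemma second_eigenvalue_ge:
  fixes M :: "nat \<Rightarrow> nat \<Rightarrow> real"
  assumes on: "orthonormal_system n n u" and n: "n \<ge> 2"
    and ev: "\<And>a i. a < n \<Longrightarrow> i < n \<Longrightarrow> (\<Sum>j<n. M i j * u a j) = l a * u a i"
    and dec: "\<And>a b. a \<le> b \<Longrightarrow> b < n \<Longrightarrow> l b \<le> l a"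
    and span: "\<And>\<alpha> \<beta>. \<alpha> \<noteq> 0 \<or> \<beta> \<noteq> 0 \<Longrightarrow>
      0 < (\<Sum>i<n. (\<alpha> * y1 i + \<beta> * y2 i)\<^sup>2) \<and>
      c * (\<Sum>i<n. (\<alpha> * y1 i + \<beta> * y2 i)\<^sup>2) \<le>
        (\<Sum>i<n. \<Sum>j<n. M i j * (\<alpha> * y1 i + \<beta> * y2 i) * (\<alpha> * y1 j + \<beta> * y2 j))"
  shows "c \<le> l 1"
proof -
  define g1 where "g1 = (\<Sum>i<n. u 0 i * y1 i)"
  define g2 where "g2 = (\<Sum>i<n. u 0 i * y2 i)"
  \<comment> \<open>\<open>g2 * y1 - g1 * y2\<close> is orthogonal to \<open>u 0\<close>; if both
    inner products vanish, its coefficients would be zero, and \<open>y1\<close> is taken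
    instead.\<close>
  define \<alpha> where "\<alpha> = (if g1 = 0 \<and> g2 = 0 then 1 else g2)"
  define \<beta> where "\<beta> = (if g1 = 0 \<and> g2 = 0 then 0 else - g1)"
  define y where "y = (\<lambda>i. \<alpha> * y1 i + \<beta> * y2 i)"
  define w where "w = (\<lambda>a. \<Sum>i<n. u a i * y i)"
  have "\<alpha> \<noteq> 0 \<or> \<beta> \<noteq> 0" by (auto simp: \<alpha>_def \<beta>_def)
  hence sp: "0 < (\<Sum>i<n. (y i)\<^sup>2)" "c * (\<Sum>i<n. (y i)\<^sup>2) \<le> (\<Sum>i<n. \<Sum>j<n. M i j * y i * y j)"
    unfolding y_def using span by blast+
  have "w 0 = \<alpha> * g1 + \<beta> * g2"
    unfolding w_def y_def g1_def g2_def sum_distrib_left sum.distrib[symmetric]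
    by (intro sum.cong refl) (simp add: algebra_simps)
  hence w0: "w 0 = 0" by (auto simp: \<alpha>_def \<beta>_def)
  have expand: "y j = (\<Sum>a<n. w a * u a j)" if "j < n" for j
  proof -
    have "(\<Sum>a<n. w a * u a j) = (\<Sum>i<n. \<Sum>a<n. y i * (u a i * u a j))"
      unfolding w_def sum_distrib_right by (subst sum.swap) (intro sum.cong refl, simp add: mult_ac)
    also have "\<dots> = (\<Sum>i<n. y i * (if i = j then 1 else 0))"
      unfolding sum_distrib_left[symmetric] using orthonormal_complete[OF on refl _ that] by (intro sum.cong refl) simp
    also have "\<dots> = (\<Sum>i<n. if i = j then y i else 0)" by (intro sum.cong refl) simp
    finally show ?thesis using that by simp
  qed
  have form: "(\<Sum>i<n. y i * (\<Sum>a<n. f a * u a i)) = (\<Sum>a<n. f a * w a)" for f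
    unfolding w_def sum_distrib_left by (subst sum.swap) (intro sum.cong refl, simp add: mult_ac)
  have nrm: "(\<Sum>i<n. (y i)\<^sup>2) = (\<Sum>a<n. w a * w a)"
  proof -
    have "(\<Sum>i<n. (y i)\<^sup>2) = (\<Sum>i<n. y i * (\<Sum>a<n. w a * u a i))"
      using expand by (intro sum.cong refl) (simp add: power2_eq_square)
    thus ?thesis by (simp only: form)
  qed
  have "(\<Sum>j<n. M i j * y j) = (\<Sum>a<n. (w a * l a) * u a i)" if i: "i < n" for i
  proof -
    have "(\<Sum>j<n. M i j * y j) = (\<Sum>j<n. \<Sum>a<n. w a * (M i j * u a j))"
      using expand by (intro sum.cong refl) (simp add: sum_distrib_left mult_ac)
    also have "\<dots> = (\<Sum>a<n. w a * (\<Sum>j<n. M i j * u a j))"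
      unfolding sum_distrib_left by (rule sum.swap)
    also have "\<dots> = (\<Sum>a<n. (w a * l a) * u a i)" using ev i by (intro sum.cong refl) simp
    finally show ?thesis .
  qed
  moreover have "(\<Sum>i<n. \<Sum>j<n. M i j * y i * y j) = (\<Sum>i<n. y i * (\<Sum>j<n. M i j * y j))"
    unfolding sum_distrib_left by (intro sum.cong refl) (simp add: mult_ac)
  ultimately have "(\<Sum>i<n. \<Sum>j<n. M i j * y i * y j) = (\<Sum>i<n. y i * (\<Sum>a<n. (w a * l a) * u a i))" by simp
  also have "\<dots> = (\<Sum>a<n. (w a * l a) * w a)" by (rule form)
  also have "\<dots> \<le> (\<Sum>a<n. l 1 * (w a * w a))"
  proof (rule sum_mono)
    fix a assume a: "a \<in> {..<n}"
    show "w a * l a * w a \<le> l 1 * (w a * w a)"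
    proof (cases "a = 0")
      case False
      hence "l a * (w a * w a) \<le> l 1 * (w a * w a)" using dec[of 1 a] a by (intro mult_right_mono) auto
      thus ?thesis by (simp add: mult_ac)
    qed (simp add: w0)
  qed
  also have "\<dots> = l 1 * (\<Sum>i<n. (y i)\<^sup>2)" unfolding nrm by (simp only: sum_distrib_left)
  finally have "c * (\<Sum>i<n. (y i)\<^sup>2) \<le> l 1 * (\<Sum>i<n. (y i)\<^sup>2)" using sp(2) by linarith
  thus ?thesis using sp(1) by simp
qed

section \<open>The first two eigenvalues\<close>

context typical_graph
begin

lemma sum_B_row: "(\<Sum>i<n. \<Sum>j<n. B i j * f i) = (\<Sum>i<n. D i * f i)"
  by (simp only: sum_distrib_right[symmetric] sum_B)

lemma sum_B_col: "(\<Sum>i<n. \<Sum>j<n. B i j * f j) = (\<Sum>i<n. D i * f i)"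
proof -
  have "(\<Sum>i<n. \<Sum>j<n. B i j * f j) = (\<Sum>j<n. \<Sum>i<n. B j i * f j)"
    by (subst sum.swap) (simp only: B_commute)
  thus ?thesis by (simp only: sum_B_row)
qed

text \<open>The Dirichlet form of \<open>x\<close> equals 2 (1 - l) times its squared D-norm, which
  is not positive. Regularisation makes every \<open>B i j\<close> positive, so all differences
  vanish even if the graph is disconnected.\<close>

lemma top_eigenvector_constant:
  assumes ev: "\<And>i. i < n \<Longrightarrow> (\<Sum>j<n. B i j * x j) = l * (D i * x i)" and l: "l \<ge> 1"
    and ij: "i < n" "j < n"
  shows "x i = x j"
proof -
  have "(\<Sum>i<n. \<Sum>j<n. B i j * (x i - x j)\<^sup>2) =
      (\<Sum>i<n. \<Sum>j<n. B i j * (x i)\<^sup>2) + (\<Sum>i<n. \<Sum>j<n. B i j * (x j)\<^sup>2) - 2 * (\<Sum>i<n. x i * (\<Sum>j<n. B i j * x j))"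
    unfolding sum_distrib_left sum.distrib[symmetric] sum_subtractf[symmetric]
    by (intro sum.cong refl) (simp add: power2_eq_square algebra_simps)
  also have "(\<Sum>i<n. x i * (\<Sum>j<n. B i j * x j)) = l * (\<Sum>i<n. D i * (x i)\<^sup>2)"
    unfolding sum_distrib_left[of l] using ev by (intro sum.cong refl) (simp add: power2_eq_square mult_ac)
  finally have eq: "(\<Sum>i<n. \<Sum>j<n. B i j * (x i - x j)\<^sup>2) = 2 * ((1 - l) * (\<Sum>i<n. D i * (x i)\<^sup>2))"
    unfolding sum_B_row sum_B_col by (simp add: algebra_simps)
  have "(\<Sum>i<n. D i * (x i)\<^sup>2) \<ge> 0" using D_ge(2) by (intro sum_nonneg mult_nonneg_nonneg) (auto intro: less_imp_le)
  hence "(1 - l) * (\<Sum>i<n. D i * (x i)\<^sup>2) \<le> 0" using l by (intro mult_nonpos_nonneg) auto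
  hence le: "(\<Sum>i<n. \<Sum>j<n. B i j * (x i - x j)\<^sup>2) \<le> 0" using eq by linarith
  have nn: "0 \<le> B i j * (x i - x j)\<^sup>2" for i j using B_pos[of i j] by simp
  have "B i j * (x i - x j)\<^sup>2 \<le> (\<Sum>j<n. B i j * (x i - x j)\<^sup>2)"
    using ij nn by (intro member_le_sum) auto
  also have "\<dots> \<le> (\<Sum>i<n. \<Sum>j<n. B i j * (x i - x j)\<^sup>2)"
    using ij nn by (intro member_le_sum[of i "{..<n}" "\<lambda>i. \<Sum>j<n. B i j * (x i - x j)\<^sup>2"]) (auto intro: sum_nonneg)
  finally have "B i j * (x i - x j)\<^sup>2 \<le> 0" using le by linarith
  thus ?thesis using B_pos[of i j] by (simp add: mult_le_0_iff)
qed

definition M :: "nat \<Rightarrow> nat \<Rightarrow> real" where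
  "M i j = B i j / (sqrt (D i) * sqrt (D j))"

lemma n2: "n \<ge> 2" using n S(2) by (cases "card S = 0") auto

lemma M_form: "(\<Sum>i<n. \<Sum>j<n. M i j * (sqrt (D i) * x i) * (sqrt (D j) * x j)) = (\<Sum>i<n. \<Sum>j<n. B i j * x i * x j)"
  using D_ge(2) by (intro sum.cong refl) (simp add: M_def order.strict_implies_not_eq less_imp_neq[symmetric])

lemma M_norm: "(\<Sum>i<n. (sqrt (D i) * x i)\<^sup>2) = (\<Sum>i<n. D i * (x i)\<^sup>2)"
  using D_ge(2) by (intro sum.cong refl) (simp add: power_mult_distrib less_imp_le)

lemma M_eigenvector:
  assumes "i < n" "(\<Sum>j<n. M i j * v j) = l * v i"
  shows "(\<Sum>j<n. B i j * (v j / sqrt (D j))) = l * (D i * (v i / sqrt (D i)))"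
proof -
  have s: "sqrt (D k) > 0" "sqrt (D k) * sqrt (D k) = D k" for k using D_ge(2)[of k] by auto
  have "(\<Sum>j<n. B i j * (v j / sqrt (D j))) = sqrt (D i) * (\<Sum>j<n. M i j * v j)"
    unfolding sum_distrib_left using s(1) by (intro sum.cong refl) (simp add: M_def order.strict_implies_not_eq less_imp_neq[symmetric])
  also have "\<dots> = sqrt (D i) * (l * v i)" by (simp only: assms(2))
  also have "\<dots> = l * ((sqrt (D i) * sqrt (D i)) * (v i / sqrt (D i)))"
  proof -
    have "r * (l * w) = l * ((r * r) * (w / r))" if "r > 0" for r w :: real using that by simp
    thus ?thesis using s(1) by blast
  qed
  finally show ?thesis by (simp only: s(2))
qed

text \<open>If \<open>l 1\<close> were at least 1, \<open>u 0\<close> and \<open>u 1\<close> would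
  both be multiples of the vector of the \<open>sqrt (D i)\<close>, against orthonormality. With
  \<open>l 1 < 1\<close> the claim follows by adding up the rows of the eigenvalue equation, for
  every eigenvector and also for a multiple eigenvalue.\<close>

lemma second_eigenvector_orthogonal:
  assumes on: "orthonormal_system n n u"
    and ev: "\<And>a i. a < n \<Longrightarrow> i < n \<Longrightarrow> (\<Sum>j<n. M i j * u a j) = l a * u a i"
    and dec: "\<And>a b. a \<le> b \<Longrightarrow> b < n \<Longrightarrow> l b \<le> l a"
    and x: "\<And>i. i < n \<Longrightarrow> (\<Sum>j<n. B i j * x j) = l 1 * (D i * x i)"
  shows "(\<Sum>i<n. D i * x i) = 0"
proof -
  have "l 1 < 1"
  proof (rule ccontr)
    assume "\<not> l 1 < 1"
    hence l: "l 1 \<ge> 1" "l 0 \<ge> 1" using dec[of 0 1] n2 by auto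
    have const: "u a i = u a 0 / sqrt (D 0) * sqrt (D i)" if a: "a < 2" and i: "i < n" for a i
    proof -
      have "l a \<ge> 1" using l a by (auto simp: less_2_cases_iff)
      hence "u a i / sqrt (D i) = u a 0 / sqrt (D 0)"
        using a i n2 by (intro top_eigenvector_constant[of "\<lambda>i. u a i / sqrt (D i)" "l a"] M_eigenvector ev) auto
      thus ?thesis using D_ge(2)[of i] by (simp add: field_simps)
    qed
    define k where "k = (\<lambda>a. u a 0 / sqrt (D 0))"
    have gram: "(\<Sum>i<n. u a i * u b i) = k a * k b * (\<Sum>i<n. D i)" if "a < 2" "b < 2" for a b
      unfolding sum_distrib_left
    proof (intro sum.cong refl)
      fix i assume "i \<in> {..<n}"
      hence i: "i < n" by simp
      have "u a i * u b i = (k a * sqrt (D i)) * (k b * sqrt (D i))"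
        using const[OF that(1) i] const[OF that(2) i] by (simp only: k_def)
      also have "\<dots> = k a * k b * (sqrt (D i) * sqrt (D i))" by (simp only: mult_ac)
      also have "sqrt (D i) * sqrt (D i) = D i" using D_ge(2)[of i] by simp
      finally show "u a i * u b i = k a * k b * D i" .
    qed
    have gram_id: "(\<Sum>i<n. u a i * u b i) = (if a = b then 1 else 0)" if "a < 2" "b < 2" for a b
      using on n2 that by (auto simp: orthonormal_system_def)
    have "k 0 * k 1 * (\<Sum>i<n. D i) = 0" "k 0 * k 0 * (\<Sum>i<n. D i) = 1" "k 1 * k 1 * (\<Sum>i<n. D i) = 1"
      using gram[of 0 1] gram[of 0 0] gram[of 1 1] gram_id[of 0 1] gram_id[of 0 0] gram_id[of 1 1] by simp_all
    thus False by auto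
  qed
  have "l 1 * (\<Sum>i<n. D i * x i) = (\<Sum>i<n. \<Sum>j<n. B i j * x j)"
    unfolding sum_distrib_left using x by (intro sum.cong refl) simp
  also have "\<dots> = (\<Sum>i<n. D i * x i)" by (rule sum_B_col)
  finally have "(1 - l 1) * (\<Sum>i<n. D i * x i) = 0" by (simp add: left_diff_distrib)
  thus ?thesis using \<open>l 1 < 1\<close> by simp
qed

lemma delta_bounds: "0 < \<delta>" "\<delta> \<le> d" "\<delta> \<le> 2 * \<tau>"
  using b ba tau_bounds by (auto simp: \<delta>_def d_def)

lemma inverse_sqrt_d: "1 / sqrt d * d = sqrt d"
  using d1 by (simp add: real_div_sqrt)

text \<open>The summand \<open>\<delta> / (2 * \<tau>)\<close> is the second eigenvalue of the expected Laplacian, up to lower order terms.\<close>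

definition gap :: real where "gap = \<delta> / (2 * \<tau>) - (10 / sqrt d + K / d + 2 / d)"

text \<open>The community vector is shifted by \<open>c\<close> to be D-orthogonal to the constants.
  As the row sums of B are the \<open>D i\<close>, both quadratic forms are then diagonal on the
  test space, and the constants have quotient 1. In \<open>gap\<close> the noise costs 10 / sqrt d,
  the shift K / d and the diagonal correction 2 / d.\<close>

lemma second_eigenvalue_ge_gap:
  assumes on: "orthonormal_system n n u"
    and ev: "\<And>a i. a < n \<Longrightarrow> i < n \<Longrightarrow> (\<Sum>j<n. M i j * u a j) = l a * u a i"
    and dec: "\<And>a b. a \<le> b \<Longrightarrow> b < n \<Longrightarrow> l b \<le> l a"
    and gap: "gap \<ge> 0"
  shows "gap \<le> l 1"
proof -
  define T where "T = 2 * n * \<tau>"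
  have T0: "T > 0" using tau_pos n by (simp add: T_def)
  have T: "(\<Sum>i<n. D i) = T" by (simp add: T_def sum_D)
  have Tnd: "T \<ge> n * d" using tau_bounds(1) mult_left_mono[of "d/2" \<tau> "2 * real n"] by (simp add: T_def)
  define c where "c = (\<Sum>i<n. D i * \<sigma> i) / T"
  define s where "s = (\<lambda>i. \<sigma> i - c)"
  have cT: "(\<Sum>i<n. D i * \<sigma> i) = c * T" using T0 by (simp add: c_def)
  have Ds: "(\<Sum>i<n. D i * s i) = 0"
    by (simp only: s_def right_diff_distrib sum_subtractf cT sum_distrib_right[symmetric] T) simp
  have Ds2: "(\<Sum>i<n. D i * (s i)\<^sup>2) = T * (1 - c\<^sup>2)"
  proof -
    have "(\<Sum>i<n. D i * (s i)\<^sup>2) = (\<Sum>i<n. D i + c\<^sup>2 * D i - 2 * c * (D i * \<sigma> i))"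
    proof (intro sum.cong refl)
      fix i
      have "(s i)\<^sup>2 = 1 + c\<^sup>2 - 2 * c * \<sigma> i" by (simp add: s_def power2_diff)
      thus "D i * (s i)\<^sup>2 = D i + c\<^sup>2 * D i - 2 * c * (D i * \<sigma> i)"
        by (simp only: distrib_left right_diff_distrib mult_1_right mult_ac)
    qed
    also have "\<dots> = T + c\<^sup>2 * T - 2 * c * (c * T)"
      by (simp only: sum.distrib sum_subtractf sum_distrib_left[symmetric] T cT)
    finally show ?thesis by (simp add: power2_eq_square algebra_simps)
  qed
  have c2: "c\<^sup>2 \<le> K / d"
  proof -
    have "(\<Sum>i<n. (D i - 2 * \<tau>) * \<sigma> i) = c * T"
      using sum_sigma by (simp add: left_diff_distrib sum_subtractf cT sum_distrib_left[symmetric])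
    hence "(c * T)\<^sup>2 \<le> K * n * d * n" using D_dev_product[of \<sigma>] by simp
    also have "\<dots> = K / d * (n * d)\<^sup>2" using d1 by (simp add: power2_eq_square)
    also have "\<dots> \<le> K / d * T\<^sup>2" using Tnd K d1 by (intro mult_left_mono power_mono) auto
    finally have "c\<^sup>2 * T\<^sup>2 \<le> K / d * T\<^sup>2" by (simp only: power_mult_distrib)
    thus ?thesis by (rule mult_right_le_imp_le) (use T0 in simp)
  qed
  have c1: "c\<^sup>2 < 1"
  proof -
    have "K / d \<le> 1 / 4" using K d1 by (simp add: divide_le_eq)
    thus ?thesis using c2 by linarith
  qed
  have Bs: "(\<Sum>i<n. \<Sum>j<n. B i j * s i * s j) = (\<Sum>i<n. \<Sum>j<n. B i j * \<sigma> i * \<sigma> j) - c\<^sup>2 * T"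
  proof -
    have "(\<Sum>i<n. \<Sum>j<n. B i j * s i * s j) =
        (\<Sum>i<n. \<Sum>j<n. B i j * \<sigma> i * \<sigma> j) - c * (\<Sum>i<n. \<Sum>j<n. B i j * \<sigma> i) - c * (\<Sum>i<n. \<Sum>j<n. B i j * \<sigma> j)
        + c\<^sup>2 * (\<Sum>i<n. \<Sum>j<n. B i j)"
      unfolding sum_distrib_left sum.distrib[symmetric] sum_subtractf[symmetric]
      by (intro sum.cong refl) (simp add: s_def power2_eq_square algebra_simps)
    also have "\<dots> = (\<Sum>i<n. \<Sum>j<n. B i j * \<sigma> i * \<sigma> j) - c * (c * T) - c * (c * T) + c\<^sup>2 * T"
      by (simp only: sum_B_row sum_B_col cT sum_B T)
    finally show ?thesis by (simp add: power2_eq_square)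
  qed
  have "(\<Sum>i<n. \<Sum>j<n. B i j * \<sigma> i * \<sigma> j) \<ge> \<delta> * n - a - 10 * real n * 2 ^ q"
    using comm sum_sigma n unfolding B_form[of \<sigma>] by (simp add: power2_eq_square)
  moreover have "10 * real n * 2 ^ q \<le> 10 / sqrt d * T"
  proof -
    have "10 * real n * 2 ^ q \<le> 10 * real n * sqrt d" using two_power_q by (intro mult_left_mono) auto
    also have "\<dots> = 10 * real n * (1 / sqrt d * d)" by (simp only: inverse_sqrt_d)
    also have "\<dots> = 10 / sqrt d * (n * d)" by simp
    also have "\<dots> \<le> 10 / sqrt d * T" using Tnd d1 by (intro mult_left_mono) auto
    finally show ?thesis .
  qed
  moreover have "a \<le> 2 / d * T"
  proof -
    have "a \<le> 2 / d * (n * d)" using an d1 by simp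
    also have "\<dots> \<le> 2 / d * T" using Tnd d1 by (intro mult_left_mono) auto
    finally show ?thesis .
  qed
  moreover have "c\<^sup>2 * T \<le> K / d * T" using c2 T0 by (intro mult_right_mono) auto
  moreover have "\<delta> / (2 * \<tau>) * T = \<delta> * n" using tau_pos by (simp add: T_def)
  ultimately have "gap * T \<le> (\<Sum>i<n. \<Sum>j<n. B i j * s i * s j)"
    unfolding Bs gap_def left_diff_distrib distrib_right by linarith
  moreover have "gap * (T * (1 - c\<^sup>2)) \<le> gap * T"
    using gap T0 by (intro mult_left_mono) (auto simp: mult_le_cancel_left2)
  ultimately have Bs_ge: "gap * (T * (1 - c\<^sup>2)) \<le> (\<Sum>i<n. \<Sum>j<n. B i j * s i * s j)" by linarith
  have gap1: "gap \<le> 1"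
  proof -
    have "\<delta> / (2 * \<tau>) \<le> 1" using delta_bounds tau_pos by simp
    moreover have "0 \<le> 10 / sqrt d + K / d + 2 / d" using d1 K by simp
    ultimately show ?thesis by (simp add: gap_def)
  qed
  show ?thesis
  proof (rule second_eigenvalue_ge[OF on n2 ev dec,
        where ?y1.0 = "\<lambda>i. sqrt (D i)" and ?y2.0 = "\<lambda>i. sqrt (D i) * s i"])
    fix \<alpha> \<beta> :: real
    assume ab: "\<alpha> \<noteq> 0 \<or> \<beta> \<noteq> 0"
    define x where "x = (\<lambda>i. \<alpha> + \<beta> * s i)"
    have y: "\<alpha> * sqrt (D i) + \<beta> * (sqrt (D i) * s i) = sqrt (D i) * x i" for i
      by (simp add: x_def algebra_simps)
    have N: "(\<Sum>i<n. D i * (x i)\<^sup>2) = \<alpha>\<^sup>2 * T + \<beta>\<^sup>2 * (T * (1 - c\<^sup>2))"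
    proof -
      have "(\<Sum>i<n. D i * (x i)\<^sup>2) = \<alpha>\<^sup>2 * (\<Sum>i<n. D i) + 2 * \<alpha> * \<beta> * (\<Sum>i<n. D i * s i) + \<beta>\<^sup>2 * (\<Sum>i<n. D i * (s i)\<^sup>2)"
        unfolding sum_distrib_left sum.distrib[symmetric]
        by (intro sum.cong refl) (simp add: x_def power2_eq_square algebra_simps)
      thus ?thesis by (simp add: Ds Ds2 T)
    qed
    have Q: "(\<Sum>i<n. \<Sum>j<n. B i j * x i * x j) = \<alpha>\<^sup>2 * T + \<beta>\<^sup>2 * (\<Sum>i<n. \<Sum>j<n. B i j * s i * s j)"
    proof -
      have "(\<Sum>i<n. \<Sum>j<n. B i j * x i * x j) = \<alpha>\<^sup>2 * (\<Sum>i<n. \<Sum>j<n. B i j) + \<alpha> * \<beta> * (\<Sum>i<n. \<Sum>j<n. B i j * s i)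
          + \<alpha> * \<beta> * (\<Sum>i<n. \<Sum>j<n. B i j * s j) + \<beta>\<^sup>2 * (\<Sum>i<n. \<Sum>j<n. B i j * s i * s j)"
        unfolding sum_distrib_left sum.distrib[symmetric]
        by (intro sum.cong refl) (simp add: x_def power2_eq_square algebra_simps)
      also have "\<dots> = \<alpha>\<^sup>2 * T + \<beta>\<^sup>2 * (\<Sum>i<n. \<Sum>j<n. B i j * s i * s j)"
        by (simp only: sum_B_row sum_B_col Ds sum_B T mult_zero_right add_0_right)
      finally show ?thesis .
    qed
    have "\<alpha>\<^sup>2 * T + \<beta>\<^sup>2 * (T * (1 - c\<^sup>2)) > 0"
    proof (cases "\<alpha> = 0")
      case True
      hence "\<beta>\<^sup>2 * (T * (1 - c\<^sup>2)) > 0" using ab T0 c1 by (intro mult_pos_pos) auto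
      thus ?thesis using True by simp
    next
      case False
      hence "\<alpha>\<^sup>2 * T > 0" using T0 by simp
      moreover have "\<beta>\<^sup>2 * (T * (1 - c\<^sup>2)) \<ge> 0" using T0 c1 by (intro mult_nonneg_nonneg) auto
      ultimately show ?thesis by linarith
    qed
    moreover have "gap * (\<alpha>\<^sup>2 * T + \<beta>\<^sup>2 * (T * (1 - c\<^sup>2))) \<le>
        \<alpha>\<^sup>2 * T + \<beta>\<^sup>2 * (\<Sum>i<n. \<Sum>j<n. B i j * s i * s j)"
    proof -
      have "gap * (\<alpha>\<^sup>2 * T) \<le> 1 * (\<alpha>\<^sup>2 * T)" using gap1 T0 by (intro mult_right_mono) auto
      moreover have "\<beta>\<^sup>2 * (gap * (T * (1 - c\<^sup>2))) \<le> \<beta>\<^sup>2 * (\<Sum>i<n. \<Sum>j<n. B i j * s i * s j)"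
        using Bs_ge by (intro mult_left_mono) auto
      ultimately show ?thesis by (simp add: distrib_left mult_ac)
    qed
    ultimately show "0 < (\<Sum>i<n. (\<alpha> * sqrt (D i) + \<beta> * (sqrt (D i) * s i))\<^sup>2) \<and>
       gap * (\<Sum>i<n. (\<alpha> * sqrt (D i) + \<beta> * (sqrt (D i) * s i))\<^sup>2)
       \<le> (\<Sum>i<n. \<Sum>j<n. M i j * (\<alpha> * sqrt (D i) + \<beta> * (sqrt (D i) * s i)) * (\<alpha> * sqrt (D j) + \<beta> * (sqrt (D j) * s j)))"
      unfolding y M_norm M_form N Q by blast
  qed
qed

text \<open>With \<open>T\<close> and \<open>N\<close> the squared D-norms of the community vector
  and of \<open>x\<close>, \<open>t\<^sup>2 / (T * N)\<close> is the squared cosine of their angle,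
  shown to be at least \<open>1 - 2 * \<eta>\<close>. A vertex of wrong sign adds at least
  \<open>\<tau> * w\<^sup>2\<close> to the squared distance of \<open>x\<close> from the line of the
  community vector, and that distance is at most \<open>2 * \<eta> * N\<close>.\<close>

lemma sign_errors_bound:
  fixes \<eta> :: real
  assumes \<eta>: "0 < \<eta>" "\<eta> \<le> 1 / 4" and d\<eta>: "4 * K \<le> d * \<eta>\<^sup>2"
    and \<delta>\<eta>: "6 * (7652 + 6 * K) * sqrt d \<le> \<delta> * \<eta>"
    and x0: "\<exists>i<n. x i \<noteq> 0" and orth: "(\<Sum>i<n. D i * x i) = 0"
    and form: "(\<Sum>i<n. \<Sum>j<n. B i j * x i * x j) = l * (\<Sum>i<n. D i * (x i)\<^sup>2)"
    and l: "gap \<ge> 0 \<Longrightarrow> gap \<le> l"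
  shows "\<exists>s. (s = 1 \<or> s = -1) \<and> real (card {i. i < n \<and> sgn (x i) \<noteq> s * \<sigma> i}) \<le> 8 * \<eta> * n"
proof -
  define N where "N = (\<Sum>i<n. D i * (x i)\<^sup>2)"
  define T where "T = 2 * n * \<tau>"
  define z where "z = (\<Sum>i<n. \<sigma> i * x i)"
  \<comment> \<open>Both losses together: \<open>7640 / sqrt d + 5 * K / d\<close> from the upper
    bound on the form and \<open>10 / sqrt d + K / d + 2 / d\<close> from
    \<open>gap\<close>.\<close>
  define e where "e = 7650 / sqrt d + (6 * K + 2) / d"
  have T0: "T > 0" using tau_pos n by (simp add: T_def)
  have T: "(\<Sum>i<n. D i) = T" by (simp add: T_def sum_D)
  have sd: "sqrt d > 0" "sqrt d \<le> d" using d1 by (auto intro: real_le_lsqrt simp: power2_eq_square)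
  have nonneg: "0 \<le> D i * y\<^sup>2" for i and y :: real using D_ge(2)[of i] by simp
  have N0: "N > 0"
  proof -
    obtain i where i: "i < n" "x i \<noteq> 0" using x0 by blast
    have "0 < D i * (x i)\<^sup>2" using i D_ge(2)[of i] by simp
    also have "\<dots> \<le> N" unfolding N_def using i(1) by (intro member_le_sum) (auto simp: nonneg)
    finally show ?thesis .
  qed
  have e_le: "e \<le> (7652 + 6 * K) / sqrt d"
  proof -
    have "(6 * K + 2) / d \<le> (6 * K + 2) / sqrt d" using sd K d1 by (intro divide_left_mono) auto
    thus ?thesis by (simp add: e_def add_divide_distrib)
  qed
  have te: "2 * \<tau> * e \<le> \<delta> * \<eta> / 2"
  proof -
    have "2 * \<tau> * e \<le> 3 * d * ((7652 + 6 * K) / sqrt d)"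
      using tau_bounds tau_pos e_le d1 K by (intro mult_mono[of "2 * \<tau>" "3 * d"]) (auto simp: e_def)
    also have "\<dots> = 3 * (7652 + 6 * K) * (1 / sqrt d * d)" by simp
    also have "\<dots> = 3 * (7652 + 6 * K) * sqrt d" by (simp only: inverse_sqrt_d)
    finally show ?thesis using \<delta>\<eta> by linarith
  qed
  have gap_e: "gap = \<delta> / (2 * \<tau>) - (e - (7640 / sqrt d + 5 * K / d))"
    by (simp add: gap_def e_def add_divide_distrib diff_divide_distrib)
  have "\<delta> * \<eta> / 2 \<le> \<delta>" using \<eta> delta_bounds(1) by simp
  hence "2 * \<tau> * e \<le> \<delta>" using te by linarith
  hence "e \<le> \<delta> / (2 * \<tau>)" using tau_pos by (simp add: le_divide_eq mult.commute)
  moreover have "7640 / sqrt d + 5 * K / d \<ge> 0" using d1 K by simp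
  ultimately have "gap \<ge> 0" unfolding gap_e by linarith
  hence "gap * N \<le> l * N" using l N0 by (intro mult_right_mono) auto
  also have "\<dots> \<le> (7640 / sqrt d + 5 * K / d) * N + \<delta> / n * z\<^sup>2"
    using B_form_le[OF orth] form by (simp add: N_def z_def)
  finally have main: "(\<delta> / (2 * \<tau>) - e) * N \<le> \<delta> / n * z\<^sup>2"
    unfolding gap_e by (simp add: algebra_simps)
  have z2: "(2 * \<tau> * z)\<^sup>2 \<ge> T * N * (1 - \<eta> / 2)"
  proof -
    have "(2 * \<tau> * T / \<delta>) * ((\<delta> / (2 * \<tau>) - e) * N) \<le> (2 * \<tau> * T / \<delta>) * (\<delta> / n * z\<^sup>2)"
      using main tau_pos T0 delta_bounds by (intro mult_left_mono) auto
    also have "\<dots> = (2 * \<tau> * z)\<^sup>2" using delta_bounds n by (simp add: T_def power2_eq_square)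
    also have "(2 * \<tau> * T / \<delta>) * ((\<delta> / (2 * \<tau>) - e) * N) = T * N * (1 - (2 * \<tau> * e) / \<delta>)"
      using delta_bounds tau_pos by (simp add: field_simps)
    finally have "T * N * (1 - (2 * \<tau> * e) / \<delta>) \<le> (2 * \<tau> * z)\<^sup>2" .
    moreover have "(2 * \<tau> * e) / \<delta> \<le> \<eta> / 2" using te delta_bounds by (simp add: divide_le_eq mult.commute)
    hence "T * N * (1 - \<eta> / 2) \<le> T * N * (1 - (2 * \<tau> * e) / \<delta>)" using T0 N0 by (intro mult_left_mono) auto
    ultimately show ?thesis by linarith
  qed
  define \<rho> where "\<rho> = (\<Sum>i<n. (D i - 2 * \<tau>) * (\<sigma> i * x i))"
  have \<rho>2: "\<rho>\<^sup>2 \<le> 2 * K * n * N"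
  proof -
    have "(\<Sum>i<n. (\<sigma> i * x i)\<^sup>2) = (\<Sum>i<n. (x i)\<^sup>2)" by (simp add: power_mult_distrib)
    hence "\<rho>\<^sup>2 \<le> K * n * d * (\<Sum>i<n. (x i)\<^sup>2)" unfolding \<rho>_def using D_dev_product[of "\<lambda>i. \<sigma> i * x i"] by simp
    also have "\<dots> \<le> K * n * ((2 * \<tau>) * (\<Sum>i<n. (x i)\<^sup>2))"
      using tau_bounds K mult_right_mono[of d "2 * \<tau>" "\<Sum>i<n. (x i)\<^sup>2"]
      by (simp add: mult.assoc mult_left_mono sum_nonneg)
    also have "\<dots> \<le> K * n * (2 * N)" using norm_le[of x] K unfolding N_def by (intro mult_left_mono) auto
    finally show ?thesis by simp
  qed
  define t where "t = (\<Sum>i<n. D i * (\<sigma> i * x i))"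
  have t_eq: "t = 2 * \<tau> * z + \<rho>"
    unfolding t_def z_def \<rho>_def sum_distrib_left sum.distrib[symmetric]
    by (intro sum.cong refl) (simp add: algebra_simps)
  have t2: "t\<^sup>2 \<ge> T * N * (1 - 2 * \<eta>)"
  proof -
    \<comment> \<open>Young's inequality for the square of \<open>2 * \<tau> * z + \<rho>\<close>,
      obtained from a completed square.\<close>
    have "0 \<le> (\<eta> * (2 * \<tau> * z) + \<rho>)\<^sup>2 / \<eta>" using \<eta> by simp
    also have "\<dots> = t\<^sup>2 - (1 - \<eta>) * (2 * \<tau> * z)\<^sup>2 + (1 / \<eta> - 1) * \<rho>\<^sup>2"
      unfolding t_eq using \<eta> by (simp add: field_simps power2_eq_square)
    finally have "(1 - \<eta>) * (2 * \<tau> * z)\<^sup>2 - (1 / \<eta> - 1) * \<rho>\<^sup>2 \<le> t\<^sup>2" by linarith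
    moreover have "(1 - \<eta>) * (T * N * (1 - \<eta> / 2)) \<le> (1 - \<eta>) * (2 * \<tau> * z)\<^sup>2"
      using z2 \<eta> by (intro mult_left_mono) auto
    moreover have "(1 / \<eta> - 1) * \<rho>\<^sup>2 \<le> \<eta> / 2 * (T * N)"
    proof -
      have "(1 / \<eta> - 1) * \<rho>\<^sup>2 \<le> 1 / \<eta> * (2 * K * n * N)" using \<rho>2 \<eta> by (intro mult_mono) auto
      also have "\<dots> = (4 * K) * (n * N) / (2 * \<eta>)" by simp
      also have "\<dots> \<le> (d * \<eta>\<^sup>2) * (n * N) / (2 * \<eta>)"
        using d\<eta> N0 \<eta> by (intro divide_right_mono mult_right_mono) auto
      also have "\<dots> = \<eta> / 2 * (n * d * N)" using \<eta> by (simp add: power2_eq_square)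
      also have "\<dots> \<le> \<eta> / 2 * (T * N)"
      proof -
        have "n * d \<le> T" using tau_bounds(1) mult_left_mono[of "d/2" \<tau> "2 * real n"] by (simp add: T_def)
        thus ?thesis using N0 \<eta> by (intro mult_left_mono mult_right_mono) auto
      qed
      finally show ?thesis .
    qed
    moreover have "T * N * (1 - 2 * \<eta>) \<le> (1 - \<eta>) * (T * N * (1 - \<eta> / 2)) - \<eta> / 2 * (T * N)"
    proof -
      have "(1 - \<eta>) * (T * N * (1 - \<eta> / 2)) - \<eta> / 2 * (T * N) = T * N * (1 - 2 * \<eta>) + T * N * \<eta>\<^sup>2 / 2"
        by (simp add: field_simps power2_eq_square)
      thus ?thesis using T0 N0 by simp
    qed
    ultimately show ?thesis by linarith
  qed
  have "T * N * (1 / 2) \<le> T * N * (1 - 2 * \<eta>)" using \<eta> T0 N0 by (intro mult_left_mono) auto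
  hence t2': "T * N / 2 \<le> t\<^sup>2" using t2 by linarith
  hence "t \<noteq> 0" using T0 N0 by (auto simp: mult_le_0_iff)
  \<comment> \<open>The coefficient of the D-orthogonal projection of \<open>x\<close> onto the
    community vector.\<close>
  define w where "w = t / T"
  define s where "s = sgn t"
  have s: "s = 1 \<or> s = -1" using \<open>t \<noteq> 0\<close> by (auto simp: s_def sgn_if)
  let ?X = "{i. i < n \<and> sgn (x i) \<noteq> s * \<sigma> i}"
  have "\<tau> * real (card ?X) * w\<^sup>2 = (\<Sum>i\<in>?X. \<tau> * w\<^sup>2)" by simp
  also have "\<dots> \<le> (\<Sum>i\<in>?X. D i * (x i - w * \<sigma> i)\<^sup>2)"
  proof (rule sum_mono)
    fix i assume i: "i \<in> ?X"
    \<comment> \<open>This includes vertices with \<open>x i = 0\<close>, which count as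
      errors.\<close>
    have "w * (\<sigma> i * x i) \<le> 0"
    proof -
      have "s * (\<sigma> i * x i) \<le> 0"
        using i s by (cases "x i" "0::real" rule: linorder_cases) (auto simp: community_sign_def split: if_splits)
      moreover have "w = s * (\<bar>t\<bar> / T)" by (simp add: w_def s_def sgn_mult_abs)
      ultimately show ?thesis using T0 mult_nonneg_nonpos[of "\<bar>t\<bar> / T" "s * (\<sigma> i * x i)"] by (simp add: mult_ac)
    qed
    hence "w\<^sup>2 \<le> (x i)\<^sup>2 - 2 * (w * (\<sigma> i * x i)) + w\<^sup>2" using zero_le_power2[of "x i"] by linarith
    also have "\<dots> = (x i - w * \<sigma> i)\<^sup>2"
      by (simp only: power2_diff power_mult_distrib sigma_square) (simp add: mult_ac)
    finally show "\<tau> * w\<^sup>2 \<le> D i * (x i - w * \<sigma> i)\<^sup>2" using D_ge[of i] tau_pos by (intro mult_mono) auto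
  qed
  also have "\<dots> \<le> (\<Sum>i<n. D i * (x i - w * \<sigma> i)\<^sup>2)"
    by (intro sum_mono2) (auto simp: nonneg)
  also have "\<dots> = (\<Sum>i<n. D i * (x i)\<^sup>2 - 2 * w * (D i * (\<sigma> i * x i)) + w\<^sup>2 * D i)"
  proof (intro sum.cong refl)
    fix i
    have "(x i - w * \<sigma> i)\<^sup>2 = (x i)\<^sup>2 - 2 * w * (\<sigma> i * x i) + w\<^sup>2"
      by (simp only: power2_diff power_mult_distrib sigma_square) (simp add: mult_ac)
    thus "D i * (x i - w * \<sigma> i)\<^sup>2 = D i * (x i)\<^sup>2 - 2 * w * (D i * (\<sigma> i * x i)) + w\<^sup>2 * D i"
      by (simp only: distrib_left right_diff_distrib mult_ac)
  qed
  also have "\<dots> = N - 2 * w * t + w\<^sup>2 * T"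
    by (simp only: sum.distrib sum_subtractf sum_distrib_left[symmetric] N_def t_def T)
  also have "\<dots> = N - t\<^sup>2 / T" using T0 by (simp add: w_def power2_eq_square field_simps)
  also have "\<dots> \<le> 2 * \<eta> * N"
  proof -
    have "N * (1 - 2 * \<eta>) \<le> t\<^sup>2 / T" using t2 T0 by (simp add: le_divide_eq mult_ac)
    thus ?thesis by (simp add: algebra_simps)
  qed
  finally have 1: "\<tau> * real (card ?X) * w\<^sup>2 \<le> 2 * \<eta> * N" .
  have "\<tau> * real (card ?X) * (N / (2 * T)) \<le> \<tau> * real (card ?X) * w\<^sup>2"
  proof (rule mult_left_mono)
    have "N / (2 * T) = (T * N / 2) / T\<^sup>2" using T0 by (simp add: power2_eq_square)
    also have "\<dots> \<le> t\<^sup>2 / T\<^sup>2" using t2' by (intro divide_right_mono) auto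
    finally show "N / (2 * T) \<le> w\<^sup>2" by (simp add: w_def power_divide)
  qed (use tau_pos in simp)
  with 1 have "\<tau> * real (card ?X) * (N / (2 * T)) \<le> 2 * \<eta> * N" by linarith
  hence "\<tau> * real (card ?X) / (2 * T) * N \<le> 2 * \<eta> * N" by (simp only: times_divide_eq_right times_divide_eq_left)
  hence "\<tau> * real (card ?X) / (2 * T) \<le> 2 * \<eta>" using N0 by (rule mult_right_le_imp_le)
  hence "\<tau> * real (card ?X) \<le> 2 * \<eta> * (2 * T)" using T0 by (simp only: pos_divide_le_eq zero_less_mult_iff zero_less_numeral simp_thms)
  also have "\<dots> = \<tau> * (8 * \<eta> * n)" by (simp add: T_def)
  finally have "\<tau> * real (card ?X) \<le> \<tau> * (8 * \<eta> * n)" .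
  hence "real (card ?X) \<le> 8 * \<eta> * n" using tau_pos by simp
  thus ?thesis using s by blast
qed

section \<open>Transfer to the Laplacian matrix\<close>

lemma laplacian_eq:
  "laplacian (regularized_adjacency (average_degree (adjacency_mat n E)) (adjacency_mat n E)) =
     mat n n (\<lambda>(i, j). M i j)"
proof -
  let ?A = "adjacency_mat n E"
  have dim: "dim_row ?A = n" "dim_col ?A = n" by (auto simp: adjacency_mat_def)
  have "row_sum ?A i = degree E i" if "i < n" for i
    unfolding row_sum_def degree_def dim using that by (intro sum.cong refl) (auto simp: adjacency_mat_def)
  hence avg: "average_degree ?A = \<tau>" by (simp add: average_degree_def dim \<tau>_def)
  have R: "regularized_adjacency \<tau> ?A = mat n n (\<lambda>(i, j). B i j)"
    by (rule eq_matI) (auto simp: regularized_adjacency_def B_def adjacency_mat_def)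
  have rs: "row_sum (mat n n (\<lambda>(i, j). B i j)) i = D i" if "i < n" for i
    using that sum_B[of i] by (simp add: row_sum_def)
  show ?thesis
    unfolding avg R laplacian_def Let_def
    by (rule eq_matI) (auto simp: mat_diag_mult_left[of _ n n] mat_diag_mult_right[of _ n n] rs M_def)
qed

theorem misclassified_second_eigenvector:
  fixes \<eta> :: real
  assumes \<eta>: "0 < \<eta>" "\<eta> \<le> 1 / 4" and d\<eta>: "4 * K \<le> d * \<eta>\<^sup>2"
    and \<delta>\<eta>: "6 * (7652 + 6 * K) * sqrt d \<le> \<delta> * \<eta>"
  defines "L \<equiv> laplacian (regularized_adjacency (average_degree (adjacency_mat n E)) (adjacency_mat n E))"
  assumes v: "eigenvector L v (second_largest_eigenvalue L)"
  shows "real (misclassified S v) \<le> 8 * \<eta> * n"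
proof -
  have L: "L = mat n n (\<lambda>(i, j). M i j)" unfolding L_def by (rule laplacian_eq)
  have sym: "M i j = M j i" for i j by (simp add: M_def B_commute mult.commute)
  obtain u l where on: "orthonormal_system n n u"
    and ev: "\<And>a i. a < n \<Longrightarrow> i < n \<Longrightarrow> (\<Sum>j<n. M i j * u a j) = l a * u a i"
    and dec: "\<And>a b. a \<le> b \<Longrightarrow> b < n \<Longrightarrow> l b \<le> l a"
    using real_symmetric_eigenbasis[of n M, OF sym] by blast
  have "eigenvalues_desc L = map l [0..<n]"
    unfolding L by (rule eigenvalues_desc_eigenbasis[OF _ on _ dec]) (auto simp: ev)
  hence l1: "second_largest_eigenvalue L = l 1"
    using n2 by (simp add: second_largest_eigenvalue_def)
  have dv: "dim_vec v = n" and v0: "v \<noteq> 0\<^sub>v n" and Lv: "L *\<^sub>v v = l 1 \<cdot>\<^sub>v v"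
    using v unfolding eigenvector_def l1 by (auto simp: L)
  have Mv: "(\<Sum>j<n. M i j * v $ j) = l 1 * v $ i" if i: "i < n" for i
  proof -
    have "(L *\<^sub>v v) $ i = (\<Sum>j<n. M i j * v $ j)"
      using i dv by (simp add: L scalar_prod_def lessThan_atLeast0)
    thus ?thesis using i dv by (simp add: Lv)
  qed
  define x where "x = (\<lambda>i. v $ i / sqrt (D i))"
  have Bx: "(\<Sum>j<n. B i j * x j) = l 1 * (D i * x i)" if "i < n" for i
    unfolding x_def using that Mv by (intro M_eigenvector) auto
  have "\<exists>i<n. x i \<noteq> 0"
  proof -
    obtain i where "i < n" "v $ i \<noteq> 0" using v0 dv by (metis eq_vecI index_zero_vec)
    thus ?thesis using D_ge(2)[of i] by (auto simp: x_def)
  qed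
  moreover have "(\<Sum>i<n. D i * x i) = 0" by (rule second_eigenvector_orthogonal[OF on ev dec Bx])
  moreover have "(\<Sum>i<n. \<Sum>j<n. B i j * x i * x j) = l 1 * (\<Sum>i<n. D i * (x i)\<^sup>2)"
  proof -
    have "(\<Sum>i<n. \<Sum>j<n. B i j * x i * x j) = (\<Sum>i<n. x i * (\<Sum>j<n. B i j * x j))"
      unfolding sum_distrib_left by (intro sum.cong refl) (simp only: mult_ac)
    also have "\<dots> = (\<Sum>i<n. l 1 * (D i * (x i)\<^sup>2))"
      using Bx by (intro sum.cong refl) (simp add: power2_eq_square)
    finally show ?thesis by (simp only: sum_distrib_left)
  qed
  moreover have "gap \<ge> 0 \<Longrightarrow> gap \<le> l 1" by (rule second_eigenvalue_ge_gap[OF on ev dec])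
  ultimately obtain s where s: "s = 1 \<or> s = -1"
    and c: "real (card {i. i < n \<and> sgn (x i) \<noteq> s * \<sigma> i}) \<le> 8 * \<eta> * n"
    using sign_errors_bound[OF \<eta> d\<eta> \<delta>\<eta>] by blast
  \<comment> \<open>The substitution divides each entry by a positive number, so it keeps the
    signs.\<close>
  have "sgn (x i) = sgn (v $ i)" for i using D_ge(2)[of i] by (simp add: x_def sgn_divide)
  with s c show ?thesis unfolding misclassified_def dv by auto
qed

end

section \<open>Probability of a typical graph and choice of constants\<close>

lemma ex_power4_bracket:
  fixes d :: real
  assumes "d \<ge> 1"
  shows "\<exists>q::nat. 4 ^ q \<le> d \<and> d \<le> 4 * 4 ^ q"
proof -
  define q where "q = nat \<lfloor>log 4 d\<rfloor>"
  have l0: "log 4 d \<ge> 0" using assms by simp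
  have "4 powr real q \<le> 4 powr log 4 d" using l0 by (intro powr_mono) (auto simp: q_def)
  moreover have "4 powr log 4 d \<le> 4 powr real (Suc q)"
    using l0 unfolding q_def by (intro powr_mono) linarith+
  ultimately show ?thesis using assms by (intro exI[of _ q]) (simp add: powr_realpow powr_add)
qed

text \<open>Light pairs, community form and discrepancy fail with probability at most 1 / n each,
  the degrees with at most \<open>28 / \<kappa>\<close>. Recentring the degrees at d turns
  \<open>\<kappa>\<close> into \<open>2 * \<kappa> + 2\<close>.\<close>

lemma (in planted_partition) typical_graph_probability:
  fixes \<kappa> :: real
  assumes q: "4 ^ q \<le> d" "d \<le> 4 * 4 ^ q" and \<kappa>: "\<kappa> > 0" and d: "d \<ge> 4 * (2 * \<kappa> + 2)"
    and P: "\<And>E. typical_graph n S a b E q (2 * \<kappa> + 2) \<Longrightarrow> P E"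
  shows "measure_pmf.prob (sbm n S a b) {E. P E} \<ge> 1 - (3 / n + 28 / \<kappa>)"
proof -
  let ?pr = "measure_pmf.prob (sbm n S a b)"
  define B1 where "B1 = {E. \<exists>z. (\<forall>i<n. z i \<in> dyadic (7 * n)) \<and> (\<Sum>i<n. (z i)\<^sup>2) \<le> 7 * real n \<and>
        206 * real n * 2 ^ q < (\<Sum>j<n. \<Sum>i<j. light q (z i * z j) * W E i j)}"
  define B2 where "B2 = {E. 5 * real n * 2 ^ q < - (\<Sum>j<n. \<Sum>i<j. \<sigma> i * \<sigma> j * W E i j)}"
  define B3 where "B3 = {E. \<kappa> * n * d \<le> (\<Sum>i<n. (\<Sum>j<n. if i \<noteq> j then W E i j else 0)\<^sup>2)}"
  define B4 where "B4 = {E. \<exists>A B h. A \<subseteq> {..<n} \<and> A \<noteq> {} \<and> B \<subseteq> {..<n} \<and> B \<noteq> {} \<and> 1 \<le> h \<and> h \<le> 7 * n \<and>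
      (2 * d / n) * card A * card B * 2 ^ h + 3 * (entropy_bound n (card A) + entropy_bound n (card B))
      < real h * ln 2 * edges_between n E A B}"
  have d1: "d \<ge> 1" using d \<kappa> by (simp add: distrib_left)
  have en: "exp (- real n) \<le> 1 / n"
  proof -
    have "1 / exp (real n) \<le> 1 / real n"
      using n order_trans[OF _ exp_ge_add_one_self, of "real n" "real n"] by (intro divide_left_mono) auto
    thus ?thesis by (simp add: exp_minus inverse_eq_divide)
  qed
  have sub: "UNIV - (B1 \<union> B2 \<union> B3 \<union> B4) \<subseteq> {E. P E}"
  proof (intro subsetI CollectI)
    fix E assume E: "E \<in> UNIV - (B1 \<union> B2 \<union> B3 \<union> B4)"
    show "P E"
    proof (rule P, unfold_locales)
      show "4 ^ q \<le> d" "d \<le> 4 * 4 ^ q" by (fact q)+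
      show "light_event q E" using E unfolding B1_def light_event_def by (auto simp: not_less)
      show "discrepancy_event E" using E unfolding B4_def discrepancy_event_def by (auto simp: not_less)
      show "(\<Sum>i<n. (degree E i - d)\<^sup>2) \<le> (2 * \<kappa> + 2) * n * d"
        using E by (intro degree_deviation d1) (auto simp: B3_def)
      show "- (\<Sum>j<n. \<Sum>i<j. \<sigma> i * \<sigma> j * W E i j) \<le> 5 * real n * 2 ^ q" using E by (auto simp: B2_def)
      show "1 \<le> 2 * \<kappa> + 2" "4 * (2 * \<kappa> + 2) \<le> d" using \<kappa> d by auto
    qed
  qed
  have "?pr (B1 \<union> B2 \<union> B3 \<union> B4) \<le> ?pr B1 + ?pr B2 + ?pr B3 + ?pr B4"
    by (intro order_trans[OF measure_Un_le] add_mono) auto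
  also have "\<dots> \<le> 1 / n + 1 / n + 28 / \<kappa> + 1 / n"
    using light_tail[OF q(2), of "7 * n"] community_form_tail[OF q(2)] degree_deviation_tail[OF d1 \<kappa>] discrepancy_tail en
    by (intro add_mono) (auto simp: B1_def B2_def B3_def B4_def)
  finally have "?pr (B1 \<union> B2 \<union> B3 \<union> B4) \<le> 3 / n + 28 / \<kappa>" by simp
  moreover have "?pr (UNIV - (B1 \<union> B2 \<union> B3 \<union> B4)) = 1 - ?pr (B1 \<union> B2 \<union> B3 \<union> B4)"
    using measure_pmf.prob_compl[of "B1 \<union> B2 \<union> B3 \<union> B4" "sbm n S a b"] by simp
  moreover have "?pr (UNIV - (B1 \<union> B2 \<union> B3 \<union> B4)) \<le> ?pr {E. P E}"
    using sub by (intro measure_pmf.finite_measure_mono) auto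
  ultimately show ?thesis by linarith
qed

theorem corollary6p2:
  fixes \<epsilon> r :: real
  assumes "\<epsilon> > 0" and "r \<ge> 1"
  shows "\<exists>C>0. \<forall>(n::nat) (a::real) (b::real) (S::nat set).
    n > 0 \<longrightarrow> S \<subseteq> {..<n} \<longrightarrow> 2 * card S = n \<longrightarrow>
    0 \<le> b \<longrightarrow> b < a \<longrightarrow> a \<le> real n \<longrightarrow>
    (a - b)\<^sup>2 > C * (a + b) \<longrightarrow>
    measure_pmf.prob (sbm n S a b)
      {E. let A = adjacency_mat n E;
              L = laplacian (regularized_adjacency (average_degree A) A)
          in \<forall>v. eigenvector L v (second_largest_eigenvalue L) \<longrightarrow>
               real (misclassified S v) \<le> \<epsilon> * real n}
    \<ge> 1 - exp (- r)"
proof -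
  define \<eta> where "\<eta> = min (1 / 4) (\<epsilon> / 8)"
  \<comment> \<open>56 = 2 * 28: the degrees use up half of the allowed failure probability.\<close>
  define \<kappa> where "\<kappa> = 56 * exp r"
  define K where "K = 2 * \<kappa> + 2"
  define K3 where "K3 = 7652 + 6 * K"
  \<comment> \<open>In terms of \<open>\<delta>\<close> and \<open>d\<close> the hypothesis reads
    \<open>\<delta>\<^sup>2 > C / 2 * d\<close>, and \<open>C / 2\<close> is the square of
    \<open>6 * K3 / \<eta>\<close>, just what \<open>6 * K3 * sqrt d \<le> \<delta> * \<eta>\<close>
    asks for.\<close>
  define C where "C = 72 * K3\<^sup>2 / \<eta>\<^sup>2"
  have \<eta>: "0 < \<eta>" "\<eta> \<le> 1 / 4" "8 * \<eta> \<le> \<epsilon>" using assms by (auto simp: \<eta>_def)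
  have \<kappa>: "\<kappa> > 0" by (simp add: \<kappa>_def)
  have K: "K > 0" "K \<le> K3" "\<kappa> \<le> K3" "1 \<le> K3" using \<kappa> by (auto simp: K_def K3_def)
  have \<eta>1: "\<eta>\<^sup>2 \<le> 1" using \<eta> by (simp add: power_le_one)
  have K3sq: "K3 \<le> K3\<^sup>2" using K by (simp add: power2_eq_square)
  have C72: "C \<ge> 72 * K3"
  proof -
    have "72 * K3 \<le> 72 * K3\<^sup>2 / 1" using K3sq by simp
    also have "\<dots> \<le> C" unfolding C_def using \<eta> \<eta>1 by (intro divide_left_mono) auto
    finally show ?thesis .
  qed
  hence C0: "C > 0" using K by linarith
  show ?thesis
  proof (intro exI[of _ C] conjI C0 allI impI)
    fix n :: nat and a b :: real and S :: "nat set"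
    assume n: "n > 0" and S: "S \<subseteq> {..<n}" "2 * card S = n" and b: "0 \<le> b" and ba: "b < a" and an: "a \<le> real n"
      and sep: "(a - b)\<^sup>2 > C * (a + b)"
    interpret planted_partition n S a b by unfold_locales (fact n S b ba an)+
    have dC: "d \<ge> C / 2"
    proof -
      have "C * (a + b) < (a - b)\<^sup>2" by (fact sep)
      also have "\<dots> \<le> (a + b)\<^sup>2" using b ba by (intro power_mono) auto
      finally have "C * (a + b) < (a + b) * (a + b)" by (simp only: power2_eq_square)
      hence "C < a + b" using b ba by (simp only: mult_less_cancel_right_pos add_nonneg_pos)
      thus ?thesis by (simp add: d_def)
    qed
    have d36: "d \<ge> 36 * K3" using dC C72 by linarith
    hence d1: "d \<ge> 1" and dK: "d \<ge> 4 * K" using K by linarith+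
    obtain q :: nat where q: "4 ^ q \<le> d" "d \<le> 4 * 4 ^ q" using ex_power4_bracket[OF d1] by blast
    have nd: "real n \<ge> d" using an ba by (simp add: d_def)
    have d\<eta>: "4 * K \<le> d * \<eta>\<^sup>2"
    proof -
      have "4 * K \<le> 36 * K3\<^sup>2" using K K3sq by linarith
      also have "\<dots> = C / 2 * \<eta>\<^sup>2" using \<eta> by (simp add: C_def)
      also have "\<dots> \<le> d * \<eta>\<^sup>2" using dC by (intro mult_right_mono) auto
      finally show ?thesis .
    qed
    have \<delta>\<eta>: "6 * K3 * sqrt d \<le> \<delta> * \<eta>"
    proof (rule power2_le_imp_le)
      have "(6 * K3 * sqrt d)\<^sup>2 = C / 2 * d * \<eta>\<^sup>2"
        using \<eta> d1 by (simp add: C_def power_mult_distrib)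
      also have "\<dots> \<le> \<delta>\<^sup>2 * \<eta>\<^sup>2"
      proof (rule mult_right_mono)
        have "\<delta>\<^sup>2 = (a - b)\<^sup>2 / 4" by (simp add: \<delta>_def power_divide)
        thus "C / 2 * d \<le> \<delta>\<^sup>2" using sep by (simp add: d_def)
      qed simp
      finally show "(6 * K3 * sqrt d)\<^sup>2 \<le> (\<delta> * \<eta>)\<^sup>2" by (simp add: power_mult_distrib)
      show "0 \<le> \<delta> * \<eta>" using ba \<eta> by (simp add: \<delta>_def)
    qed
    let ?P = "\<lambda>E. let A = adjacency_mat n E;
              L = laplacian (regularized_adjacency (average_degree A) A)
          in \<forall>v. eigenvector L v (second_largest_eigenvalue L) \<longrightarrow>
               real (misclassified S v) \<le> \<epsilon> * real n"
    have "measure_pmf.prob (sbm n S a b) {E. ?P E} \<ge> 1 - (3 / n + 28 / \<kappa>)"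
    proof (rule typical_graph_probability[OF q \<kappa>])
      show "4 * (2 * \<kappa> + 2) \<le> d" using dK by (simp add: K_def)
      fix E assume "typical_graph n S a b E q (2 * \<kappa> + 2)"
      then interpret typical_graph n S a b E q K by (simp add: K_def)
      show "?P E" unfolding Let_def
      proof (intro allI impI)
        fix v
        assume "eigenvector (laplacian (regularized_adjacency (average_degree (adjacency_mat n E)) (adjacency_mat n E))) v
          (second_largest_eigenvalue (laplacian (regularized_adjacency (average_degree (adjacency_mat n E)) (adjacency_mat n E))))"
        from misclassified_second_eigenvector[OF \<eta>(1,2) d\<eta> \<delta>\<eta>[unfolded K3_def] this]
        have "real (misclassified S v) \<le> 8 * \<eta> * n" .
        also have "\<dots> \<le> \<epsilon> * n" using \<eta>(3) by (intro mult_right_mono) auto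
        finally show "real (misclassified S v) \<le> \<epsilon> * real n" .
      qed
    qed
    moreover have "3 / n + 28 / \<kappa> \<le> exp (- r)"
    proof -
      \<comment> \<open>The other half pays for \<open>3 / n\<close>: n is at least d, and d exceeds
        \<open>\<kappa>\<close> by the choice of \<open>C\<close>.\<close>
      have "6 * exp r \<le> \<kappa>" by (simp add: \<kappa>_def)
      also have "\<dots> \<le> real n" using K d36 nd by linarith
      finally have "3 / n \<le> 3 / (6 * exp r)" by (intro divide_left_mono) (use n in auto)
      moreover have "28 / \<kappa> = exp (- r) / 2" "3 / (6 * exp r) = exp (- r) / 2"
        by (simp_all add: \<kappa>_def exp_minus field_simps)
      ultimately show ?thesis by linarith
    qed
    ultimately show "1 - exp (- r) \<le> measure_pmf.prob (sbm n S a b) {E. ?P E}" by linarith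
  qed
qed

end
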